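(* Let $0<\alpha_2<\alpha_1<1$, $c_1>0$, $c_2\ge0$, $c_1+c_2=1$. For $n\ge1$ and $1\le s\le k$, the state probabilities of the mixed time-changed Erlang queue $\{\mathcal Q^{\alpha_1,\alpha_2}(t)\}_{t\ge0}$ are given, for $t>0$, by $$p_{n,s}^{\alpha_1,\alpha_2}(t)=\sum_{i=0}^\infty\frac{B_i^{n,s}}{c_1^{\delta_i^{n,s}}}\Big(c_1f_{\delta_i^{n,s}}^{*(\delta_i^{n,s})}(t)+c_2g_{\delta_i^{n,s}}^{*(\delta_i^{n,s})}(t)\Big)$$ $$+\sum_{i=0}^\infty\sum_{m=1}^\infty\sum_{r=0}^\infty\frac{C^{n,s}_{i,m,r}}{c_1^{\nu^{n,s}_{i,m,r}}}\Big(c_1f_{\nu^{n,s}_{i,m,r}}^{*(\nu^{n,s}_{i,m,r})}(t)+c_2g_{\nu^{n,s}_{i,m,r}}^{*(\nu^{n,s}_{i,m,r})}(t)\Big)-\sum_{i=0}^\infty\sum_{m=1}^\infty\sum_{r=0}^\infty\frac{D^{n,s}_{i,m,r}}{c_1^{\pi^{n,s}_{i,m,r}}}\Big(c_1f_{\pi^{n,s}_{i,m,r}}^{*(\pi^{n,s}_{i,m,r})}(t)+c_2g_{\pi^{n,s}_{i,m,r}}^{*(\pi^{n,s}_{i,m,r})}(t)\Big),$$ where $f^{*(N)}$ denotes the $N$-fold convolution of $f$, the constants $B,C,D,\delta,\nu,\pi$ are those defined in the context, and for $N\in\mathbb N$ $$f_N(t)=t^{\alpha_1-\frac{\alpha_1-1}{N}-1}\sum_{h=0}^\infty\Big(-\frac{c_2}{c_1}\Big)^ht^{(\alpha_1-\alpha_2)h}E^{h+1}_{\alpha_1,\,\alpha_1+(\alpha_1-\alpha_2)h+\frac{1-\alpha_1}{N}}\Big(-\frac{\lambda+k\mu}{c_1}t^{\alpha_1}\Big),$$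 $$g_N(t)=t^{\alpha_1-\frac{\alpha_2-1}{N}-1}\sum_{h=0}^\infty\Big(-\frac{c_2}{c_1}\Big)^ht^{(\alpha_1-\alpha_2)h}E^{h+1}_{\alpha_1,\,\alpha_1+(\alpha_1-\alpha_2)h+\frac{1-\alpha_2}{N}}\Big(-\frac{\lambda+k\mu}{c_1}t^{\alpha_1}\Big).$$
   Context: Parameters: $\lambda>0$, $\mu>0$, $k\in\mathbb N=\{1,2,\dots\}$. Erlang queue: single-server queue with Poisson arrivals of rate $\lambda$, each service consisting of $k$ successive phases, each exponential with parameter $k\mu$, all independent. $\mathcal Q(t)=(\mathcal N(t),\mathcal S(t))$, where $\mathcal N(t)$ is the number of customers in the system and $\mathcal S(t)$ is the phase of the customer being served if $\mathcal N(t)>0$ (phases are counted down: service starts at phase $k$ and ends upon completion of phase $1$), with $\mathcal S(t)=0$ if $\mathcal N(t)=0$. Thus $\mathcal Q$ is the continuous-time Markov chain on $\mathcal H_0=\mathcal H\cup\{(0,0)\}$, $\mathcal H=\{(n,s)\in\mathbb N\times\mathbb N: s\le k\}$, with $\mathcal Q(0)=(0,0)$ and transition rates: $(0,0)\to(1,k)$ at rate $\lambda$; $(n,s)\to(n+1,s)$ at rate $\lambda$; $(n,s)\to(n,s-1)$ at rate $k\mu$ if $s\ge2$; $(n,1)\to(n-1,k)$ at rate $k\mu$ if $n\ge2$; $(1,1)\to(0,0)$ at rate $k\mu$. Inverse mixed stable subordinator: $\{D_{\alpha_1,\alpha_2}(t)\}_{t\ge0}$ is the nondecreasing Lévy process (started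 at $0$) with $\mathbb E(e^{-zD_{\alpha_1,\alpha_2}(t)})=e^{-t(c_1z^{\alpha_1}+c_2z^{\alpha_2})}$, $z>0$; $Y_{\alpha_1,\alpha_2}(t)=\inf\{s\ge0:D_{\alpha_1,\alpha_2}(s)>t\}$, $t>0$, $Y_{\alpha_1,\alpha_2}(0)=0$. Mixed time-changed Erlang queue: $\mathcal Q^{\alpha_1,\alpha_2}(t)=\mathcal Q(Y_{\alpha_1,\alpha_2}(t))$, with $\mathcal Q$ and $Y_{\alpha_1,\alpha_2}$ independent. State probabilities: $p_{n,s}^{\alpha_1,\alpha_2}(t)=\Pr(\mathcal Q^{\alpha_1,\alpha_2}(t)=(n,s)\mid \mathcal Q^{\alpha_1,\alpha_2}(0)=(0,0))$, $(n,s)\in\mathcal H$. Constants: $a^0_{m,r}=m+r(k+1)$, $A^0_{m,r}=\frac{m\lambda^r(k\mu)^{m+rk-1}}{r!\,(m+rk)!}(m+r(k+1)-1)!$; $B_i^{n,s}=\frac{\lambda^{n+i}(k\mu)^{k(i+1)-s}}{(k(i+1)-s)!\,(n+i)!}(n+k-s+i(k+1))!$; $\delta_i^{n,s}=n-s+(i+1)(k+1)$; $C^{n,s}_{i,m,r}=k\mu B_i^{n,s}A^0_{m,r}$; $\nu^{n,s}_{i,m,r}=\delta_i^{n,s}+a^0_{m,r}$; $D^{n,s}_{i,m,r}=k\mu B_i^{n,s+1}A^0_{m,r}$ for $s=1,\dots,k-1$ and $D^{n,k}_{i,m,r}=k\mu B_i^{n+1,1}A^0_{m,r}$; $\pi^{n,s}_{i,m,r}=\delta_i^{n,s+1}+a^0_{m,r}$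 for $s=1,\dots,k-1$ and $\pi^{n,k}_{i,m,r}=\delta_i^{n+1,1}+a^0_{m,r}$. Three-parameter Mittag-Leffler function: $E^\gamma_{\alpha,\beta}(t)=\sum_{r=0}^\infty\frac{\Gamma(\gamma+r)t^r}{r!\,\Gamma(\gamma)\Gamma(\alpha r+\beta)}$, $t\in\mathbb R$, $\alpha,\beta,\gamma>0$. Convolution of functions on $(0,\infty)$: $(f*g)(t)=\int_0^tf(t-u)g(u)\,\mathrm du$, $f^{*(1)}=f$, $f^{*(N+1)}=f*f^{*(N)}$. Convention $0^0=1$. *)

theory Defs
  imports "HOL-Probability.Probability"
begin

section \<open>Continuous-time Markov chains\<close>

text \<open>
  A standard stochastic transition function on a countable set \<open>S\<close> whose off-diagonal rates are
  \<open>q x y\<close> and which is conservative, i.e. the total rate out of \<open>x\<close> is the sum of the \<open>q x y\<close>.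
  Only the values of \<open>q\<close> off the diagonal are used.
\<close>

definition transition_function ::
    "'s set \<Rightarrow> ('s \<Rightarrow> 's \<Rightarrow> real) \<Rightarrow> (real \<Rightarrow> 's \<Rightarrow> 's \<Rightarrow> real) \<Rightarrow> bool" where
  "transition_function S q P \<longleftrightarrow>
     (\<forall>t\<ge>0. \<forall>x\<in>S. \<forall>y\<in>S. 0 \<le> P t x y) \<and>
     (\<forall>t\<ge>0. \<forall>x\<in>S. (P t x has_sum 1) S) \<and>
     (\<forall>x\<in>S. \<forall>y\<in>S. P 0 x y = (if x = y then 1 else 0)) \<and>
     (\<forall>s\<ge>0. \<forall>t\<ge>0. \<forall>x\<in>S. \<forall>y\<in>S. ((\<lambda>z. P s x z * P t z y) has_sum P (s + t) x y) S) \<and>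
     (\<forall>x\<in>S. \<forall>y\<in>S. x \<noteq> y \<longrightarrow> ((\<lambda>h. P h x y / h) \<longlongrightarrow> q x y) (at_right 0)) \<and>
     (\<forall>x\<in>S. ((\<lambda>h. (1 - P h x x) / h) \<longlongrightarrow> (\<Sum>\<^sub>\<infinity>y\<in>S - {x}. q x y)) (at_right 0))"

text \<open>
  A time-homogeneous Markov chain with state space \<open>S\<close>, transition rates \<open>q\<close> and initial state
  \<open>x0\<close>, with paths that are right-continuous for the discrete topology on \<open>S\<close>.
\<close>

definition ctmc ::
    "'w measure \<Rightarrow> 's set \<Rightarrow> ('s \<Rightarrow> 's \<Rightarrow> real) \<Rightarrow> 's \<Rightarrow> (real \<Rightarrow> 'w \<Rightarrow> 's) \<Rightarrow> bool" where
  "ctmc M S q x0 X \<longleftrightarrow>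
     (\<forall>t\<ge>0. X t \<in> measurable M (count_space S)) \<and>
     (AE \<omega> in M. X 0 \<omega> = x0) \<and>
     (\<forall>\<omega>\<in>space M. \<forall>t\<ge>0. \<forall>\<^sub>F u in at_right t. X u \<omega> = X t \<omega>) \<and>
     (\<exists>P. transition_function S q P \<and>
        (\<forall>(n::nat) (\<tau> :: nat \<Rightarrow> real) (x :: nat \<Rightarrow> 's).
           0 \<le> \<tau> 0 \<longrightarrow> (\<forall>i\<le>n. \<tau> i < \<tau> (Suc i)) \<longrightarrow> (\<forall>i\<le>Suc n. x i \<in> S) \<longrightarrow>
           0 < \<P>(\<omega> in M. \<forall>i\<le>n. X (\<tau> i) \<omega> = x i) \<longrightarrow>
           \<P>(\<omega> in M. X (\<tau> (Suc n)) \<omega> = x (Suc n) \<bar> \<forall>i\<le>n. X (\<tau> i) \<omega> = x i)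
             = P (\<tau> (Suc n) - \<tau> n) (x n) (x (Suc n))))"


section \<open>The Erlang queue\<close>

text \<open>A state is a pair (number of customers in the system, current phase of service).\<close>

definition busy_states :: "nat \<Rightarrow> (nat \<times> nat) set" where
  "busy_states k = {(n, s). 1 \<le> n \<and> 1 \<le> s \<and> s \<le> k}"

definition queue_states :: "nat \<Rightarrow> (nat \<times> nat) set" where
  "queue_states k = insert (0, 0) (busy_states k)"

definition arrival :: "nat \<Rightarrow> nat \<times> nat \<Rightarrow> nat \<times> nat \<Rightarrow> bool" where
  "arrival k x y \<longleftrightarrow>
     x = (0, 0) \<and> y = (1, k) \<or>
     (\<exists>n s. (n, s) \<in> busy_states k \<and> x = (n, s) \<and> y = (n + 1, s))"

definition phase_completion :: "nat \<Rightarrow> nat \<times> nat \<Rightarrow> nat \<times> nat \<Rightarrow> bool" where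
  "phase_completion k x y \<longleftrightarrow>
     (\<exists>n s. (n, s) \<in> busy_states k \<and> 2 \<le> s \<and> x = (n, s) \<and> y = (n, s - 1)) \<or>
     (\<exists>n\<ge>2. x = (n, 1) \<and> y = (n - 1, k)) \<or>
     x = (1, 1) \<and> y = (0, 0)"

definition erlang_rate :: "real \<Rightarrow> real \<Rightarrow> nat \<Rightarrow> nat \<times> nat \<Rightarrow> nat \<times> nat \<Rightarrow> real" where
  "erlang_rate lam mu k x y =
     (if arrival k x y then lam else if phase_completion k x y then real k * mu else 0)"

definition erlang_queue ::
    "'w measure \<Rightarrow> real \<Rightarrow> real \<Rightarrow> nat \<Rightarrow> (real \<Rightarrow> 'w \<Rightarrow> nat \<times> nat) \<Rightarrow> bool" where
  "erlang_queue M lam mu k Q \<longleftrightarrow> ctmc M (queue_states k) (erlang_rate lam mu k) (0, 0) Q"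


section \<open>The mixed stable subordinator and its inverse\<close>

definition levy_process :: "'w measure \<Rightarrow> (real \<Rightarrow> 'w \<Rightarrow> real) \<Rightarrow> bool" where
  "levy_process M X \<longleftrightarrow>
     (\<forall>t\<ge>0. X t \<in> borel_measurable M) \<and>
     (AE \<omega> in M. X 0 \<omega> = 0) \<and>
     (\<forall>(n::nat) (\<tau> :: nat \<Rightarrow> real). 0 \<le> \<tau> 0 \<longrightarrow> (\<forall>i<n. \<tau> i \<le> \<tau> (Suc i)) \<longrightarrow>
        prob_space.indep_vars M (\<lambda>_. borel) (\<lambda>i \<omega>. X (\<tau> (Suc i)) \<omega> - X (\<tau> i) \<omega>) {..<n}) \<and>
     (\<forall>s\<ge>0. \<forall>t\<ge>0. distr M borel (\<lambda>\<omega>. X (s + t) \<omega> - X s \<omega>) = distr M borel (X t)) \<and>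
     (\<forall>\<omega>\<in>space M. \<forall>t\<ge>0. ((\<lambda>u. X u \<omega>) \<longlongrightarrow> X t \<omega>) (at_right t)) \<and>
     (\<forall>\<omega>\<in>space M. \<forall>t>0. \<exists>l. ((\<lambda>u. X u \<omega>) \<longlongrightarrow> l) (at_left t))"

definition mixed_stable_subordinator ::
    "'w measure \<Rightarrow> real \<Rightarrow> real \<Rightarrow> real \<Rightarrow> real \<Rightarrow> (real \<Rightarrow> 'w \<Rightarrow> real) \<Rightarrow> bool" where
  "mixed_stable_subordinator M \<alpha>1 \<alpha>2 c1 c2 D \<longleftrightarrow>
     levy_process M D \<and>
     (\<forall>\<omega>\<in>space M. mono_on {0..} (\<lambda>t. D t \<omega>)) \<and>
     (\<forall>t\<ge>0. \<forall>z>0. prob_space.expectation M (\<lambda>\<omega>. exp (- z * D t \<omega>))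
                     = exp (- t * (c1 * z powr \<alpha>1 + c2 * z powr \<alpha>2)))"

text \<open>
  The first-passage time of a mixed stable subordinator above a level is almost surely finite.
  On the exceptional null event the infimum is infinite; the value \<open>0\<close> there is arbitrary.
\<close>

definition inverse_process :: "(real \<Rightarrow> 'w \<Rightarrow> real) \<Rightarrow> real \<Rightarrow> 'w \<Rightarrow> real" where
  "inverse_process D t \<omega> =
     (if 0 < t \<and> (\<exists>s\<ge>0. t < D s \<omega>) then Inf {s. 0 \<le> s \<and> t < D s \<omega>} else 0)"

definition process_events ::
    "'w measure \<Rightarrow> 's measure \<Rightarrow> (real \<Rightarrow> 'w \<Rightarrow> 's) \<Rightarrow> 'w set set" where
  "process_events M N X =
     sigma_sets (space M) {X t -` A \<inter> space M | t A. 0 \<le> t \<and> A \<in> sets N}"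


section \<open>The time-changed queue\<close>

definition time_change :: "(real \<Rightarrow> 'w \<Rightarrow> 's) \<Rightarrow> (real \<Rightarrow> 'w \<Rightarrow> real) \<Rightarrow> real \<Rightarrow> 'w \<Rightarrow> 's" where
  "time_change Q Y t \<omega> = Q (Y t \<omega>) \<omega>"

definition state_prob ::
    "'w measure \<Rightarrow> (real \<Rightarrow> 'w \<Rightarrow> nat \<times> nat) \<Rightarrow> nat \<Rightarrow> nat \<Rightarrow> real \<Rightarrow> real" where
  "state_prob M X n s t = \<P>(\<omega> in M. X t \<omega> = (n, s) \<bar> X 0 \<omega> = (0, 0))"


section \<open>Constants\<close>

text \<open>
  All subtractions below are on natural numbers; they do not truncate for \<open>1 \<le> m\<close> and
  \<open>1 \<le> s \<le> k\<close>.
\<close>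

definition a0_exp :: "nat \<Rightarrow> nat \<Rightarrow> nat \<Rightarrow> nat" where
  "a0_exp k m r = m + r * (k + 1)"

definition A0_coeff :: "real \<Rightarrow> real \<Rightarrow> nat \<Rightarrow> nat \<Rightarrow> nat \<Rightarrow> real" where
  "A0_coeff lam mu k m r =
     real m * lam ^ r * (real k * mu) ^ (m + r * k - 1) / (fact r * fact (m + r * k))
       * fact (m + r * (k + 1) - 1)"

definition B_coeff :: "real \<Rightarrow> real \<Rightarrow> nat \<Rightarrow> nat \<Rightarrow> nat \<Rightarrow> nat \<Rightarrow> real" where
  "B_coeff lam mu k n s i =
     lam ^ (n + i) * (real k * mu) ^ (k * (i + 1) - s) / (fact (k * (i + 1) - s) * fact (n + i))
       * fact (n + k + i * (k + 1) - s)"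

definition delta_exp :: "nat \<Rightarrow> nat \<Rightarrow> nat \<Rightarrow> nat \<Rightarrow> nat" where
  "delta_exp k n s i = n + (i + 1) * (k + 1) - s"

definition C_coeff :: "real \<Rightarrow> real \<Rightarrow> nat \<Rightarrow> nat \<Rightarrow> nat \<Rightarrow> nat \<Rightarrow> nat \<Rightarrow> nat \<Rightarrow> real" where
  "C_coeff lam mu k n s i m r = real k * mu * B_coeff lam mu k n s i * A0_coeff lam mu k m r"

definition nu_exp :: "nat \<Rightarrow> nat \<Rightarrow> nat \<Rightarrow> nat \<Rightarrow> nat \<Rightarrow> nat \<Rightarrow> nat" where
  "nu_exp k n s i m r = delta_exp k n s i + a0_exp k m r"

definition D_coeff :: "real \<Rightarrow> real \<Rightarrow> nat \<Rightarrow> nat \<Rightarrow> nat \<Rightarrow> nat \<Rightarrow> nat \<Rightarrow> nat \<Rightarrow> real" where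
  "D_coeff lam mu k n s i m r =
     (if s < k then real k * mu * B_coeff lam mu k n (s + 1) i * A0_coeff lam mu k m r
      else real k * mu * B_coeff lam mu k (n + 1) 1 i * A0_coeff lam mu k m r)"

definition pi_exp :: "nat \<Rightarrow> nat \<Rightarrow> nat \<Rightarrow> nat \<Rightarrow> nat \<Rightarrow> nat \<Rightarrow> nat" where
  "pi_exp k n s i m r = (if s < k then delta_exp k n (s + 1) i else delta_exp k (n + 1) 1 i) + a0_exp k m r"


section \<open>Mittag-Leffler functions and convolution powers\<close>

definition mittag_leffler :: "real \<Rightarrow> real \<Rightarrow> real \<Rightarrow> real \<Rightarrow> real" where
  "mittag_leffler \<gamma> \<alpha> \<beta> t =
     (\<Sum>r. Gamma (\<gamma> + real r) * t ^ r / (fact r * Gamma \<gamma> * Gamma (\<alpha> * real r + \<beta>)))"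

definition fun_convolution :: "(real \<Rightarrow> real) \<Rightarrow> (real \<Rightarrow> real) \<Rightarrow> real \<Rightarrow> real" where
  "fun_convolution f g t = (LINT u:{0<..<t}|lborel. f (t - u) * g u)"

text \<open>\<open>conv_power f N\<close> is the \<open>N\<close>-fold convolution of \<open>f\<close> for \<open>1 \<le> N\<close>; \<open>N = 0\<close> is irrelevant.\<close>

definition conv_power :: "(real \<Rightarrow> real) \<Rightarrow> nat \<Rightarrow> real \<Rightarrow> real" where
  "conv_power f N = (fun_convolution f ^^ (N - 1)) f"

text \<open>In the two kernels \<open>\<Lambda>\<close> stands for \<open>lam + k * mu\<close>.\<close>

definition f_kernel ::
    "real \<Rightarrow> real \<Rightarrow> real \<Rightarrow> real \<Rightarrow> real \<Rightarrow> nat \<Rightarrow> real \<Rightarrow> real" where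
  "f_kernel \<Lambda> \<alpha>1 \<alpha>2 c1 c2 N t =
     t powr (\<alpha>1 - (\<alpha>1 - 1) / real N - 1) *
     (\<Sum>h. (- (c2 / c1)) ^ h * t powr ((\<alpha>1 - \<alpha>2) * real h) *
        mittag_leffler (real h + 1) \<alpha>1 (\<alpha>1 + (\<alpha>1 - \<alpha>2) * real h + (1 - \<alpha>1) / real N)
          (- (\<Lambda> / c1) * t powr \<alpha>1))"

definition g_kernel ::
    "real \<Rightarrow> real \<Rightarrow> real \<Rightarrow> real \<Rightarrow> real \<Rightarrow> nat \<Rightarrow> real \<Rightarrow> real" where
  "g_kernel \<Lambda> \<alpha>1 \<alpha>2 c1 c2 N t =
     t powr (\<alpha>1 - (\<alpha>2 - 1) / real N - 1) *
     (\<Sum>h. (- (c2 / c1)) ^ h * t powr ((\<alpha>1 - \<alpha>2) * real h) *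
        mittag_leffler (real h + 1) \<alpha>1 (\<alpha>1 + (\<alpha>1 - \<alpha>2) * real h + (1 - \<alpha>2) / real N)
          (- (\<Lambda> / c1) * t powr \<alpha>1))"

definition mixed_conv ::
    "real \<Rightarrow> real \<Rightarrow> real \<Rightarrow> real \<Rightarrow> real \<Rightarrow> nat \<Rightarrow> real \<Rightarrow> real" where
  "mixed_conv \<Lambda> \<alpha>1 \<alpha>2 c1 c2 N t =
     c1 * conv_power (f_kernel \<Lambda> \<alpha>1 \<alpha>2 c1 c2 N) N t +
     c2 * conv_power (g_kernel \<Lambda> \<alpha>1 \<alpha>2 c1 c2 N) N t"

end

theory Submission
  imports Defs
begin

text \<open>
  Let \<open>\<Lambda> = lam + k mu\<close> and \<open>\<psi> z = c1 z powr \<alpha>1 + c2 z powr \<alpha>2\<close>. The resolvent of the queue satisfies the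
  equation of a random walk with steps \<open>+ k\<close> and \<open>- 1\<close>, corrected by a boundary term at the empty state.
  Pairing it with lattice path series expands it in powers of \<open>1 / (z + \<Lambda>)\<close>, so that the transition
  probabilities are series in the functions \<open>y ^ (N - 1) exp (- \<Lambda> y) / (N - 1)!\<close> with the coefficients
  \<open>B\<close>, \<open>C\<close> and \<open>D\<close>. By independence the state probabilities are the expectations of these series at
  \<open>y = Y t\<close>, and \<open>Y t\<close> has exponential moments. Finally the expectation of the \<open>N\<close>-th function, as a
  function of \<open>t\<close>, has Laplace transform \<open>(\<psi> z / z) / (\<psi> z + \<Lambda>) ^ N\<close>, and so has the \<open>N\<close>-fold
  convolution divided by \<open>c1 ^ N\<close>; both are right-continuous, hence equal for every \<open>t\<close>.
\<close>

text \<open>The constant \<theta> = 1 / (4 \<Lambda>) governs convergence. The coefficients count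
  lattice paths, at most 2 ^ N with N steps, times a product of rates. For 0 \<le> x \<le> \<theta>
  the N-step paths together weigh at most (1 / 2) ^ N, and all series converge geometrically. With x
  = 1 / (z + \<Lambda>) this yields transforms for large z only, so uniqueness has to work from an
  arbitrary threshold \<open>z0\<close>. At x = \<theta> the same estimate dominates the series in
  time, because y ^ (N - 1) / (N - 1)! is at most \<theta> ^ (N - 1) exp (y / \<theta>). Exchanging
  sum and expectation therefore costs an exponential moment of Y t of order 1 / \<theta>; it is
  finite because \<psi> is unbounded. The three series are kept apart since each has nonnegative
  terms, so that comparison applies to each of them; signs enter only in the final combination. The
  definition of a transition function gives derivatives at time 0 only. The resolvent equation is
  thus obtained by differentiating the semigroup identity, after the transform in t, in its second
  time argument.\<close>

section \<open>Laplace transforms\<close>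

text \<open>Existence of the integral is part of the predicate, so sums, differences and
  convolutions carry their integrability along. Only the values of \<open>f\<close> on the open
  half-line enter.\<close>

definition has_laplace :: "(real \<Rightarrow> real) \<Rightarrow> real \<Rightarrow> real \<Rightarrow> bool" where
  "has_laplace f z L \<longleftrightarrow>
     has_bochner_integral lborel (\<lambda>t. indicator {0<..} t * (exp (- (z * t)) * f t)) L"

lemma has_laplace_cong:
  assumes "has_laplace f z L" "\<And>t. 0 < t \<Longrightarrow> f t = g t"
  shows "has_laplace g z L"
proof -
  have "(\<lambda>t. indicator {0<..} t * (exp (- (z * t)) * f t)) = (\<lambda>t. indicator {0<..} t * (exp (- (z * t)) * g t))"
    using assms(2) by (auto simp: fun_eq_iff indicator_def)
  then show ?thesis using assms(1) by (simp add: has_laplace_def)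
qed

lemma has_laplace_cmult: "has_laplace f z L \<Longrightarrow> has_laplace (\<lambda>t. c * f t) z (c * L)"
  using has_bochner_integral_mult_right[of c lborel
    "\<lambda>t. indicator {0<..} t * (exp (- (z * t)) * f t)" L]
  by (simp add: has_laplace_def mult_ac)

lemma has_laplace_add:
  "has_laplace f z L \<Longrightarrow> has_laplace g z K \<Longrightarrow> has_laplace (\<lambda>t. f t + g t) z (L + K)"
  unfolding has_laplace_def by (drule (1) has_bochner_integral_add) (simp add: algebra_simps)

lemma has_laplace_diff:
  "has_laplace f z L \<Longrightarrow> has_laplace g z K \<Longrightarrow> has_laplace (\<lambda>t. f t - g t) z (L - K)"
  unfolding has_laplace_def by (drule (1) has_bochner_integral_diff) (simp add: algebra_simps)

lemma has_laplace_nonneg: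
  assumes "has_laplace f z L" "\<And>t. 0 < t \<Longrightarrow> 0 \<le> f t"
  shows "0 \<le> L"
proof -
  have "L = (\<integral>t. indicator {0<..} t * (exp (- (z * t)) * f t) \<partial>lborel)"
    using assms(1) by (simp add: has_laplace_def has_bochner_integral_integral_eq)
  also have "\<dots> \<ge> 0"
    using assms(2) by (intro integral_nonneg_AE AE_I2) (auto simp: indicator_def)
  finally show ?thesis .
qed

text \<open>
  By Stone--Weierstrass a vanishing Laplace transform kills every integral of \<open>d t\<close> against
  \<open>exp (- z0 t) \<phi> (exp (- t))\<close> with \<open>\<phi>\<close> continuous on \<open>[0, 1]\<close>; take for \<open>\<phi>\<close> a bump that is
  supported where \<open>d\<close> is positive.
\<close>

lemma laplace_zero_imp_nonpos:
  assumes L: "\<And>z. z0 \<le> z \<Longrightarrow> has_laplace d z 0"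
    and cont: "(d \<longlongrightarrow> d t0) (at_right t0)" and t0: "0 < t0"
  shows "d t0 \<le> 0"
proof (rule ccontr)
  assume "\<not> d t0 \<le> 0"
  then have "\<forall>\<^sub>F t in at_right t0. 0 < d t"
    using cont by (intro order_tendstoD(1)[OF cont]) auto
  then obtain b where b: "t0 < b" "\<And>t. t0 < t \<Longrightarrow> t < b \<Longrightarrow> 0 < d t"
    unfolding eventually_at_right_field by auto
  define w where "w = (\<lambda>t. indicator {0<..} t * (exp (- (z0 * t)) * d t))"
  have w_int: "integrable lborel w"
    using L[of z0] by (auto simp: has_laplace_def w_def has_bochner_integral_iff)
  have w_meas[measurable]: "w \<in> borel_measurable lborel" using w_int by auto
  \<comment> \<open>Only the transforms at z0 + i with natural i are used: each contributes the
    monomial exp (- t) ^ i against the weight \<open>w\<close>.\<close>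
  have poly: "has_bochner_integral lborel (\<lambda>t. p (exp (-t)) * w t) 0"
    if "real_polynomial_function p" for p
  proof -
    from that obtain a n where p: "p = (\<lambda>x. \<Sum>i\<le>n. a i * x ^ i)"
      unfolding real_polynomial_function_iff_sum by auto
    have "has_bochner_integral lborel
        (\<lambda>t. \<Sum>i\<le>n. a i * (indicator {0<..} t * (exp (- ((z0 + real i) * t)) * d t))) (\<Sum>i\<le>n. a i * 0)"
      by (intro has_bochner_integral_sum has_bochner_integral_mult_right
          L[unfolded has_laplace_def]) auto
    moreover have "(\<Sum>i\<le>n. a i * (indicator {0<..} t * (exp (- ((z0 + real i) * t)) * d t))) = p (exp (-t)) * w t" for t
    proof -
      have e: "exp (- ((z0 + real i) * t)) = exp (- t) ^ i * exp (- (z0 * t))" for i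
        by (simp add: exp_of_nat_mult[symmetric] exp_add[symmetric] algebra_simps)
      show ?thesis
        unfolding p w_def sum_distrib_right e by (intro sum.cong refl) (simp only: mult_ac)
    qed
    ultimately show ?thesis by simp
  qed
  define \<phi> where "\<phi> = (\<lambda>x::real. max 0 ((x - exp (-b)) * (exp (-t0) - x)))"
  have \<phi>_cont: "continuous_on A \<phi>" for A
    unfolding \<phi>_def by (intro continuous_intros)
  have [measurable]: "\<phi> \<in> borel_measurable borel"
    using \<phi>_cont by (intro borel_measurable_continuous_onI)
  have \<phi>_pos: "0 < \<phi> (exp (-t)) \<longleftrightarrow> t0 < t \<and> t < b" for t
  proof -
    have "0 < \<phi> (exp (-t)) \<longleftrightarrow> 0 < (exp (-t) - exp (-b)) * (exp (-t0) - exp (-t))"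
      by (auto simp: \<phi>_def)
    also have "\<dots> \<longleftrightarrow> (t0 < t \<and> t < b) \<or> (t < t0 \<and> b < t)"
      by (simp add: zero_less_mult_iff conj_commute)
    finally show ?thesis using b by auto
  qed
  have \<phi>_nonneg: "0 \<le> \<phi> x" for x by (simp add: \<phi>_def)
  define W where "W = (\<integral>t. \<bar>w t\<bar> \<partial>lborel)"
  have approx: "\<bar>\<integral>t. \<phi> (exp (-t)) * w t \<partial>lborel\<bar> \<le> e * W
      \<and> integrable lborel (\<lambda>t. \<phi> (exp (-t)) * w t)" if e: "0 < e" for e
  proof -
    obtain p where p: "real_polynomial_function p" "\<And>x. x \<in> {0..1} \<Longrightarrow> \<bar>\<phi> x - p x\<bar> < e"
      using Stone_Weierstrass_real_polynomial_function[OF compact_Icc[of 0 1] \<phi>_cont e] by blast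
    have [measurable]: "p \<in> borel_measurable borel"
      using p(1) continuous_real_polymonial_function[OF p(1)]
      by (intro borel_measurable_continuous_onI continuous_at_imp_continuous_on) auto
    have bnd: "\<bar>(\<phi> (exp (-t)) - p (exp (-t))) * w t\<bar> \<le> e * \<bar>w t\<bar>" for t
    proof (cases "0 < t")
      case True
      then have "\<bar>\<phi> (exp (-t)) - p (exp (-t))\<bar> \<le> e" using p(2)[of "exp (-t)"] by simp
      then show ?thesis by (simp add: abs_mult mult_right_mono)
    qed (simp add: w_def)
    have i1: "integrable lborel (\<lambda>t. (\<phi> (exp (-t)) - p (exp (-t))) * w t)"
      by (rule Bochner_Integration.integrable_bound[of _ "\<lambda>t. e * \<bar>w t\<bar>"])
        (use w_int bnd e in \<open>auto simp: abs_mult intro!: integrable_mult_right\<close>)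
    have i2: "has_bochner_integral lborel (\<lambda>t. p (exp (-t)) * w t) 0" by (rule poly) fact
    have eq: "\<phi> (exp (-t)) * w t = (\<phi> (exp (-t)) - p (exp (-t))) * w t + p (exp (-t)) * w t" for t
      by (simp add: algebra_simps)
    have "has_bochner_integral lborel (\<lambda>t. \<phi> (exp (-t)) * w t)
       ((\<integral>t. (\<phi> (exp (-t)) - p (exp (-t))) * w t \<partial>lborel) + 0)"
      unfolding eq by (intro has_bochner_integral_add has_bochner_integral_integrable i1 i2)
    moreover have "\<bar>\<integral>t. (\<phi> (exp (-t)) - p (exp (-t))) * w t \<partial>lborel\<bar> \<le> (\<integral>t. e * \<bar>w t\<bar> \<partial>lborel)"
    proof (rule order_trans[OF integral_abs_bound])
      show "(\<integral>t. \<bar>(\<phi> (exp (-t)) - p (exp (-t))) * w t\<bar> \<partial>lborel) \<le> (\<integral>t. e * \<bar>w t\<bar> \<partial>lborel)"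
        by (rule integral_mono) (use i1 w_int bnd in auto)
    qed
    ultimately show ?thesis by (auto simp: has_bochner_integral_iff W_def)
  qed
  have int: "integrable lborel (\<lambda>t. \<phi> (exp (-t)) * w t)" using approx[of 1] by simp
  have "\<bar>\<integral>t. \<phi> (exp (-t)) * w t \<partial>lborel\<bar> \<le> 0"
  proof (rule field_le_epsilon)
    fix e :: real assume e: "0 < e"
    have W: "0 \<le> W" by (simp add: W_def)
    have "\<bar>\<integral>t. \<phi> (exp (-t)) * w t \<partial>lborel\<bar> \<le> (e / (W + 1)) * W"
      using approx[of "e / (W + 1)"] e W by simp
    also have "\<dots> \<le> e" using e W by (simp add: field_simps)
    finally show "\<bar>\<integral>t. \<phi> (exp (-t)) * w t \<partial>lborel\<bar> \<le> 0 + e" by simp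
  qed
  then have zero: "(\<integral>t. \<phi> (exp (-t)) * w t \<partial>lborel) = 0" by simp
  have nonneg: "0 \<le> \<phi> (exp (-t)) * w t" for t
  proof (cases "t0 < t \<and> t < b")
    case True
    then show ?thesis using b(2)[of t] \<phi>_nonneg by (auto simp: w_def indicator_def)
  next
    case False
    then have "\<phi> (exp (-t)) = 0" using \<phi>_pos[of t] \<phi>_nonneg[of "exp (-t)"] by linarith
    then show ?thesis by simp
  qed
  have "AE t in lborel. \<phi> (exp (-t)) * w t = 0"
    using integral_nonneg_eq_0_iff_AE[OF int] nonneg zero by simp
  then have "AE t in lborel. t \<notin> {t0<..<b}"
  proof eventually_elim
    case (elim t)
    then show ?case using \<phi>_pos[of t] b(2)[of t] t0 by (auto simp: w_def)
  qed
  then have "emeasure lborel {t0<..<b} = 0"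
    by (subst (asm) AE_iff_measurable[of "{t0<..<b}"]) auto
  then show False using b(1) by simp
qed

text \<open>Both differences have transform 0, so the one-sided bound applies twice.
  Right-continuity at the single point t upgrades equality almost everywhere to equality at
  t.\<close>

lemma has_laplace_unique:
  assumes "\<And>z. z0 \<le> z \<Longrightarrow> has_laplace f z (F z)" "\<And>z. z0 \<le> z \<Longrightarrow> has_laplace g z (F z)"
    and "(f \<longlongrightarrow> f t) (at_right t)" "(g \<longlongrightarrow> g t) (at_right t)" and "0 < t"
  shows "f t = g t"
proof (rule antisym)
  have *: "f t - g t \<le> 0"
    if "\<And>z. z0 \<le> z \<Longrightarrow> has_laplace f z (F z)" "\<And>z. z0 \<le> z \<Longrightarrow> has_laplace g z (F z)"
      "(f \<longlongrightarrow> f t) (at_right t)" "(g \<longlongrightarrow> g t) (at_right t)" for f g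
    using laplace_zero_imp_nonpos[of z0 "\<lambda>t. f t - g t" t]
      has_laplace_diff[OF that(1,2)] tendsto_diff[OF that(3,4)] \<open>0 < t\<close> by simp
  show "f t \<le> g t" "g t \<le> f t" using *[OF assms(1-4)] *[OF assms(2,1,4,3)] by auto
qed

text \<open>An enumeration of the infinite countable index type reduces the exchange to the one for
  series. Unordered sums are used because the same statement must serve single and triple
  indices.\<close>

lemma has_bochner_integral_infsum:
  fixes f :: "'i::countable \<Rightarrow> 'a \<Rightarrow> real"
  assumes inf: "infinite (UNIV :: 'i set)"
    and int: "\<And>i. integrable M (f i)"
    and norms: "(\<lambda>i. \<integral>x. \<bar>f i x\<bar> \<partial>M) summable_on UNIV"
    and ptw: "\<And>x. x \<in> space M \<Longrightarrow> (\<lambda>i. f i x) summable_on UNIV"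
  shows "has_bochner_integral M (\<lambda>x. \<Sum>\<^sub>\<infinity>i. f i x) (\<Sum>\<^sub>\<infinity>i. \<integral>x. f i x \<partial>M)"
proof -
  define e where "e = from_nat_into (UNIV :: 'i set)"
  have e: "bij_betw e UNIV UNIV" unfolding e_def by (intro bij_betw_from_nat_into inf) auto
  have sums_e: "(\<lambda>n. h (e n)) sums infsum h UNIV" if "h summable_on UNIV" for h :: "'i \<Rightarrow> real"
    using that has_sum_reindex_bij_betw[OF e, of h] by (intro has_sum_imp_sums) auto
  have summ: "summable (\<lambda>n. norm (f (e n) x))" if "x \<in> space M" for x
    using sums_e[OF summable_on_iff_abs_summable_on_real[THEN iffD1, OF ptw[OF that]]]
    by (simp add: sums_iff)
  have summ_int: "summable (\<lambda>n. \<integral>x. norm (f (e n) x) \<partial>M)"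
    using sums_e[OF norms] by (auto simp: sums_iff)
  have I: "(\<lambda>i. \<integral>x. f i x \<partial>M) summable_on UNIV"
    by (rule summable_on_iff_abs_summable_on_real[THEN iffD2],
        rule summable_on_comparison_test[OF norms]) (auto intro: integral_abs_bound)
  note * = integrable_suminf[of M "\<lambda>n. f (e n)", OF int _ summ_int]
    integral_suminf[of M "\<lambda>n. f (e n)", OF int _ summ_int]
  have "(\<Sum>n. f (e n) x) = (\<Sum>\<^sub>\<infinity>i. f i x)" if "x \<in> space M" for x
    using sums_e[OF ptw[OF that]] by (simp add: sums_iff)
  moreover have "(\<Sum>n. \<integral>x. f (e n) x \<partial>M) = (\<Sum>\<^sub>\<infinity>i. \<integral>x. f i x \<partial>M)"
    using sums_e[OF I] by (simp add: sums_iff)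
  moreover have "has_bochner_integral M (\<lambda>x. \<Sum>n. f (e n) x) (\<Sum>n. \<integral>x. f (e n) x \<partial>M)"
    using * summ by (simp add: has_bochner_integral_iff)
  ultimately show ?thesis
    by (subst has_bochner_integral_cong[OF refl]) auto
qed

lemma has_laplace_infsum:
  fixes f :: "'i::countable \<Rightarrow> real \<Rightarrow> real"
  assumes inf: "infinite (UNIV :: 'i set)"
    and L: "\<And>i. has_laplace (f i) z (L i)" "\<And>i. has_laplace (\<lambda>t. \<bar>f i t\<bar>) z (K i)"
    and norms: "K summable_on UNIV"
    and ptw: "\<And>t. 0 < t \<Longrightarrow> (\<lambda>i. f i t) summable_on UNIV"
  shows "has_laplace (\<lambda>t. \<Sum>\<^sub>\<infinity>i. f i t) z (\<Sum>\<^sub>\<infinity>i. L i)"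
proof -
  define w where "w = (\<lambda>i t. indicator {0<..} t * (exp (- (z * t)) * f i t))"
  have w_eq: "indicator {0<..} t * (exp (- (z * t)) * \<bar>f i t\<bar>) = \<bar>w i t\<bar>" for i t
    by (simp add: w_def abs_mult)
  have "has_bochner_integral lborel (\<lambda>t. \<Sum>\<^sub>\<infinity>i. w i t) (\<Sum>\<^sub>\<infinity>i. \<integral>t. w i t \<partial>lborel)"
  proof (rule has_bochner_integral_infsum[OF inf])
    show "integrable lborel (w i)" for i
      using L(1)[of i] by (simp add: has_laplace_def w_def has_bochner_integral_iff)
    have "(\<integral>x. \<bar>w i x\<bar> \<partial>lborel) = K i" for i
      using L(2)[of i] unfolding has_laplace_def w_eq by (simp only: has_bochner_integral_iff)
    then show "(\<lambda>i. \<integral>x. \<bar>w i x\<bar> \<partial>lborel) summable_on UNIV" using norms by simp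
    show "(\<lambda>i. w i t) summable_on UNIV" for t
      using ptw[of t] by (cases "0 < t") (auto simp: w_def intro!: summable_on_cmult_right)
  qed
  moreover have "(\<integral>t. w i t \<partial>lborel) = L i" for i
    using L(1)[of i] by (simp add: has_laplace_def w_def has_bochner_integral_iff)
  moreover have "(\<Sum>\<^sub>\<infinity>i. w i t) = indicator {0<..} t * (exp (- (z * t)) * (\<Sum>\<^sub>\<infinity>i. f i t))" for t
    by (cases "0 < t") (simp_all add: w_def infsum_cmult_right')
  ultimately show ?thesis by (simp add: has_laplace_def)
qed

text \<open>Euler's integral for Gamma with the variable scaled by z; the factor z powr (1 - b)
  undoes the scaling of the integrand's power.\<close>

lemma has_laplace_powr:
  assumes b: "0 < b" and z: "0 < z"
  shows "has_laplace (\<lambda>t. t powr (b - 1) / Gamma b) z (z powr (- b))"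
proof -
  define G where "G = (\<lambda>t::real. indicator {0..} t * t powr (b - 1) / exp t)"
  have "has_bochner_integral lborel G (Gamma b)"
    unfolding G_def using Gamma_conv_nn_integral_real[OF b] Gamma_real_pos[OF b]
    by (intro has_bochner_integral_nn_integral) (auto simp: less_imp_le)
  then have "has_bochner_integral lborel (\<lambda>t. G (0 + z * t)) (Gamma b /\<^sub>R \<bar>z\<bar>)"
    using z by (subst (asm) lborel_has_bochner_integral_real_affine_iff[of z _ _ 0]) auto
  then have "has_bochner_integral lborel (\<lambda>t. (z powr (1 - b) / Gamma b) * G (0 + z * t)) ((z powr (1 - b) / Gamma b) * (Gamma b /\<^sub>R \<bar>z\<bar>))"
    by (intro has_bochner_integral_mult_right) auto
  moreover have "(z powr (1 - b) / Gamma b) * G (0 + z * t) = indicator {0<..} t * (exp (- (z * t)) * (t powr (b - 1) / Gamma b))" for t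
  proof (cases "0 < t")
    case True
    have "z powr (1 - b) * (z powr (b - 1) * t powr (b - 1)) = t powr (b - 1)"
      using z by (simp add: powr_add[symmetric] mult.assoc[symmetric])
    then show ?thesis using True z
      by (simp add: G_def powr_mult exp_minus field_simps)
  next
    case False
    then show ?thesis using z by (cases "t = 0") (auto simp: G_def indicator_def zero_le_mult_iff)
  qed
  moreover have "(z powr (1 - b) / Gamma b) * (Gamma b /\<^sub>R \<bar>z\<bar>) = z powr (- b)"
  proof -
    have "z powr (1 - b) = z * z powr (- b)" using z by (simp add: powr_diff powr_minus field_simps)
    then show ?thesis using z Gamma_real_pos[OF b] by (simp add: field_simps)
  qed
  ultimately show ?thesis unfolding has_laplace_def by (simp only:)
qed

section \<open>Phase densities and their transforms\<close>

lemma has_laplace_shift: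
  "has_laplace (\<lambda>t. exp (- (c * t)) * f t) z L \<longleftrightarrow> has_laplace f (z + c) L"
proof -
  have "exp (- (z * t)) * (exp (- (c * t)) * f t) = exp (- ((z + c) * t)) * f t" for t
    by (simp add: distrib_right exp_add[symmetric] mult.assoc[symmetric])
  then show ?thesis unfolding has_laplace_def by (simp only:)
qed

text \<open>For 1 \<le> N, the Erlang density of shape N and rate \<Lambda> without its factor
  \<Lambda> ^ N, so that its transform is exactly a power of 1 / (z + \<Lambda>).\<close>

definition phase_density :: "real \<Rightarrow> nat \<Rightarrow> real \<Rightarrow> real" where
  "phase_density \<Lambda> N t = t ^ (N - 1) * exp (- (\<Lambda> * t)) / fact (N - 1)"

lemma phase_density_measurable [measurable]: "phase_density \<Lambda> N \<in> borel_measurable borel"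
  unfolding phase_density_def by measurable

lemma phase_density_nonneg: "0 \<le> t \<Longrightarrow> 0 \<le> phase_density \<Lambda> N t"
  by (simp add: phase_density_def)

lemma has_laplace_phase_density:
  assumes "1 \<le> N" "0 < z + \<Lambda>"
  shows "has_laplace (phase_density \<Lambda> N) z (1 / (z + \<Lambda>) ^ N)"
proof -
  obtain n where N: "N = Suc n" using assms(1) by (cases N) auto
  have "has_laplace (\<lambda>t. exp (- (\<Lambda> * t)) * (t powr (real N - 1) / Gamma (real N))) z ((z + \<Lambda>) powr (- real N))"
    unfolding has_laplace_shift using assms by (intro has_laplace_powr) auto
  then have "has_laplace (phase_density \<Lambda> N) z ((z + \<Lambda>) powr (- real N))"
  proof (rule has_laplace_cong)
    fix t :: real assume "0 < t"
    then have "t powr (real N - 1) = t ^ n" unfolding N by (simp add: powr_realpow)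
    moreover have "Gamma (real N) = fact n"
      unfolding N using Gamma_fact[of n, where ?'a=real] by (simp add: add.commute)
    ultimately show "exp (- (\<Lambda> * t)) * (t powr (real N - 1) / Gamma (real N)) = phase_density \<Lambda> N t"
      by (simp add: phase_density_def N)
  qed
  moreover have "(z + \<Lambda>) powr (- real N) = 1 / (z + \<Lambda>) ^ N"
    using assms(2) by (simp only: powr_minus powr_realpow) (simp add: field_simps)
  ultimately show ?thesis by simp
qed

text \<open>Extended by 0 to the left, the weighted functions have a full convolution on the line,
  to which Fubini applies. The weights fit because exp (- z (t - u)) exp (- z u) = exp (- z
  t).\<close>

lemma has_laplace_convolution:
  assumes "has_laplace f z F" "has_laplace g z G"
  shows "has_laplace (fun_convolution f g) z (F * G)"
proof -
  define \<phi> where "\<phi> = (\<lambda>t. indicator {0<..} t * (exp (- (z * t)) * f t))"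
  define \<gamma> where "\<gamma> = (\<lambda>t. indicator {0<..} t * (exp (- (z * t)) * g t))"
  have \<phi>: "integrable lborel \<phi>" "(\<integral>t. \<phi> t \<partial>lborel) = F"
    and \<gamma>: "integrable lborel \<gamma>" "(\<integral>t. \<gamma> t \<partial>lborel) = G"
    using assms by (auto simp: has_laplace_def \<phi>_def \<gamma>_def has_bochner_integral_iff)
  have [measurable]: "\<phi> \<in> borel_measurable borel" "\<gamma> \<in> borel_measurable borel"
    using \<phi>(1) \<gamma>(1) by auto
  have shift: "(\<integral>t. h (t - u) \<partial>lborel) = (\<integral>t. h t \<partial>lborel)" for h :: "real \<Rightarrow> real" and u
    using lborel_integral_real_affine[of 1 h "-u"] by simp
  have shift_int: "integrable lborel (\<lambda>t. \<phi> (t - u))" for u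
    using lborel_integrable_real_affine[OF \<phi>(1), of 1 "-u"] by simp
  have int: "integrable (lborel \<Otimes>\<^sub>M lborel) (\<lambda>(u, t). \<phi> (t - u) * \<gamma> u)"
  proof (rule lborel_pair.Fubini_integrable)
    show "(\<lambda>(u, t). \<phi> (t - u) * \<gamma> u) \<in> borel_measurable (lborel \<Otimes>\<^sub>M lborel)"
      by measurable
    have "(\<integral>t. norm (case (u, t) of (u, t) \<Rightarrow> \<phi> (t - u) * \<gamma> u) \<partial>lborel) = (\<integral>t. \<bar>\<phi> t\<bar> \<partial>lborel) * \<bar>\<gamma> u\<bar>" for u
      using shift[of "\<lambda>t. \<bar>\<phi> t\<bar>" u] by (simp add: abs_mult)
    then show "integrable lborel (\<lambda>u. \<integral>t. norm (case (u, t) of (u, t) \<Rightarrow> \<phi> (t - u) * \<gamma> u) \<partial>lborel)"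
      using \<gamma>(1) by simp
    show "AE u in lborel. integrable lborel (\<lambda>t. case (u, t) of (u, t) \<Rightarrow> \<phi> (t - u) * \<gamma> u)"
      using shift_int by simp
  qed
  have "integrable lborel (\<lambda>t. \<integral>u. \<phi> (t - u) * \<gamma> u \<partial>lborel)"
    using lborel_pair.integrable_snd[OF int] .
  moreover have "(\<integral>t. (\<integral>u. \<phi> (t - u) * \<gamma> u \<partial>lborel) \<partial>lborel) = F * G"
    using lborel_pair.Fubini_integral[OF int] shift[of \<phi>] \<phi>(2) \<gamma>(2) by simp
  moreover have "(\<integral>u. \<phi> (t - u) * \<gamma> u \<partial>lborel)
      = indicator {0<..} t * (exp (- (z * t)) * fun_convolution f g t)" for t
  proof -
    have "\<phi> (t - u) * \<gamma> u
        = exp (- (z * t)) * (indicator {0<..<t} u *\<^sub>R (f (t - u) * g u))" for u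
    proof (cases "0 < u \<and> u < t")
      case True
      have "exp (- (z * (t - u))) * exp (- (z * u)) = exp (- (z * t))"
        by (simp add: exp_add[symmetric] algebra_simps)
      then have "(exp (- (z * (t - u))) * f (t - u)) * (exp (- (z * u)) * g u) = exp (- (z * t)) * (f (t - u) * g u)"
        by (metis mult.assoc mult.left_commute)
      then show ?thesis using True by (simp add: \<phi>_def \<gamma>_def)
    qed (auto simp: \<phi>_def \<gamma>_def indicator_def)
    then have "(\<integral>u. \<phi> (t - u) * \<gamma> u \<partial>lborel) = exp (- (z * t)) * fun_convolution f g t"
      by (simp only: fun_convolution_def set_lebesgue_integral_def integral_mult_right_zero)
    moreover have "fun_convolution f g t = 0" if "t \<le> 0"
    proof -
      have "{0<..<t} = {}" using that by auto
      then show ?thesis by (simp add: fun_convolution_def set_lebesgue_integral_def)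
    qed
    ultimately show ?thesis by (cases "0 < t") auto
  qed
  ultimately show ?thesis by (simp add: has_laplace_def has_bochner_integral_iff)
qed

text \<open>A class that is closed under convolution and contains both kernels. The bound admits an
  integrable singularity at 0; continuity off 0 is what the uniqueness of transforms finally asks
  for.\<close>

definition power_kernel :: "(real \<Rightarrow> real) \<Rightarrow> bool" where
  "power_kernel f \<longleftrightarrow> continuous_on {0<..} f \<and>
     (\<exists>a>0. \<exists>C w. \<forall>t>0. \<bar>f t\<bar> \<le> C * t powr (a - 1) * exp (w * t))"

text \<open>The substitution u = t x makes the range of integration independent of t. The integrand
  is then bounded by a function of t times a Beta integrand in x, so dominated convergence gives
  continuity, and the exponents at 0 add up.\<close>

lemma power_kernel_convolution:
  assumes "power_kernel f" "power_kernel g"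
  shows "power_kernel (fun_convolution f g)"
proof -
  obtain a C w where a: "0 < a" and f: "\<And>t. 0 < t \<Longrightarrow> \<bar>f t\<bar> \<le> C * t powr (a - 1) * exp (w * t)"
    and fc: "continuous_on {0<..} f"
    using assms(1) by (auto simp: power_kernel_def)
  obtain b C' w' where b: "0 < b" and g: "\<And>t. 0 < t \<Longrightarrow> \<bar>g t\<bar> \<le> C' * t powr (b - 1) * exp (w' * t)"
    and gc: "continuous_on {0<..} g"
    using assms(2) by (auto simp: power_kernel_def)
  have C: "0 \<le> C" "0 \<le> C'"
    using order_trans[OF abs_ge_zero f[of 1]] order_trans[OF abs_ge_zero g[of 1]]
    by (auto simp: zero_le_mult_iff)
  define v where "v = max w w'"
  have f': "\<bar>f t\<bar> \<le> C * t powr (a - 1) * exp (v * t)" if "0 < t" for t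
    using f[OF that] by (rule order_trans) (use C that in \<open>auto intro!: mult_left_mono mult_right_mono simp: v_def\<close>)
  have g': "\<bar>g t\<bar> \<le> C' * t powr (b - 1) * exp (v * t)" if "0 < t" for t
    using g[OF that] by (rule order_trans) (use C that in \<open>auto intro!: mult_left_mono mult_right_mono simp: v_def\<close>)
  define H where "H = (\<lambda>t x. indicator {0<..<1} x *\<^sub>R (t * (f (t * (1 - x)) * g (t * x))))"
  define \<beta> where "\<beta> = (\<lambda>x. indicator {0<..<1} x * (x powr (b - 1) * (1 - x) powr (a - 1)))"
  define A where "A = (\<lambda>t. C * C' * t powr (a + b - 1) * exp (v * t))"
  have conv: "fun_convolution f g t = (\<integral>x. H t x \<partial>lborel)" if "0 < t" for t
  proof -
    have "fun_convolution f g t = \<bar>t\<bar> *\<^sub>R (\<integral>x. indicator {0<..<t} (0 + t * x) *\<^sub>R (f (t - (0 + t * x)) * g (0 + t * x)) \<partial>lborel)"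
      unfolding fun_convolution_def set_lebesgue_integral_def
      by (rule lborel_integral_real_affine) (use that in simp)
    also have "\<dots> = (\<integral>x. t * (indicator {0<..<t} (t * x) *\<^sub>R (f (t - t * x) * g (t * x))) \<partial>lborel)"
      using that by simp
    also have "\<dots> = (\<integral>x. H t x \<partial>lborel)"
      using that by (intro Bochner_Integration.integral_cong refl)
        (auto simp: H_def indicator_def algebra_simps zero_less_mult_iff)
    finally show ?thesis .
  qed
  have bnd: "\<bar>H t x\<bar> \<le> A t * \<beta> x" if "0 < t" for t x
  proof (cases "0 < x \<and> x < 1")
    case True
    have "\<bar>H t x\<bar> = t * (\<bar>f (t * (1 - x))\<bar> * \<bar>g (t * x)\<bar>)"
      using True that by (simp add: H_def abs_mult)
    also have "\<dots> \<le> t * ((C * (t * (1 - x)) powr (a - 1) * exp (v * (t * (1 - x)))) * (C' * (t * x) powr (b - 1) * exp (v * (t * x))))"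
      using True that C by (intro mult_left_mono mult_mono f' g') auto
    also have "\<dots> = C * C' * (t powr 1 * t powr (a - 1) * t powr (b - 1)) * (exp (v * (t * (1 - x))) * exp (v * (t * x))) * (x powr (b - 1) * (1 - x) powr (a - 1))"
      using True that by (simp add: powr_mult)
    also have "exp (v * (t * (1 - x))) * exp (v * (t * x)) = exp (v * t)"
      by (simp add: exp_add[symmetric] algebra_simps)
    also have "t powr 1 * t powr (a - 1) * t powr (b - 1) = t powr (a + b - 1)"
      by (simp only: powr_add[symmetric]) (simp add: algebra_simps)
    finally show ?thesis using True by (simp add: A_def \<beta>_def)
  qed (auto simp: H_def \<beta>_def)
  have \<beta>: "integrable lborel \<beta>"
  proof -
    have "set_integrable lborel {0..1} (\<lambda>t. t powr (b - 1) * (1 - t) powr (a - 1))"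
      by (rule integrable_Beta) fact+
    moreover have "\<beta> = (\<lambda>x. indicator {0..1} x *\<^sub>R (x powr (b - 1) * (1 - x) powr (a - 1)))"
    proof
      fix x show "\<beta> x = indicator {0..1} x *\<^sub>R (x powr (b - 1) * (1 - x) powr (a - 1))"
        by (cases "x = 0 \<or> x = 1") (auto simp: \<beta>_def indicator_def)
    qed
    ultimately show ?thesis by (simp add: set_integrable_def)
  qed
  have H_meas: "H t \<in> borel_measurable borel" if "0 < t" for t
    unfolding H_def
    by (rule borel_measurable_continuous_on_indicator)
      (use that in \<open>auto intro!: continuous_intros continuous_on_compose2[OF fc] continuous_on_compose2[OF gc]\<close>)
  have A_cont: "continuous_on {0<..} A"
    unfolding A_def by (intro continuous_intros) auto
  have "continuous_on {0<..} (fun_convolution f g)"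
    unfolding continuous_on_sequentially
  proof safe
    fix X :: "nat \<Rightarrow> real" and t :: real
    assume t: "0 < t" and X: "\<forall>n. X n \<in> {0<..}" "X \<longlonglongrightarrow> t"
    have "(A \<circ> X) \<longlonglongrightarrow> A t"
      using A_cont X t unfolding continuous_on_sequentially by auto
    \<comment> \<open>Boundedness along the convergent sequence gives one dominating function for
      all n.\<close>
    then have "Bseq (A \<circ> X)" by (intro convergent_imp_Bseq convergentI)
    then obtain B where B: "\<And>n. \<bar>A (X n)\<bar> \<le> B" unfolding Bseq_def by auto
    have "(\<lambda>n. \<integral>x. H (X n) x \<partial>lborel) \<longlonglongrightarrow> (\<integral>x. H t x \<partial>lborel)"
    proof (rule integral_dominated_convergence)
      show "integrable lborel (\<lambda>x. B * \<beta> x)" using \<beta> by simp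
      show "AE x in lborel. (\<lambda>n. H (X n) x) \<longlonglongrightarrow> H t x"
      proof (intro AE_I2)
        fix x
        show "(\<lambda>n. H (X n) x) \<longlonglongrightarrow> H t x"
        proof (cases "0 < x \<and> x < 1")
          case True
          have "(\<lambda>n. f (X n * (1 - x))) \<longlonglongrightarrow> f (t * (1 - x))"
            using True X t
            by (intro continuous_on_tendsto_compose[OF fc]) (auto intro!: tendsto_intros)
          moreover have "(\<lambda>n. g (X n * x)) \<longlonglongrightarrow> g (t * x)"
            using True X t
            by (intro continuous_on_tendsto_compose[OF gc]) (auto intro!: tendsto_intros)
          ultimately show ?thesis
            unfolding H_def by (intro tendsto_intros X)
        qed (auto simp: H_def)
      qed
      show "AE x in lborel. norm (H (X n) x) \<le> B * \<beta> x" for n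
      proof (intro AE_I2)
        fix x
        have "norm (H (X n) x) \<le> A (X n) * \<beta> x" using bnd[of "X n" x] X by auto
        also have "\<dots> \<le> B * \<beta> x"
          using B[of n] by (intro mult_right_mono) (auto simp: \<beta>_def)
        finally show "norm (H (X n) x) \<le> B * \<beta> x" .
      qed
    qed (use H_meas X t in auto)
    then show "(fun_convolution f g \<circ> X) \<longlonglongrightarrow> fun_convolution f g t"
      using X t conv by (simp add: o_def)
  qed
  moreover have "\<bar>fun_convolution f g t\<bar> \<le> (C * C' * (\<integral>x. \<beta> x \<partial>lborel)) * t powr (a + b - 1) * exp (v * t)"
    if "0 < t" for t
  proof -
    have H_int: "integrable lborel (H t)"
      by (rule Bochner_Integration.integrable_bound[of _ "\<lambda>x. A t * \<beta> x"])
        (use \<beta> H_meas[OF that] in \<open>auto intro!: order_trans[OF bnd[OF that]]\<close>)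
    have "\<bar>fun_convolution f g t\<bar> \<le> (\<integral>x. \<bar>H t x\<bar> \<partial>lborel)"
      unfolding conv[OF that] by (rule integral_abs_bound)
    also have "\<dots> \<le> (\<integral>x. A t * \<beta> x \<partial>lborel)"
      using H_int \<beta> bnd[OF that] by (intro integral_mono) auto
    also have "\<dots> = A t * (\<integral>x. \<beta> x \<partial>lborel)" by simp
    finally show ?thesis by (simp add: A_def mult_ac)
  qed
  moreover have "0 < a + b" using a b by simp
  ultimately show ?thesis unfolding power_kernel_def by blast
qed

lemma power_kernel_conv_power: "power_kernel f \<Longrightarrow> power_kernel (conv_power f N)"
proof -
  assume f: "power_kernel f"
  have "power_kernel ((fun_convolution f ^^ n) f)" for n
    by (induction n) (simp_all add: f power_kernel_convolution)
  then show ?thesis by (simp add: conv_power_def)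
qed

lemma has_laplace_conv_power:
  assumes "has_laplace f z F" "1 \<le> N"
  shows "has_laplace (conv_power f N) z (F ^ N)"
proof -
  have "has_laplace ((fun_convolution f ^^ n) f) z (F ^ Suc n)" for n
    by (induction n) (simp_all add: assms(1) has_laplace_convolution)
  from this[of "N - 1"] assms(2) show ?thesis by (simp add: conv_power_def)
qed

section \<open>Series of phase densities\<close>

lemma power_div_fact_le_exp:
  fixes x :: real
  assumes "0 \<le> x"
  shows "x ^ n / fact n \<le> exp x"
proof -
  have s: "summable (\<lambda>n. x ^ n / fact n)"
    using exp_converges[of x] by (auto simp: sums_iff scaleR_conv_of_real divide_inverse mult_ac)
  have "(\<Sum>i\<in>{n}. x ^ i / fact i) \<le> (\<Sum>i. x ^ i / fact i)"
    by (rule sum_le_suminf[OF s]) (use assms in auto)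
  also have "\<dots> = exp x"
    using exp_converges[of x] by (auto simp: sums_iff scaleR_conv_of_real divide_inverse mult_ac)
  finally show ?thesis by simp
qed

text \<open>The factor exp (- \<Lambda> y) is dropped and y / \<theta> put into the exponential
  series. This separates \<theta> ^ N, against which the coefficients are summable, from a factor
  that does not depend on N.\<close>

lemma phase_density_bound:
  assumes "1 \<le> N" "0 < \<theta>" "0 \<le> \<Lambda>" "0 \<le> y"
  shows "phase_density \<Lambda> N y \<le> \<theta> ^ N * (exp (y / \<theta>) / \<theta>)"
proof -
  obtain n where N: "N = Suc n" using assms(1) by (cases N) auto
  have "phase_density \<Lambda> N y \<le> y ^ n / fact n"
    using assms by (simp add: phase_density_def N divide_right_mono mult_left_le)
  also have "\<dots> = \<theta> ^ n * ((y / \<theta>) ^ n / fact n)"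
    using assms by (simp add: power_divide)
  also have "\<dots> \<le> \<theta> ^ n * exp (y / \<theta>)"
    using assms by (intro mult_left_mono power_div_fact_le_exp) auto
  finally show ?thesis using assms by (simp add: N)
qed

text \<open>The common setting of the B, C and D series, which differ in their index types.
  Summability at the single point \<theta> controls everything that follows.\<close>

locale phase_series =
  fixes \<Lambda> \<theta> :: real and K :: "'i::countable \<Rightarrow> real" and N :: "'i \<Rightarrow> nat"
  assumes inf_UNIV: "infinite (UNIV :: 'i set)"
    and \<Lambda>: "0 \<le> \<Lambda>" and \<theta>: "0 < \<theta>"
    and K_nonneg: "0 \<le> K j" and N_pos: "1 \<le> N j"
    and K_summable: "(\<lambda>j. K j * \<theta> ^ N j) summable_on UNIV"
begin

definition S :: "real \<Rightarrow> real" where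
  "S y = (\<Sum>\<^sub>\<infinity>j. K j * phase_density \<Lambda> (N j) y)"

lemma term_bound:
  assumes "0 \<le> y"
  shows "0 \<le> K j * phase_density \<Lambda> (N j) y"
    and "K j * phase_density \<Lambda> (N j) y \<le> K j * \<theta> ^ N j * (exp (y / \<theta>) / \<theta>)"
  using assms mult_left_mono[OF phase_density_bound[OF N_pos \<theta> \<Lambda>, of y j] K_nonneg[of j]]
  by (auto simp: K_nonneg phase_density_nonneg mult.assoc)

lemma terms_summable: "0 \<le> y \<Longrightarrow> (\<lambda>j. K j * phase_density \<Lambda> (N j) y) summable_on UNIV"
  by (rule summable_on_comparison_test[OF summable_on_cmult_left[OF K_summable, of "exp (y / \<theta>) / \<theta>"]])
    (use term_bound in auto)

text \<open>The M-test works on every bounded interval {0..b}. The endpoint 0 is included because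
  the inverse process may take the value 0.\<close>

lemma S_continuous: "continuous_on {0..} S"
proof -
  have "continuous_on {0..b} S" for b
  proof (rule uniform_limit_theorem)
    show "uniform_limit {0..b} (\<lambda>X y. \<Sum>j\<in>X. K j * phase_density \<Lambda> (N j) y) S (finite_subsets_at_top UNIV)"
      unfolding S_def
    proof (rule Weierstrass_m_test_general)
      show "(\<lambda>j. K j * \<theta> ^ N j * (exp (b / \<theta>) / \<theta>)) summable_on UNIV"
        by (rule summable_on_cmult_left[OF K_summable])
      show "norm (K j * phase_density \<Lambda> (N j) y) \<le> K j * \<theta> ^ N j * (exp (b / \<theta>) / \<theta>)"
        if "y \<in> {0..b}" for j y
      proof -
        have "norm (K j * phase_density \<Lambda> (N j) y) \<le> K j * \<theta> ^ N j * (exp (y / \<theta>) / \<theta>)"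
          using term_bound[of y j] that by simp
        also have "\<dots> \<le> K j * \<theta> ^ N j * (exp (b / \<theta>) / \<theta>)"
          using that \<theta> K_nonneg[of j]
          by (intro mult_left_mono divide_right_mono) (auto simp: divide_right_mono)
        finally show ?thesis .
      qed
    qed
    show "\<forall>\<^sub>F X in finite_subsets_at_top UNIV. continuous_on {0..b} (\<lambda>y. \<Sum>j\<in>X. K j * phase_density \<Lambda> (N j) y)"
      unfolding phase_density_def by (intro always_eventually allI continuous_intros) auto
  qed auto
  note c = this
  show ?thesis
    unfolding continuous_on_eq_continuous_within
  proof
    fix y :: real assume y: "y \<in> {0..}"
    have "continuous (at y within {0..y+1}) S"
      using c[of "y + 1"] y by (auto simp: continuous_on_eq_continuous_within)
    moreover have "at y within {0..y+1} = at y within {0..}"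
      using y by (intro at_within_nhd[of _ "{..<y+1}"]) auto
    ultimately show "continuous (at y within {0..}) S" by (simp add: continuous_within)
  qed
qed

text \<open>The hypothesis on z says that 1 / (z + \<Lambda>) \<le> \<theta>, so the transformed
  series is dominated by the one at \<theta>.\<close>

lemma has_laplace_S:
  assumes z: "1 / \<theta> \<le> z + \<Lambda>"
  shows "has_laplace S z (\<Sum>\<^sub>\<infinity>j. K j * (1 / (z + \<Lambda>) ^ N j))"
proof -
  have pos: "0 < z + \<Lambda>" using z \<theta> by (meson less_le_trans zero_less_divide_1_iff)
  have L: "has_laplace (\<lambda>y. K j * phase_density \<Lambda> (N j) y) z (K j * (1 / (z + \<Lambda>) ^ N j))" for j
    by (intro has_laplace_cmult has_laplace_phase_density N_pos pos)
  have "1 / (z + \<Lambda>) \<le> \<theta>" using z pos \<theta> by (simp add: field_simps)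
  then have le: "1 / (z + \<Lambda>) ^ N j \<le> \<theta> ^ N j" for j
    using power_mono[of "1 / (z + \<Lambda>)" \<theta> "N j"] pos by (simp add: power_divide)
  show ?thesis
    unfolding S_def
  proof (rule has_laplace_infsum[OF inf_UNIV L])
    show "has_laplace (\<lambda>t. \<bar>K j * phase_density \<Lambda> (N j) t\<bar>) z (K j * (1 / (z + \<Lambda>) ^ N j))" for j
      by (rule has_laplace_cong[OF L]) (use term_bound(1) in \<open>auto simp: less_imp_le\<close>)
    show "(\<lambda>j. K j * (1 / (z + \<Lambda>) ^ N j)) summable_on UNIV"
      by (rule summable_on_comparison_test[OF K_summable])
        (use mult_left_mono[OF le K_nonneg] K_nonneg pos in \<open>auto simp: less_imp_le\<close>)
  qed (use terms_summable in \<open>auto simp: less_imp_le\<close>)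
qed

lemma expectation_S:
  fixes Y :: "'a \<Rightarrow> real"
  assumes [measurable]: "Y \<in> borel_measurable M" and Y: "\<And>\<omega>. \<omega> \<in> space M \<Longrightarrow> 0 \<le> Y \<omega>"
    and int: "integrable M (\<lambda>\<omega>. exp (Y \<omega> / \<theta>))"
  shows "(\<lambda>j. K j * (\<integral>\<omega>. phase_density \<Lambda> (N j) (Y \<omega>) \<partial>M)) summable_on UNIV" (is ?A)
    and "has_bochner_integral M (\<lambda>\<omega>. S (Y \<omega>)) (\<Sum>\<^sub>\<infinity>j. K j * (\<integral>\<omega>. phase_density \<Lambda> (N j) (Y \<omega>) \<partial>M))"
      (is ?B)
proof -
  define E where "E = (\<integral>\<omega>. exp (Y \<omega> / \<theta>) / \<theta> \<partial>M)"
  have i: "integrable M (\<lambda>\<omega>. K j * phase_density \<Lambda> (N j) (Y \<omega>))" for j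
  proof (rule Bochner_Integration.integrable_bound)
    show "integrable M (\<lambda>\<omega>. K j * \<theta> ^ N j * (exp (Y \<omega> / \<theta>) / \<theta>))"
      using int by simp
    show "AE \<omega> in M. norm (K j * phase_density \<Lambda> (N j) (Y \<omega>)) \<le> norm (K j * \<theta> ^ N j * (exp (Y \<omega> / \<theta>) / \<theta>))"
    proof (rule AE_I2)
      fix \<omega> assume "\<omega> \<in> space M"
      note * = term_bound[OF Y[OF this], of j]
      show "norm (K j * phase_density \<Lambda> (N j) (Y \<omega>)) \<le> norm (K j * \<theta> ^ N j * (exp (Y \<omega> / \<theta>) / \<theta>))"
        using *(1) order_trans[OF *(2) abs_ge_self] by (simp only: real_norm_def abs_of_nonneg)
    qed
  qed simp
  have le: "(\<integral>\<omega>. K j * phase_density \<Lambda> (N j) (Y \<omega>) \<partial>M) \<le> K j * \<theta> ^ N j * E" for j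
  proof -
    have "(\<integral>\<omega>. K j * phase_density \<Lambda> (N j) (Y \<omega>) \<partial>M) \<le> (\<integral>\<omega>. K j * \<theta> ^ N j * (exp (Y \<omega> / \<theta>) / \<theta>) \<partial>M)"
      using i int term_bound Y by (intro integral_mono) auto
    then show ?thesis by (simp add: E_def)
  qed
  have nonneg: "0 \<le> (\<integral>\<omega>. K j * phase_density \<Lambda> (N j) (Y \<omega>) \<partial>M)" for j
    using term_bound(1)[OF Y] by (intro integral_nonneg_AE AE_I2) auto
  have summ: "(\<lambda>j. \<integral>\<omega>. K j * phase_density \<Lambda> (N j) (Y \<omega>) \<partial>M) summable_on UNIV"
    by (rule summable_on_comparison_test[OF summable_on_cmult_left[OF K_summable, of E]])
      (use le nonneg in auto)
  then show ?A by simp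
  have abs_eq: "(\<integral>\<omega>. \<bar>K j * phase_density \<Lambda> (N j) (Y \<omega>)\<bar> \<partial>M) = (\<integral>\<omega>. K j * phase_density \<Lambda> (N j) (Y \<omega>) \<partial>M)" for j
    by (intro Bochner_Integration.integral_cong refl abs_of_nonneg term_bound(1) Y)
  have "has_bochner_integral M (\<lambda>\<omega>. \<Sum>\<^sub>\<infinity>j. K j * phase_density \<Lambda> (N j) (Y \<omega>))
      (\<Sum>\<^sub>\<infinity>j. \<integral>\<omega>. K j * phase_density \<Lambda> (N j) (Y \<omega>) \<partial>M)"
    by (rule has_bochner_integral_infsum[OF inf_UNIV i])
      (use summ terms_summable Y in \<open>auto simp only: abs_eq\<close>)
  then show ?B by (simp add: S_def)
qed

end

section \<open>The convolution kernels\<close>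

text \<open>On the diagonal h + r = n the terms add up to (X + Y) ^ n, which leaves a geometric
  series. The same computation with absolute values gives summability.\<close>

lemma has_sum_binomial_two_vars:
  fixes X Y :: real
  assumes "\<bar>X\<bar> + \<bar>Y\<bar> < 1"
  shows "((\<lambda>(h, r). real (h + r choose h) * X ^ h * Y ^ r) has_sum 1 / (1 - X - Y)) UNIV"
proof -
  define F where "F = (\<lambda>X Y (n, h). real (n choose h) * X ^ h * Y ^ (n - h) :: real)"
  have fin: "((\<lambda>h. F X Y (n, h)) has_sum (X + Y) ^ n) {..n}" for X Y :: real and n
    by (rule has_sum_finiteI) (simp_all add: F_def binomial_ring)
  have geo: "((\<lambda>n. x ^ n) has_sum 1 / (1 - x)) UNIV" if "\<bar>x\<bar> < 1" for x :: real
    by (rule norm_summable_imp_has_sum)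
      (use that geometric_sums[of x] in \<open>auto simp: power_abs intro: summable_geometric\<close>)
  have "F \<bar>X\<bar> \<bar>Y\<bar> summable_on (SIGMA n:UNIV. {..n})"
    by (rule summable_on_SigmaI[OF fin])
      (use geo[of "\<bar>X\<bar> + \<bar>Y\<bar>"] assms in \<open>auto simp: F_def summable_on_def\<close>)
  moreover have "F \<bar>X\<bar> \<bar>Y\<bar> = (\<lambda>p. \<bar>F X Y p\<bar>)"
    by (auto simp: F_def abs_mult power_abs)
  ultimately have "F X Y summable_on (SIGMA n:UNIV. {..n})"
    by (subst summable_on_iff_abs_summable_on_real) simp
  moreover have "\<bar>X + Y\<bar> < 1" using assms by linarith
  ultimately have "(F X Y has_sum 1 / (1 - (X + Y))) (SIGMA n:UNIV. {..n})"
    by (intro has_sum_SigmaI[OF fin geo])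
  moreover have "((\<lambda>(h, r). real (h + r choose h) * X ^ h * Y ^ r) has_sum s) UNIV
      \<longleftrightarrow> (F X Y has_sum s) (SIGMA n:UNIV. {..n})" for s
    by (rule has_sum_reindex_bij_witness[of _ "\<lambda>(n, h). (h, n - h)" "\<lambda>(h, r). (h + r, h)"])
      (auto simp: F_def)
  ultimately show ?thesis by (simp add: diff_diff_eq)
qed

text \<open>Restrict Euler's integral to s \<ge> v + 1. There s powr x \<ge> v powr x, and one
  factor exp (- s) \<le> 1 / s absorbs the remaining power s powr (\<beta> - 1). The bound grows
  geometrically in x with any prescribed ratio v.\<close>

lemma Gamma_lower_bound:
  fixes \<beta> x v :: real
  assumes "0 < \<beta>" "0 \<le> x" "0 < v"
  shows "v powr x * exp (- 2 * (v + 1)) / 2 \<le> Gamma (\<beta> + x)"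
proof -
  have "((\<lambda>s. exp (- 2 * s)) has_integral exp (- 2 * (v + 1)) / 2) {v + 1..}"
    using has_integral_exp_minus_to_infinity[of 2 "v + 1"] by simp
  then have "((\<lambda>s. v powr x * exp (- 2 * s)) has_integral v powr x * (exp (- 2 * (v + 1)) / 2)) {v + 1..}"
    by (rule has_integral_mult_right)
  then have 1: "((\<lambda>s. if s \<in> {v + 1..} then v powr x * exp (- 2 * s) else 0) has_integral v powr x * (exp (- 2 * (v + 1)) / 2)) {0..}"
    using assms by (subst has_integral_restrict) auto
  have 2: "((\<lambda>s. s powr (\<beta> + x - 1) / exp s) has_integral Gamma (\<beta> + x)) {0..}"
    using assms by (intro Gamma_integral_real) auto
  have "v powr x * (exp (- 2 * (v + 1)) / 2) \<le> Gamma (\<beta> + x)"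
  proof (rule has_integral_le[OF 1 2])
    fix s :: real assume "s \<in> {0..}"
    show "(if s \<in> {v + 1..} then v powr x * exp (- 2 * s) else 0) \<le> s powr (\<beta> + x - 1) / exp s"
    proof (cases "s \<in> {v + 1..}")
      case True
      then have s: "1 \<le> s" "v \<le> s" using assms by auto
      have "exp (- s) \<le> 1 / s"
        using s exp_ge_add_one_self[of s] by (simp add: exp_minus field_simps del: exp_ge_add_one_self)
      also have "\<dots> = s powr (- 1)" using s by (simp add: powr_minus field_simps)
      also have "\<dots> \<le> s powr (\<beta> - 1)" using s assms by (intro powr_mono) auto
      finally have "v powr x * exp (- s) \<le> s powr x * s powr (\<beta> - 1)"
        using s assms by (intro mult_mono powr_mono2) auto
      also have "\<dots> = s powr (\<beta> + x - 1)" by (simp add: powr_add[symmetric] algebra_simps)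
      finally have "v powr x * exp (- s) * exp (- s) \<le> s powr (\<beta> + x - 1) * exp (- s)"
        by (intro mult_right_mono) auto
      moreover have "exp (- s) * exp (- s) = exp (- 2 * s)" by (simp add: exp_add[symmetric])
      moreover have "s powr (\<beta> + x - 1) / exp s = s powr (\<beta> + x - 1) * exp (- s)"
        by (simp add: exp_minus divide_inverse)
      ultimately show ?thesis using True by (simp only: mult.assoc) simp
    qed simp
  qed
  then show ?thesis by simp
qed

text \<open>Taking v = w t in the lower bound cancels t powr x and leaves w powr (- x). A series in
  powers of t is thereby compared with the same series at a fixed large w.\<close>

lemma powr_div_Gamma_bound:
  fixes \<beta> x w t :: real
  assumes "0 < \<beta>" "0 \<le> x" "0 < w" "0 < t"
  shows "t powr (\<beta> + x - 1) / Gamma (\<beta> + x) \<le> 2 * exp 2 * (t powr (\<beta> - 1) * exp (2 * w * t)) * w powr (- x)"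
proof -
  have G: "0 < Gamma (\<beta> + x)" using assms by (intro Gamma_real_pos) auto
  have "t powr x * w powr x \<le> 2 * exp (2 * (w * t + 1)) * Gamma (\<beta> + x)"
  proof -
    have "(w * t) powr x * exp (- (2 * (w * t + 1))) / 2 \<le> Gamma (\<beta> + x)"
      using Gamma_lower_bound[of \<beta> x "w * t"] assms by simp
    then show ?thesis using assms unfolding exp_minus by (simp add: powr_mult field_simps)
  qed
  then have "t powr x \<le> 2 * exp (2 * (w * t + 1)) * Gamma (\<beta> + x) * w powr (- x)"
    using assms by (simp add: powr_minus field_simps)
  then have "t powr (\<beta> - 1) * t powr x \<le> t powr (\<beta> - 1) * (2 * exp (2 * (w * t + 1)) * Gamma (\<beta> + x) * w powr (- x))"
    by (intro mult_left_mono) auto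
  moreover have "t powr (\<beta> - 1) * t powr x = t powr (\<beta> + x - 1)"
    by (simp add: powr_add[symmetric] algebra_simps)
  moreover have "exp (2 * (w * t + 1)) = exp 2 * exp (2 * w * t)"
    by (simp add: exp_add[symmetric] algebra_simps)
  ultimately show ?thesis using G by (simp add: pos_divide_le_eq mult_ac)
qed

text \<open>
  The functions \<open>ker \<beta>\<close> below have Laplace transform
  \<open>z powr (- \<beta>) / (1 + a z powr (- \<sigma>) + b z powr (- \<alpha>))\<close>. Both kernels \<open>f\<close> and \<open>g\<close> are of this form;
  only the exponent \<open>\<beta>\<close> depends on which one is taken and on \<open>N\<close>.
\<close>

locale double_kernel =
  fixes a b \<sigma> \<alpha> :: real
  assumes a: "0 \<le> a" and b: "0 \<le> b" and \<sigma>: "0 < \<sigma>" and \<alpha>: "0 < \<alpha>"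
begin

text \<open>The coefficients of 1 / (1 + a X + b Y). For X = z powr (- \<sigma>) and Y = z powr (-
  \<alpha>) the monomial X ^ h Y ^ r is z powr (- \<rho> (h, r)).\<close>

definition coef :: "nat \<times> nat \<Rightarrow> real" where
  "coef = (\<lambda>(h, r). real (h + r choose h) * (- a) ^ h * (- b) ^ r)"

definition \<rho> :: "nat \<times> nat \<Rightarrow> real" where
  "\<rho> = (\<lambda>(h, r). \<sigma> * real h + \<alpha> * real r)"

definition ker :: "real \<Rightarrow> real \<Rightarrow> real" where
  "ker \<beta> t = (\<Sum>\<^sub>\<infinity>p. coef p * (t powr (\<beta> + \<rho> p - 1) / Gamma (\<beta> + \<rho> p)))"

lemma \<rho>_nonneg: "0 \<le> \<rho> p"
  using \<sigma> \<alpha> by (cases p) (simp add: \<rho>_def)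

lemma coef_powr:
  assumes "0 < w"
  shows "coef (h, r) * w powr (- \<rho> (h, r)) = real (h + r choose h) * (- a * w powr (- \<sigma>)) ^ h * (- b * w powr (- \<alpha>)) ^ r"
proof -
  have "w powr (- \<rho> (h, r)) = (w powr (- \<sigma>)) ^ h * (w powr (- \<alpha>)) ^ r"
    using assms by (simp add: \<rho>_def powr_power powr_add[symmetric] algebra_simps)
  then show ?thesis
    unfolding coef_def power_mult_distrib by simp
qed

lemma coef_has_sum:
  assumes w: "0 < w" and lt: "a * w powr (- \<sigma>) + b * w powr (- \<alpha>) < 1"
  shows "((\<lambda>p. coef p * w powr (- \<rho> p)) has_sum 1 / (1 + a * w powr (- \<sigma>) + b * w powr (- \<alpha>))) UNIV"
    and "(\<lambda>p. \<bar>coef p\<bar> * w powr (- \<rho> p)) summable_on UNIV"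
proof -
  have lt': "\<bar>- a * w powr (- \<sigma>)\<bar> + \<bar>- b * w powr (- \<alpha>)\<bar> < 1"
    using lt a b by (simp add: abs_mult)
  have eq: "(\<lambda>(h, r). real (h + r choose h) * (- a * w powr (- \<sigma>)) ^ h * (- b * w powr (- \<alpha>)) ^ r) = (\<lambda>p. coef p * w powr (- \<rho> p))"
    using coef_powr[OF w] by (auto simp: fun_eq_iff)
  show *: "((\<lambda>p. coef p * w powr (- \<rho> p)) has_sum 1 / (1 + a * w powr (- \<sigma>) + b * w powr (- \<alpha>))) UNIV"
    using has_sum_binomial_two_vars[OF lt'] unfolding eq by simp
  have "(\<lambda>p. \<bar>coef p * w powr (- \<rho> p)\<bar>) summable_on UNIV"
    using * summable_on_iff_abs_summable_on_real[THEN iffD1, OF has_sum_imp_summable] by fastforce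
  then show "(\<lambda>p. \<bar>coef p\<bar> * w powr (- \<rho> p)) summable_on UNIV" by (simp add: abs_mult)
qed

lemma large_ok: "\<exists>w0>0. \<forall>w\<ge>w0. a * w powr (- \<sigma>) + b * w powr (- \<alpha>) < 1"
proof -
  have "((\<lambda>w. a * w powr (- \<sigma>) + b * w powr (- \<alpha>)) \<longlongrightarrow> a * 0 + b * 0) at_top"
    using \<sigma> \<alpha> by (intro tendsto_intros tendsto_neg_powr filterlim_ident) auto
  then have "\<forall>\<^sub>F w in at_top. a * w powr (- \<sigma>) + b * w powr (- \<alpha>) < 1"
    by (intro order_tendstoD(2)) auto
  then obtain w0 where "\<forall>w\<ge>w0. a * w powr (- \<sigma>) + b * w powr (- \<alpha>) < 1"
    by (auto simp: eventually_at_top_linorder)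
  then show ?thesis by (intro exI[of _ "max 1 w0"]) auto
qed

lemma term_bound:
  assumes "0 < \<beta>" "0 < w" "0 < t"
  shows "\<bar>coef p * (t powr (\<beta> + \<rho> p - 1) / Gamma (\<beta> + \<rho> p))\<bar>
    \<le> \<bar>coef p\<bar> * w powr (- \<rho> p) * (2 * exp 2 * (t powr (\<beta> - 1) * exp (2 * w * t)))"
proof -
  have G: "0 < Gamma (\<beta> + \<rho> p)" using assms \<rho>_nonneg[of p] by (intro Gamma_real_pos) auto
  have "\<bar>coef p\<bar> * (t powr (\<beta> + \<rho> p - 1) / Gamma (\<beta> + \<rho> p)) \<le>
     \<bar>coef p\<bar> * (2 * exp 2 * (t powr (\<beta> - 1) * exp (2 * w * t)) * w powr (- \<rho> p))"
    by (intro mult_left_mono powr_div_Gamma_bound assms \<rho>_nonneg) auto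
  then show ?thesis using G by (simp add: abs_mult mult_ac)
qed

lemma terms_summable:
  assumes "0 < \<beta>" "0 < t"
  shows "(\<lambda>p. coef p * (t powr (\<beta> + \<rho> p - 1) / Gamma (\<beta> + \<rho> p))) summable_on UNIV"
proof -
  obtain w where w: "0 < w" "a * w powr (- \<sigma>) + b * w powr (- \<alpha>) < 1" using large_ok by auto
  show ?thesis
    by (rule summable_on_iff_abs_summable_on_real[THEN iffD2],
        rule summable_on_comparison_test[OF summable_on_cmult_left[OF coef_has_sum(2)[OF w]]])
      (use term_bound[OF assms(1) w(1) assms(2)] in \<open>auto simp del: abs_mult\<close>)
qed

text \<open>Each term of \<open>ker\<close> is a multiple of a power, and the transforms form the
  expansion of the denominator times z powr (- \<beta>).\<close>

lemma has_laplace_ker: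
  assumes "0 < \<beta>" and z: "0 < z" "a * z powr (- \<sigma>) + b * z powr (- \<alpha>) < 1"
  shows "has_laplace (ker \<beta>) z (z powr (- \<beta>) / (1 + a * z powr (- \<sigma>) + b * z powr (- \<alpha>)))"
proof -
  have pos: "0 < \<beta> + \<rho> p" for p using assms(1) \<rho>_nonneg[of p] by simp
  have L: "has_laplace (\<lambda>t. coef p * (t powr (\<beta> + \<rho> p - 1) / Gamma (\<beta> + \<rho> p))) z (coef p * z powr (- (\<beta> + \<rho> p)))" for p
    by (intro has_laplace_cmult has_laplace_powr pos z)
  have split: "z powr (- (\<beta> + \<rho> p)) = z powr (- \<rho> p) * z powr (- \<beta>)" for p
    by (simp add: powr_add[symmetric] algebra_simps)
  have "has_laplace (ker \<beta>) z (\<Sum>\<^sub>\<infinity>p. coef p * z powr (- (\<beta> + \<rho> p)))"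
    unfolding ker_def
  proof (rule has_laplace_infsum[OF _ L])
    show "has_laplace (\<lambda>t. \<bar>coef p * (t powr (\<beta> + \<rho> p - 1) / Gamma (\<beta> + \<rho> p))\<bar>) z (\<bar>coef p\<bar> * z powr (- (\<beta> + \<rho> p)))" for p
    proof (rule has_laplace_cong[OF has_laplace_cmult[OF has_laplace_powr[OF pos z(1)]]])
      fix t :: real assume "0 < t"
      show "\<bar>coef p\<bar> * (t powr (\<beta> + \<rho> p - 1) / Gamma (\<beta> + \<rho> p)) = \<bar>coef p * (t powr (\<beta> + \<rho> p - 1) / Gamma (\<beta> + \<rho> p))\<bar>"
        using Gamma_real_pos[OF pos[of p]] by (simp add: abs_mult)
    qed
    show "(\<lambda>p. \<bar>coef p\<bar> * z powr (- (\<beta> + \<rho> p))) summable_on UNIV"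
      unfolding split mult.assoc[symmetric] by (intro summable_on_cmult_left coef_has_sum z)
    show "(\<lambda>p. coef p * (t powr (\<beta> + \<rho> p - 1) / Gamma (\<beta> + \<rho> p))) summable_on UNIV" if "0 < t" for t
      by (rule terms_summable) fact+
  qed (simp add: finite_prod)
  moreover have "(\<Sum>\<^sub>\<infinity>p. coef p * z powr (- (\<beta> + \<rho> p))) = 1 / (1 + a * z powr (- \<sigma>) + b * z powr (- \<alpha>)) * z powr (- \<beta>)"
    unfolding split mult.assoc[symmetric]
    by (intro infsumI has_sum_cmult_left coef_has_sum z)
  ultimately show ?thesis by simp
qed

text \<open>\<open>term_bound\<close> splits into a summable weight \<open>m\<close> and a function
  \<open>A\<close> of t alone. Boundedness of \<open>A\<close> on compact intervals gives uniform
  convergence there, and \<open>A\<close> itself is the required growth bound.\<close>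

lemma power_kernel_ker:
  assumes \<beta>: "0 < \<beta>"
  shows "power_kernel (ker \<beta>)"
proof -
  obtain w where w: "0 < w" "a * w powr (- \<sigma>) + b * w powr (- \<alpha>) < 1" using large_ok by auto
  define T where "T = (\<lambda>p t. coef p * (t powr (\<beta> + \<rho> p - 1) / Gamma (\<beta> + \<rho> p)))"
  define m where "m = (\<lambda>p. \<bar>coef p\<bar> * w powr (- \<rho> p))"
  define A where "A = (\<lambda>t. 2 * exp 2 * (t powr (\<beta> - 1) * exp (2 * w * t)))"
  have ker_eq: "ker \<beta> = (\<lambda>t. \<Sum>\<^sub>\<infinity>p. T p t)" by (simp add: ker_def T_def fun_eq_iff)
  have m: "m summable_on UNIV" unfolding m_def by (rule coef_has_sum[OF w])
  have T: "\<bar>T p t\<bar> \<le> m p * A t" if "0 < t" for p t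
    unfolding T_def m_def A_def by (rule term_bound[OF \<beta> w(1) that])
  have cont_ab: "continuous_on {l..u} (ker \<beta>)" if l: "0 < l" for l u
  proof -
    have "continuous_on {l..u} A" unfolding A_def using l by (intro continuous_intros) auto
    then have "compact (A ` {l..u})" by (intro compact_continuous_image) auto
    then obtain B where B: "\<And>t. t \<in> {l..u} \<Longrightarrow> \<bar>A t\<bar> \<le> B"
      using compact_imp_bounded bounded_iff by (metis (no_types, lifting) image_eqI real_norm_def)
    show ?thesis
    proof (rule uniform_limit_theorem)
      show "uniform_limit {l..u} (\<lambda>X t. \<Sum>p\<in>X. T p t) (ker \<beta>) (finite_subsets_at_top UNIV)"
        unfolding ker_eq
      proof (rule Weierstrass_m_test_general)
        show "(\<lambda>p. m p * B) summable_on UNIV" by (rule summable_on_cmult_left[OF m])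
        show "norm (T p t) \<le> m p * B" if t: "t \<in> {l..u}" for p t
        proof -
          have "\<bar>T p t\<bar> \<le> m p * A t" using T[of t p] t l by auto
          also have "\<dots> \<le> m p * B" using B[OF t] by (intro mult_left_mono) (auto simp: m_def)
          finally show ?thesis by simp
        qed
      qed
      have "Gamma (\<beta> + \<rho> p) \<noteq> 0" for p
        using Gamma_real_pos[OF add_pos_nonneg[OF \<beta> \<rho>_nonneg[of p]]] by simp
      then show "\<forall>\<^sub>F X in finite_subsets_at_top UNIV. continuous_on {l..u} (\<lambda>t. \<Sum>p\<in>X. T p t)"
        unfolding T_def using l by (intro always_eventually allI continuous_intros) auto
    qed auto
  qed
  have "continuous_on {0<..} (ker \<beta>)"
  proof (rule continuous_at_imp_continuous_on, rule ballI)
    fix t :: real assume t: "t \<in> {0<..}"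
    then have "continuous_on {t/2<..<t+1} (ker \<beta>)"
      using cont_ab[of "t/2" "t+1"] by (auto elim: continuous_on_subset)
    then show "isCont (ker \<beta>) t"
      using t by (subst (asm) continuous_on_eq_continuous_at) auto
  qed
  moreover have "\<bar>ker \<beta> t\<bar> \<le> (infsum m UNIV * (2 * exp 2)) * t powr (\<beta> - 1) * exp ((2 * w) * t)" if "0 < t" for t
  proof -
    have "norm (ker \<beta> t) \<le> infsum m UNIV * A t"
      unfolding ker_eq
    proof (rule norm_infsum_le)
      show "((\<lambda>p. T p t) has_sum (\<Sum>\<^sub>\<infinity>p. T p t)) UNIV"
        unfolding T_def by (intro has_sum_infsum terms_summable \<beta> that)
      show "((\<lambda>p. m p * A t) has_sum infsum m UNIV * A t) UNIV"
        by (intro has_sum_cmult_left has_sum_infsum m)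
    qed (use T[OF that] in auto)
    then show ?thesis by (simp add: A_def mult_ac)
  qed
  ultimately show ?thesis using \<beta> unfolding power_kernel_def by blast
qed

end

section \<open>The kernels as Mittag-Leffler series\<close>

context double_kernel
begin

lemma has_sum_mittag_leffler:
  assumes "0 < \<beta>" "0 < t"
  shows "((\<lambda>r. real (h + r choose h) * (- b) ^ r * (t powr (\<alpha> * real r) / Gamma (\<beta> + \<rho> (h, r))))
    has_sum mittag_leffler (real h + 1) \<alpha> (\<beta> + \<sigma> * real h) (- b * t powr \<alpha>)) UNIV"
proof -
  define u where "u = (\<lambda>r. real (h + r choose h) * (- b) ^ r * (t powr (\<alpha> * real r) / Gamma (\<beta> + \<rho> (h, r))))"
  \<comment> \<open>For a = 0 all rows with h > 0 of the double series vanish and say nothing about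
    the inner series. The series with a = 1 has the same rows up to sign and a power of t, so its
    summability serves for every a.\<close>
  interpret one: double_kernel 1 b \<sigma> \<alpha>
    by unfold_locales (use b \<sigma> \<alpha> in auto)
  have "(\<lambda>(h, r). one.coef (h, r) * (t powr (\<beta> + one.\<rho> (h, r) - 1) / Gamma (\<beta> + one.\<rho> (h, r)))) summable_on UNIV \<times> UNIV"
    using one.terms_summable[OF assms] by (simp add: case_prod_unfold)
  then have "(\<lambda>r. one.coef (h, r) * (t powr (\<beta> + one.\<rho> (h, r) - 1) / Gamma (\<beta> + one.\<rho> (h, r)))) summable_on UNIV"
    by (rule summable_on_SigmaD1) simp
  then have "(\<lambda>r. ((- 1) ^ h * t powr (1 - \<beta> - \<sigma> * real h)) *
      (one.coef (h, r) * (t powr (\<beta> + one.\<rho> (h, r) - 1) / Gamma (\<beta> + one.\<rho> (h, r))))) summable_on UNIV"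
    by (rule summable_on_cmult_right)
  moreover have "((- 1) ^ h * t powr (1 - \<beta> - \<sigma> * real h)) *
      (one.coef (h, r) * (t powr (\<beta> + one.\<rho> (h, r) - 1) / Gamma (\<beta> + one.\<rho> (h, r)))) = u r" for r
  proof -
    have "t powr (1 - \<beta> - \<sigma> * real h) * t powr (\<beta> + \<rho> (h, r) - 1) = t powr (\<alpha> * real r)"
      by (simp add: powr_add[symmetric] \<rho>_def)
    moreover have "(- 1) ^ h * (- 1) ^ h = (1 :: real)"
      by (simp flip: power_mult_distrib)
    moreover have "((- 1) ^ h * t powr (1 - \<beta> - \<sigma> * real h)) *
        (one.coef (h, r) * (t powr (\<beta> + \<rho> (h, r) - 1) / Gamma (\<beta> + \<rho> (h, r))))
      = real (h + r choose h) * (- b) ^ r * ((- 1) ^ h * (- 1) ^ h) *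
        ((t powr (1 - \<beta> - \<sigma> * real h) * t powr (\<beta> + \<rho> (h, r) - 1)) / Gamma (\<beta> + \<rho> (h, r)))"
      by (simp add: one.coef_def)
    moreover have "one.\<rho> (h, r) = \<rho> (h, r)" by (simp add: one.\<rho>_def \<rho>_def)
    ultimately show ?thesis by (simp add: u_def)
  qed
  ultimately have "u summable_on UNIV" by simp
  moreover have "(\<Sum>r. u r) = mittag_leffler (real h + 1) \<alpha> (\<beta> + \<sigma> * real h) (- b * t powr \<alpha>)"
    unfolding mittag_leffler_def
  proof (rule suminf_cong)
    fix r
    have G: "Gamma (real h + 1 + real r) = fact (h + r)" "Gamma (real h + 1) = fact h"
      using Gamma_fact[of "h + r", where ?'a=real] Gamma_fact[of h, where ?'a=real] by (simp_all add: add_ac)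
    have "(- b * t powr \<alpha>) ^ r = (- b) ^ r * t powr (\<alpha> * real r)"
      unfolding power_mult_distrib using assms(2) by (simp add: powr_power mult.commute)
    moreover have "real (h + r choose h) = fact (h + r) / (fact h * fact r)"
      by (simp add: binomial_fact)
    moreover have "\<alpha> * real r + (\<beta> + \<sigma> * real h) = \<beta> + \<rho> (h, r)" by (simp add: \<rho>_def)
    ultimately show "u r = Gamma (real h + 1 + real r) * (- b * t powr \<alpha>) ^ r /
        (fact r * Gamma (real h + 1) * Gamma (\<alpha> * real r + (\<beta> + \<sigma> * real h)))"
      unfolding G u_def by (simp only:) (simp add: mult_ac)
  qed
  ultimately have "(u has_sum mittag_leffler (real h + 1) \<alpha> (\<beta> + \<sigma> * real h) (- b * t powr \<alpha>)) UNIV"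
    using has_sum_imp_sums[of u "infsum u UNIV"] by (simp add: has_sum_iff sums_iff)
  then show ?thesis unfolding u_def .
qed

text \<open>Summing the absolutely convergent double series over r first produces the Mittag-Leffler
  functions; the remaining sum over h is an ordinary series.\<close>

lemma ker_eq_mittag_leffler_series:
  assumes "0 < \<beta>" "0 < t"
  shows "ker \<beta> t = t powr (\<beta> - 1) * (\<Sum>h. (- a) ^ h * t powr (\<sigma> * real h) *
    mittag_leffler (real h + 1) \<alpha> (\<beta> + \<sigma> * real h) (- b * t powr \<alpha>))"
proof -
  define W where "W = (\<lambda>h. (- a) ^ h * t powr (\<sigma> * real h) *
    mittag_leffler (real h + 1) \<alpha> (\<beta> + \<sigma> * real h) (- b * t powr \<alpha>))"
  define T where "T = (\<lambda>h r. coef (h, r) * (t powr (\<beta> + \<rho> (h, r) - 1) / Gamma (\<beta> + \<rho> (h, r))))"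
  have T: "(\<lambda>(h, r). T h r) summable_on UNIV \<times> UNIV"
    using terms_summable[OF assms] by (simp add: T_def case_prod_unfold)
  have inner: "infsum (T h) UNIV = t powr (\<beta> - 1) * W h" for h
  proof (rule infsumI)
    have eq: "T h r = t powr (\<beta> - 1) * ((- a) ^ h * t powr (\<sigma> * real h)) *
      (real (h + r choose h) * (- b) ^ r * (t powr (\<alpha> * real r) / Gamma (\<beta> + \<rho> (h, r))))" for r
    proof -
      have "t powr (\<beta> + \<rho> (h, r) - 1) = t powr (\<beta> - 1) * t powr (\<sigma> * real h) * t powr (\<alpha> * real r)"
        by (simp add: powr_add[symmetric] \<rho>_def algebra_simps)
      then show ?thesis by (simp add: T_def coef_def)
    qed
    show "(T h has_sum t powr (\<beta> - 1) * W h) UNIV"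
      unfolding eq[abs_def] W_def
      using has_sum_cmult_right[OF has_sum_mittag_leffler[OF assms, of h], of "t powr (\<beta> - 1) * ((- a) ^ h * t powr (\<sigma> * real h))"]
      by (simp only: mult.assoc eq)
  qed
  have summ: "(\<lambda>h. t powr (\<beta> - 1) * W h) summable_on UNIV"
    using summable_on_Sigma_banach[OF T] by (simp add: inner)
  then have "(\<lambda>h. t powr (1 - \<beta>) * (t powr (\<beta> - 1) * W h)) summable_on UNIV"
    by (rule summable_on_cmult_right)
  moreover have "t powr (1 - \<beta>) * (t powr (\<beta> - 1) * W h) = W h" for h
    using assms(2) by (simp add: mult.assoc[symmetric] powr_add[symmetric])
  ultimately have "W summable_on UNIV" by simp
  then have "infsum W UNIV = suminf W"
    using has_sum_imp_sums[OF has_sum_infsum, of W] by (simp add: sums_iff)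
  moreover have "ker \<beta> t = infsum (\<lambda>h. infsum (T h) UNIV) UNIV"
    using infsum_Sigma'_banach[OF T] by (simp add: ker_def T_def case_prod_unfold)
  ultimately show ?thesis by (simp add: inner infsum_cmult_right' W_def)
qed

end

text \<open>The Laplace exponent of the mixed stable subordinator.\<close>

definition mixed_exponent :: "real \<Rightarrow> real \<Rightarrow> real \<Rightarrow> real \<Rightarrow> real \<Rightarrow> real" where
  "mixed_exponent \<alpha>1 \<alpha>2 c1 c2 z = c1 * z powr \<alpha>1 + c2 * z powr \<alpha>2"

locale mixed_kernels =
  fixes \<Lambda> \<alpha>1 \<alpha>2 c1 c2 :: real
  assumes \<Lambda>: "0 \<le> \<Lambda>" and \<alpha>2: "0 < \<alpha>2" "\<alpha>2 < \<alpha>1" and \<alpha>1: "\<alpha>1 < 1" and c1: "0 < c1" and c2: "0 \<le> c2"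
begin

text \<open>These parameters arise from dividing \<psi> z + \<Lambda> by c1 z powr
  \<alpha>1.\<close>

sublocale double_kernel "c2 / c1" "\<Lambda> / c1" "\<alpha>1 - \<alpha>2" \<alpha>1
  by unfold_locales (use \<Lambda> \<alpha>2 \<alpha>1 c1 c2 in auto)

abbreviation \<psi> :: "real \<Rightarrow> real" where "\<psi> \<equiv> mixed_exponent \<alpha>1 \<alpha>2 c1 c2"

lemma kernel_exponent_pos:
  assumes "1 \<le> N" "\<alpha> < 1"
  shows "0 < \<alpha>1 + (1 - \<alpha>) / real N"
  using assms \<alpha>2 by (intro add_pos_nonneg) auto

lemma f_kernel_eq_ker:
  assumes "1 \<le> N" "0 < t"
  shows "f_kernel \<Lambda> \<alpha>1 \<alpha>2 c1 c2 N t = ker (\<alpha>1 + (1 - \<alpha>1) / real N) t"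
proof -
  have "\<alpha>1 - (\<alpha>1 - 1) / real N - 1 = \<alpha>1 + (1 - \<alpha>1) / real N - 1"
    by (simp add: diff_divide_distrib)
  moreover have "\<alpha>1 + (\<alpha>1 - \<alpha>2) * real h + (1 - \<alpha>1) / real N = \<alpha>1 + (1 - \<alpha>1) / real N + (\<alpha>1 - \<alpha>2) * real h" for h
    by simp
  ultimately show ?thesis
    unfolding f_kernel_def ker_eq_mittag_leffler_series[OF kernel_exponent_pos[OF assms(1) \<alpha>1] assms(2)]
    by (simp only:)
qed

lemma g_kernel_eq_ker:
  assumes "1 \<le> N" "0 < t"
  shows "g_kernel \<Lambda> \<alpha>1 \<alpha>2 c1 c2 N t = ker (\<alpha>1 + (1 - \<alpha>2) / real N) t"
proof -
  have "\<alpha>1 - (\<alpha>2 - 1) / real N - 1 = \<alpha>1 + (1 - \<alpha>2) / real N - 1"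
    by (simp add: diff_divide_distrib)
  moreover have "\<alpha>1 + (\<alpha>1 - \<alpha>2) * real h + (1 - \<alpha>2) / real N = \<alpha>1 + (1 - \<alpha>2) / real N + (\<alpha>1 - \<alpha>2) * real h" for h
    by simp
  moreover have "\<alpha>2 < 1" using \<alpha>2 \<alpha>1 by simp
  ultimately show ?thesis
    unfolding g_kernel_def
    by (simp only: ker_eq_mittag_leffler_series[OF kernel_exponent_pos[OF assms(1)] assms(2)])
qed

lemma power_kernel_cong:
  assumes "power_kernel f" "\<And>t. 0 < t \<Longrightarrow> g t = f t"
  shows "power_kernel g"
proof -
  have "continuous_on {0<..} g \<longleftrightarrow> continuous_on {0<..} f"
    by (rule continuous_on_cong) (use assms(2) in auto)
  then show ?thesis using assms by (simp add: power_kernel_def)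
qed

lemma power_kernel_fg:
  assumes "1 \<le> N"
  shows "power_kernel (f_kernel \<Lambda> \<alpha>1 \<alpha>2 c1 c2 N)" "power_kernel (g_kernel \<Lambda> \<alpha>1 \<alpha>2 c1 c2 N)"
proof -
  have "\<alpha>2 < 1" using \<alpha>2 \<alpha>1 by simp
  show "power_kernel (f_kernel \<Lambda> \<alpha>1 \<alpha>2 c1 c2 N)"
    by (rule power_kernel_cong[OF power_kernel_ker[OF kernel_exponent_pos[OF assms \<alpha>1]] f_kernel_eq_ker[OF assms]])
  show "power_kernel (g_kernel \<Lambda> \<alpha>1 \<alpha>2 c1 c2 N)"
    by (rule power_kernel_cong[OF power_kernel_ker[OF kernel_exponent_pos[OF assms \<open>\<alpha>2 < 1\<close>]] g_kernel_eq_ker[OF assms]])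
qed

lemma mixed_conv_continuous:
  assumes "1 \<le> N"
  shows "continuous_on {0<..} (mixed_conv \<Lambda> \<alpha>1 \<alpha>2 c1 c2 N)"
  using power_kernel_conv_power[OF power_kernel_fg(1)[OF assms], of N]
    power_kernel_conv_power[OF power_kernel_fg(2)[OF assms], of N]
  unfolding mixed_conv_def[abs_def] power_kernel_def by (intro continuous_intros) auto

text \<open>The shift (1 - \<alpha>) / N in the exponent is chosen so that its N-fold effect is a
  single factor z powr (\<alpha> - 1), whatever N is.\<close>

lemma ker_laplace_conv_power:
  assumes z: "0 < z" "c2 / c1 * z powr (- (\<alpha>1 - \<alpha>2)) + \<Lambda> / c1 * z powr (- \<alpha>1) < 1"
    and N: "1 \<le> N" and f: "\<And>t. 0 < t \<Longrightarrow> f t = ker (\<alpha>1 + (1 - \<alpha>) / real N) t" and "\<alpha> < 1"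
  shows "has_laplace (conv_power f N) z (z powr (\<alpha> - 1) * (c1 / (\<psi> z + \<Lambda>)) ^ N)"
proof -
  define \<beta> where "\<beta> = \<alpha>1 + (1 - \<alpha>) / real N"
  have den: "1 + c2 / c1 * z powr (- (\<alpha>1 - \<alpha>2)) + \<Lambda> / c1 * z powr (- \<alpha>1) = z powr (- \<alpha>1) * ((\<psi> z + \<Lambda>) / c1)"
  proof -
    have "z powr (- \<alpha>1) * z powr \<alpha>1 = 1" "z powr (- \<alpha>1) * z powr \<alpha>2 = z powr (- (\<alpha>1 - \<alpha>2))"
      using z(1) by (simp_all add: powr_add[symmetric])
    then show ?thesis using c1 by (simp add: mixed_exponent_def field_simps)
  qed
  have "0 < \<beta>" unfolding \<beta>_def using N assms(5) by (rule kernel_exponent_pos)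
  then have "has_laplace f z (z powr (- \<beta>) / (z powr (- \<alpha>1) * ((\<psi> z + \<Lambda>) / c1)))"
    using has_laplace_cong[OF has_laplace_ker[of \<beta> z]] z f unfolding den \<beta>_def by simp
  then have "has_laplace (conv_power f N) z ((z powr (- \<beta>) / (z powr (- \<alpha>1) * ((\<psi> z + \<Lambda>) / c1))) ^ N)"
    by (rule has_laplace_conv_power) fact
  moreover have "(z powr (- \<beta>) / (z powr (- \<alpha>1) * ((\<psi> z + \<Lambda>) / c1))) ^ N = z powr (\<alpha> - 1) * (c1 / (\<psi> z + \<Lambda>)) ^ N"
  proof -
    have "z powr (- \<beta>) / z powr (- \<alpha>1) = z powr ((\<alpha> - 1) / real N)"
      unfolding powr_diff[symmetric] by (simp add: \<beta>_def diff_divide_distrib)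
    then have "z powr (- \<beta>) / (z powr (- \<alpha>1) * ((\<psi> z + \<Lambda>) / c1)) = z powr ((\<alpha> - 1) / real N) * (c1 / (\<psi> z + \<Lambda>))"
      by (metis divide_divide_eq_left divide_divide_eq_right times_divide_eq_right)
    moreover have "(z powr ((\<alpha> - 1) / real N)) ^ N = z powr (\<alpha> - 1)"
      using z(1) N by (simp add: powr_power)
    ultimately show ?thesis by (simp only: power_mult_distrib)
  qed
  ultimately show ?thesis by simp
qed

text \<open>The cases \<alpha> = \<alpha>1 and \<alpha> = \<alpha>2, weighted by c1 and c2, add up
  to \<psi> z / z. The threshold from \<open>large_ok\<close> does not depend on N.\<close>

lemma has_laplace_mixed_conv:
  "\<exists>z0>0. \<forall>z\<ge>z0. \<forall>N\<ge>1. has_laplace (\<lambda>t. mixed_conv \<Lambda> \<alpha>1 \<alpha>2 c1 c2 N t / c1 ^ N) z (\<psi> z / z * (1 / (\<psi> z + \<Lambda>) ^ N))"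
proof -
  obtain z0 where z0: "0 < z0" "\<And>z. z0 \<le> z \<Longrightarrow> c2 / c1 * z powr (- (\<alpha>1 - \<alpha>2)) + \<Lambda> / c1 * z powr (- \<alpha>1) < 1"
    using large_ok by auto
  have "has_laplace (\<lambda>t. mixed_conv \<Lambda> \<alpha>1 \<alpha>2 c1 c2 N t / c1 ^ N) z (\<psi> z / z * (1 / (\<psi> z + \<Lambda>) ^ N))"
    if z: "z0 \<le> z" and N: "1 \<le> N" for z N
  proof -
    have zp: "0 < z" using z z0(1) by simp
    have \<alpha>2': "\<alpha>2 < 1" using \<alpha>2 \<alpha>1 by simp
    have "has_laplace (\<lambda>t. (1 / c1 ^ N) * (c1 * conv_power (f_kernel \<Lambda> \<alpha>1 \<alpha>2 c1 c2 N) N t +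
        c2 * conv_power (g_kernel \<Lambda> \<alpha>1 \<alpha>2 c1 c2 N) N t)) z
      ((1 / c1 ^ N) * (c1 * (z powr (\<alpha>1 - 1) * (c1 / (\<psi> z + \<Lambda>)) ^ N) + c2 * (z powr (\<alpha>2 - 1) * (c1 / (\<psi> z + \<Lambda>)) ^ N)))"
      by (intro has_laplace_cmult has_laplace_add ker_laplace_conv_power zp z0 z N \<alpha>1 \<alpha>2'
          f_kernel_eq_ker g_kernel_eq_ker)
    moreover have "(1 / c1 ^ N) * (c1 * (z powr (\<alpha>1 - 1) * (c1 / (\<psi> z + \<Lambda>)) ^ N) + c2 * (z powr (\<alpha>2 - 1) * (c1 / (\<psi> z + \<Lambda>)) ^ N))
       = \<psi> z / z * (1 / (\<psi> z + \<Lambda>) ^ N)"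
    proof -
      have "z powr (\<alpha>1 - 1) = z powr \<alpha>1 / z" "z powr (\<alpha>2 - 1) = z powr \<alpha>2 / z"
        using zp by (simp_all add: powr_diff)
      then have "c1 * z powr (\<alpha>1 - 1) + c2 * z powr (\<alpha>2 - 1) = \<psi> z / z"
        by (simp add: mixed_exponent_def add_divide_distrib)
      moreover have "(1 / c1 ^ N) * (c1 * (z powr (\<alpha>1 - 1) * (c1 / (\<psi> z + \<Lambda>)) ^ N) + c2 * (z powr (\<alpha>2 - 1) * (c1 / (\<psi> z + \<Lambda>)) ^ N))
        = (c1 * z powr (\<alpha>1 - 1) + c2 * z powr (\<alpha>2 - 1)) * ((c1 / (\<psi> z + \<Lambda>)) ^ N / c1 ^ N)"
        by (simp add: algebra_simps add_divide_distrib)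
      moreover have "(c1 / (\<psi> z + \<Lambda>)) ^ N / c1 ^ N = 1 / (\<psi> z + \<Lambda>) ^ N"
        using c1 by (simp add: power_divide)
      ultimately show ?thesis by simp
    qed
    ultimately show ?thesis by (simp add: mixed_conv_def)
  qed
  then show ?thesis using z0(1) by blast
qed

end

section \<open>The queue counted in service phases\<close>

text \<open>
  A busy state \<open>(n, s)\<close> is encoded by the number \<open>k * (n - 1) + s\<close> of service phases still to be
  completed, the empty queue by \<open>0\<close>. Then an arrival adds \<open>k\<close> and a phase completion subtracts \<open>1\<close>.
\<close>

definition nth_state :: "nat \<Rightarrow> nat \<Rightarrow> nat \<times> nat" where
  "nth_state k L = (if L = 0 then (0, 0) else ((L - 1) div k + 1, (L - 1) mod k + 1))"

lemma nth_state_0 [simp]: "nth_state k 0 = (0, 0)"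
  by (simp add: nth_state_def)

lemma nth_state_busy:
  assumes "1 \<le> s" "s \<le> k"
  shows "nth_state k (k * n + s) = (n + 1, s)"
proof -
  obtain s' where "s = Suc s'" using assms(1) by (cases s) auto
  then show ?thesis using assms(2) by (simp add: nth_state_def)
qed

lemma nat_phase_cases:
  fixes k L :: nat
  assumes "1 \<le> k"
  obtains "L = 0" | n s where "1 \<le> s" "s \<le> k" "L = k * n + s"
proof (cases "L = 0")
  case True
  then show ?thesis by (rule that(1))
next
  case False
  have "(L - 1) mod k < k" using assms by simp
  moreover have "L = k * ((L - 1) div k) + ((L - 1) mod k + 1)"
    using False by (simp only: add.assoc[symmetric] mult_div_mod_eq)
  ultimately show ?thesis using that(2)[of "(L - 1) mod k + 1" "(L - 1) div k"] by simp
qed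

lemma bij_betw_nth_state:
  assumes k: "1 \<le> k"
  shows "bij_betw (nth_state k) UNIV (queue_states k)"
proof (rule bij_betw_byWitness[where f' = "\<lambda>(n, s). if n = 0 then 0 else k * (n - 1) + s"])
  show "\<forall>L\<in>UNIV. (case nth_state k L of (n, s) \<Rightarrow> if n = 0 then 0 else k * (n - 1) + s) = L"
  proof safe
    fix L show "(case nth_state k L of (n, s) \<Rightarrow> if n = 0 then 0 else k * (n - 1) + s) = L"
      by (cases rule: nat_phase_cases[OF k, of L]) (use k in \<open>auto simp: nth_state_busy\<close>)
  qed
  show "\<forall>x\<in>queue_states k. nth_state k (case x of (n, s) \<Rightarrow> if n = 0 then 0 else k * (n - 1) + s) = x"
    by (auto simp: queue_states_def busy_states_def nth_state_busy)
  show "nth_state k ` UNIV \<subseteq> queue_states k"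
  proof (rule image_subsetI)
    fix L show "nth_state k L \<in> queue_states k"
      by (cases rule: nat_phase_cases[OF k, of L]) (use k in \<open>auto simp: queue_states_def busy_states_def nth_state_busy\<close>)
  qed
  show "(\<lambda>(n, s). if n = 0 then 0 else k * (n - 1) + s) ` queue_states k \<subseteq> UNIV" by simp
qed

lemma arrival_nth_state:
  assumes k: "1 \<le> k"
  shows "arrival k (nth_state k L) y \<longleftrightarrow> y = nth_state k (L + k)"
proof (cases rule: nat_phase_cases[OF k, of L])
  case 1
  then show ?thesis
    using k nth_state_busy[of k k 0] by (auto simp: arrival_def busy_states_def)
next
  case (2 n s)
  have "nth_state k (L + k) = (n + 2, s)"
    using nth_state_busy[of s k "n + 1"] 2 by (simp add: algebra_simps)
  then show ?thesis using 2 by (auto simp: arrival_def busy_states_def nth_state_busy)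
qed

lemma phase_completion_nth_state:
  assumes k: "1 \<le> k"
  shows "phase_completion k (nth_state k L) y \<longleftrightarrow> L \<noteq> 0 \<and> y = nth_state k (L - 1)"
proof (cases rule: nat_phase_cases[OF k, of L])
  case 1
  then show ?thesis by (auto simp: phase_completion_def busy_states_def)
next
  case (2 n s)
  have L: "nth_state k L = (n + 1, s)" using 2 by (simp add: nth_state_busy)
  show ?thesis
  proof (cases "s = 1")
    case False
    then have "nth_state k (L - 1) = (n + 1, s - 1)"
      using nth_state_busy[of "s - 1" k n] 2 by simp
    then show ?thesis using 2 False L by (auto simp: phase_completion_def busy_states_def)
  next
    case True
    show ?thesis
    proof (cases n)
      case 0
      then show ?thesis using 2 True L by (auto simp: phase_completion_def busy_states_def)
    next
      case (Suc m)
      then have "nth_state k (L - 1) = (n, k)"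
        using nth_state_busy[of k k m] k 2 True by (simp add: algebra_simps)
      then show ?thesis using 2 True L Suc by (auto simp: phase_completion_def busy_states_def)
    qed
  qed
qed

text \<open>Writing a completion as \<open>L = Suc L'\<close> excludes it in the empty state without
  a separate case.\<close>

definition phase_rate :: "real \<Rightarrow> real \<Rightarrow> nat \<Rightarrow> nat \<Rightarrow> nat \<Rightarrow> real" where
  "phase_rate lam \<kappa> k L L' = (if L' = L + k then lam else if L = Suc L' then \<kappa> else 0)"

lemma erlang_rate_nth_state:
  assumes k: "1 \<le> k"
  shows "erlang_rate lam mu k (nth_state k L) (nth_state k L') = phase_rate lam (real k * mu) k L L'"
proof -
  have "inj (nth_state k)" using bij_betw_nth_state[OF k] by (simp add: bij_betw_def)
  then have "nth_state k L' = nth_state k M \<longleftrightarrow> L' = M" for M by (auto simp: inj_def)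
  then show ?thesis
    by (auto simp: erlang_rate_def phase_rate_def arrival_nth_state[OF k] phase_completion_nth_state[OF k])
qed

lemma transition_function_nth_state:
  assumes k: "1 \<le> k" and P: "transition_function (queue_states k) (erlang_rate lam mu k) P"
  shows "transition_function UNIV (phase_rate lam (real k * mu) k) (\<lambda>t x y. P t (nth_state k x) (nth_state k y))"
proof -
  let ?f = "nth_state k"
  note bij = bij_betw_nth_state[OF k]
  have inj: "?f x = ?f y \<longleftrightarrow> x = y" for x y using bij by (auto simp: bij_betw_def inj_def)
  have S: "?f x \<in> queue_states k" for x using bij by (auto simp: bij_betw_def)
  have sum1: "((\<lambda>y. g (?f y)) has_sum v) UNIV \<longleftrightarrow> (g has_sum v) (queue_states k)" for g :: "nat \<times> nat \<Rightarrow> real" and v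
    by (rule has_sum_reindex_bij_betw[OF bij])
  have bij': "bij_betw ?f (UNIV - {x}) (queue_states k - {?f x})" for x
    by (rule bij_betw_subset[OF bij]) (use bij in \<open>auto simp: bij_betw_def image_set_diff\<close>)
  have rate: "(\<Sum>\<^sub>\<infinity>y\<in>UNIV - {x}. phase_rate lam (real k * mu) k x y)
      = (\<Sum>\<^sub>\<infinity>y\<in>queue_states k - {?f x}. erlang_rate lam mu k (?f x) y)" for x
    using infsum_reindex_bij_betw[OF bij'[of x], of "erlang_rate lam mu k (?f x)"]
    by (simp add: erlang_rate_nth_state[OF k])
  show ?thesis
    using P unfolding transition_function_def rate sum1
    by (auto simp: S inj sum1[where g="\<lambda>z. P _ _ z * P _ z _"] simp flip: erlang_rate_nth_state[OF k])
qed

lemma phase_rate_exit: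
  assumes k: "1 \<le> k"
  shows "(\<Sum>\<^sub>\<infinity>y\<in>UNIV - {x}. phase_rate lam \<kappa> k x y) = lam + (if x = 0 then 0 else \<kappa>)"
proof -
  define A where "A = (if x = 0 then {x + k} else {x + k, x - 1})"
  have "(\<Sum>\<^sub>\<infinity>y\<in>UNIV - {x}. phase_rate lam \<kappa> k x y) = (\<Sum>\<^sub>\<infinity>y\<in>A. phase_rate lam \<kappa> k x y)"
    by (rule infsum_cong_neutral) (use k in \<open>auto simp: phase_rate_def A_def split: if_splits\<close>)
  also have "\<dots> = (\<Sum>y\<in>A. phase_rate lam \<kappa> k x y)"
    by (rule infsum_finite) (simp add: A_def)
  also have "\<dots> = lam + (if x = 0 then 0 else \<kappa>)"
    using k by (cases x) (auto simp: phase_rate_def A_def)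
  finally show ?thesis .
qed

text \<open>\<kappa> is the completion rate of one phase; it is tied to \<open>real k * mu\<close>
  only in \<open>erlang_params\<close>.\<close>

locale phase_params =
  fixes lam \<kappa> :: real and k :: nat
  assumes lam: "0 < lam" and \<kappa>: "0 < \<kappa>" and k: "1 \<le> k"
begin

abbreviation \<Lambda> :: real where "\<Lambda> \<equiv> lam + \<kappa>"

end

section \<open>Regularity and resolvent of the transition function\<close>

locale phase_chain = phase_params +
  fixes R :: "real \<Rightarrow> nat \<Rightarrow> nat \<Rightarrow> real"
  assumes R: "transition_function UNIV (phase_rate lam \<kappa> k) R"
begin

lemma R_nonneg: "0 \<le> t \<Longrightarrow> 0 \<le> R t x y"
  and R_sum: "0 \<le> t \<Longrightarrow> (R t x has_sum 1) UNIV"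
  and R_0: "R 0 x y = (if x = y then 1 else 0)"
  and R_add: "0 \<le> s \<Longrightarrow> 0 \<le> t \<Longrightarrow> ((\<lambda>z. R s x z * R t z y) has_sum R (s + t) x y) UNIV"
  and R_rate: "x \<noteq> y \<Longrightarrow> ((\<lambda>h. R h x y / h) \<longlongrightarrow> phase_rate lam \<kappa> k x y) (at_right 0)"
  and R_exit: "((\<lambda>h. (1 - R h x x) / h) \<longlongrightarrow> lam + (if x = 0 then 0 else \<kappa>)) (at_right 0)"
  using R phase_rate_exit[OF k] by (simp_all add: transition_function_def)

lemma R_le_1: "0 \<le> t \<Longrightarrow> R t x y \<le> 1"
  using finite_sum_le_has_sum[OF R_sum, of t "{y}" x] R_nonneg by simp

lemma R_off_diag:
  assumes "0 \<le> t" "x \<noteq> y"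
  shows "R t x y \<le> 1 - R t x x"
  using finite_sum_le_has_sum[OF R_sum[OF assms(1)], of "{x, y}" x] R_nonneg[OF assms(1)] assms(2) by simp

lemma R_diag_super: "0 \<le> s \<Longrightarrow> 0 \<le> t \<Longrightarrow> R s x x * R t x x \<le> R (s + t) x x"
  using finite_sum_le_has_sum[OF R_add, of s t "{x}" x x] R_nonneg by simp

lemma R_diag_power: "0 \<le> t \<Longrightarrow> R t x x ^ n \<le> R (real n * t) x x"
proof (induction n)
  case (Suc n)
  have "R t x x * R t x x ^ n \<le> R t x x * R (real n * t) x x"
    using Suc R_nonneg by (intro mult_left_mono) auto
  also have "\<dots> \<le> R (t + real n * t) x x" using Suc.prems by (intro R_diag_super) auto
  finally show ?case by (simp add: algebra_simps)
qed (simp add: R_0)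

text \<open>Divide h into n pieces of length u. Bernoulli's inequality gives 1 - R h x x \<le> n (1
  - R u x x), and as n grows the right side tends to h times the exit rate. The derivative at 0 thus
  yields a bound for every h.\<close>

lemma R_diag_lower:
  assumes h: "0 < h"
  shows "1 - R h x x \<le> h * \<Lambda>"
proof -
  have *: "1 - R h x x \<le> h * ((1 - R (h / real (Suc n)) x x) / (h / real (Suc n)))" for n
  proof -
    let ?u = "h / real (Suc n)"
    have "1 + real (Suc n) * (R ?u x x - 1) \<le> (1 + (R ?u x x - 1)) ^ Suc n"
      using R_nonneg[of ?u x x] h by (intro Bernoulli_inequality) auto
    also have "\<dots> \<le> R (real (Suc n) * ?u) x x"
      using R_diag_power[of ?u x "Suc n"] h by (simp del: power_Suc of_nat_Suc)
    also have "real (Suc n) * ?u = h" by (simp del: of_nat_Suc)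
    finally have "1 - R h x x \<le> real (Suc n) * (1 - R ?u x x)"
      by (simp add: right_diff_distrib del: of_nat_Suc)
    also have "\<dots> = h * ((1 - R ?u x x) / ?u)" using h by (simp del: of_nat_Suc)
    finally show ?thesis .
  qed
  have "(\<lambda>n. h / real (Suc n)) \<longlonglongrightarrow> 0"
    by (rule LIMSEQ_Suc[OF lim_const_over_n])
  then have "filterlim (\<lambda>n. h / real (Suc n)) (at_right 0) sequentially"
    using h by (auto simp: filterlim_at intro!: always_eventually)
  from filterlim_compose[OF R_exit this]
  have lim: "(\<lambda>n. h * ((1 - R (h / real (Suc n)) x x) / (h / real (Suc n)))) \<longlonglongrightarrow> h * (lam + (if x = 0 then 0 else \<kappa>))"
    by (intro tendsto_mult_left)
  have "1 - R h x x \<le> h * (lam + (if x = 0 then 0 else \<kappa>))"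
    by (rule LIMSEQ_le_const[OF lim]) (use * in blast)
  also have "\<dots> \<le> h * \<Lambda>" using h \<kappa> by (intro mult_left_mono) auto
  finally show ?thesis .
qed

text \<open>The short step is taken first: staying at x contributes R h x x * R t x y, and all other
  intermediate states together at most 1 - R h x x.\<close>

lemma R_Lipschitz:
  assumes t: "0 \<le> t" and h: "0 < h"
  shows "\<bar>R (t + h) x y - R t x y\<bar> \<le> h * \<Lambda>"
proof -
  have hs: "((\<lambda>z. R h x z * R t z y) has_sum R (t + h) x y) UNIV"
    using R_add[of h t x y] t h by (simp add: add.commute)
  have "R h x x * R t x y \<le> R (t + h) x y"
    using finite_sum_le_has_sum[OF hs, of "{x}"] R_nonneg t h by simp
  moreover have "R (t + h) x y \<le> R h x x * R t x y - R h x x + 1"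
  proof (rule has_sum_mono[OF hs])
    show "((\<lambda>z. (if z = x then R h x x * R t x y - R h x x else 0) + R h x z) has_sum (R h x x * R t x y - R h x x + 1)) UNIV"
      by (intro has_sum_add has_sum_finite_neutralI[of "{x}"] R_sum) (use h in auto)
    show "R h x z * R t z y \<le> (if z = x then R h x x * R t x y - R h x x else 0) + R h x z" for z
      using R_le_1[OF t, of z y] R_nonneg[of h x z] h by (auto simp: mult_left_le)
  qed
  moreover have "R h x x * R t x y \<le> R t x y"
    using R_le_1[of h x x] R_nonneg[of t x y] R_nonneg[of h x x] t h by (simp add: mult_left_le_one_le)
  moreover have "R t x y * (1 - R h x x) \<le> 1 - R h x x"
    using R_le_1[of t x y] R_le_1[of h x x] t h R_nonneg[of t x y] by (simp add: mult_left_le_one_le)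
  ultimately show ?thesis using R_diag_lower[OF h, of x] by (simp add: abs_le_iff algebra_simps)
qed

lemma R_continuous: "continuous_on {0..} (\<lambda>t. R t x y)"
proof (rule lipschitz_on_continuous_on)
  show "(\<Lambda>)-lipschitz_on {0..} (\<lambda>t. R t x y)"
  proof (rule lipschitz_onI)
    fix s t :: real assume st: "s \<in> {0..}" "t \<in> {0..}"
    consider "s = t" | "s < t" | "t < s" by linarith
    then show "dist (R s x y) (R t x y) \<le> \<Lambda> * dist s t"
    proof cases
      case 2
      then show ?thesis using R_Lipschitz[of s "t - s" x y] st by (simp add: dist_real_def mult.commute)
    next
      case 3
      then show ?thesis using R_Lipschitz[of t "s - t" x y] st by (simp add: dist_real_def mult.commute)
    qed simp
  qed (use lam \<kappa> in simp)
qed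

text \<open>The row of the resolvent that belongs to the empty state.\<close>

definition \<pi> :: "real \<Rightarrow> nat \<Rightarrow> real" where
  "\<pi> z y = (\<integral>t. indicator {0<..} t * (exp (- (z * t)) * R t 0 y) \<partial>lborel)"

lemma has_laplace_one: "0 < z \<Longrightarrow> has_laplace (\<lambda>_. 1) z (1 / z)"
  using has_laplace_cong[OF has_laplace_phase_density[of 1 z 0], of "\<lambda>_. 1"]
  by (simp add: phase_density_def)

lemma R_indicator_measurable [measurable]:
  "(\<lambda>t. indicator {0<..} t * (exp (- (z * t)) * R t x y)) \<in> borel_measurable borel"
proof -
  have "(\<lambda>t. indicator {0<..} t *\<^sub>R (exp (- (z * t)) * R t x y)) \<in> borel_measurable borel"
    by (intro borel_measurable_continuous_on_indicator continuous_intros continuous_on_subset[OF R_continuous]) auto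
  then show ?thesis by simp
qed

lemma has_laplace_R:
  assumes "0 < z"
  shows "has_laplace (\<lambda>t. R t 0 y) z (\<pi> z y)"
proof -
  have "integrable lborel (\<lambda>t. indicator {0<..} t * (exp (- (z * t)) * R t 0 y))"
  proof (rule Bochner_Integration.integrable_bound)
    show "integrable lborel (\<lambda>t. indicator {0<..} t * (exp (- (z * t)) * 1))"
      using has_laplace_one[OF assms] by (auto simp: has_laplace_def has_bochner_integral_iff)
    show "AE t in lborel. norm (indicator {0<..} t * (exp (- (z * t)) * R t 0 y)) \<le> norm (indicator {0<..} t * (exp (- (z * t)) * 1))"
      using R_le_1[of _ 0 y] R_nonneg[of _ 0 y] by (intro AE_I2) (auto simp: indicator_def abs_mult)
  qed simp
  then show ?thesis by (simp add: has_laplace_def \<pi>_def has_bochner_integral_iff)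
qed

lemma \<pi>_nonneg: "0 < z \<Longrightarrow> 0 \<le> \<pi> z y"
  by (rule has_laplace_nonneg[OF has_laplace_R]) (auto simp: R_nonneg)

lemma \<pi>_summable:
  assumes z: "0 < z"
  shows "summable (\<pi> z)"
proof (rule bounded_imp_summable)
  fix n
  have L: "has_laplace (\<lambda>t. \<Sum>y\<le>n. R t 0 y) z (\<Sum>y\<le>n. \<pi> z y)" for n
    by (induction n) (simp_all add: has_laplace_R z has_laplace_add)
  have "0 \<le> 1 / z - (\<Sum>y\<le>n. \<pi> z y)"
    by (rule has_laplace_nonneg[OF has_laplace_diff[OF has_laplace_one[OF z] L]])
      (use finite_sum_le_has_sum[OF R_sum, of _ "{..n}" 0] R_nonneg in auto)
  then show "(\<Sum>y\<le>n. \<pi> z y) \<le> 1 / z" by simp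
qed (rule \<pi>_nonneg[OF z])

text \<open>The semigroup identity for t + h, transformed in t with h fixed; later h tends to
  0.\<close>

lemma has_laplace_R_shift_series:
  assumes z: "0 < z" and h: "0 \<le> h"
  shows "has_laplace (\<lambda>t. R (t + h) 0 y) z (\<Sum>x. \<pi> z x * R h x y)"
    and "summable (\<lambda>x. \<pi> z x * R h x y)"
proof -
  have L: "has_laplace (\<lambda>t. R t 0 x * R h x y) z (\<pi> z x * R h x y)" for x
    using has_laplace_cmult[OF has_laplace_R[OF z], of "R h x y" x] by (simp add: mult.commute)
  have nn: "0 \<le> \<pi> z x * R h x y" for x using \<pi>_nonneg[OF z] R_nonneg[OF h] by simp
  show s: "summable (\<lambda>x. \<pi> z x * R h x y)"
    by (rule summable_comparison_test'[OF \<pi>_summable[OF z]])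
      (use nn \<pi>_nonneg[OF z] R_le_1[OF h] in \<open>auto simp: mult_left_le\<close>)
  have "has_laplace (\<lambda>t. \<Sum>\<^sub>\<infinity>x. R t 0 x * R h x y) z (\<Sum>\<^sub>\<infinity>x. \<pi> z x * R h x y)"
  proof (rule has_laplace_infsum[OF _ L])
    show "has_laplace (\<lambda>t. \<bar>R t 0 x * R h x y\<bar>) z (\<pi> z x * R h x y)" for x
      by (rule has_laplace_cong[OF L]) (simp add: R_nonneg h)
    show "(\<lambda>x. \<pi> z x * R h x y) summable_on UNIV"
      using s nn by (simp add: summable_on_UNIV_nonneg_real_iff)
    show "(\<lambda>x. R t 0 x * R h x y) summable_on UNIV" if "0 < t" for t
      using R_add[of t h 0 y] that h by (auto simp: summable_on_def)
  qed simp
  moreover have "(\<Sum>\<^sub>\<infinity>x. R t 0 x * R h x y) = R (t + h) 0 y" if "0 < t" for t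
    using R_add[of t h 0 y] that h by (simp add: infsumI)
  moreover have "(\<Sum>\<^sub>\<infinity>x. \<pi> z x * R h x y) = (\<Sum>x. \<pi> z x * R h x y)"
    using s nn has_sum_imp_sums[OF has_sum_infsum, of "\<lambda>x. \<pi> z x * R h x y"]
    by (simp add: summable_on_UNIV_nonneg_real_iff sums_iff)
  ultimately show "has_laplace (\<lambda>t. R (t + h) 0 y) z (\<Sum>x. \<pi> z x * R h x y)"
    using has_laplace_cong by fastforce
qed

text \<open>The transform of the path shifted by h is exp (z h) times the part of the resolvent
  integral beyond h.\<close>

lemma shift_series_eq:
  assumes z: "0 < z" and h: "0 \<le> h"
  shows "(\<Sum>x. \<pi> z x * R h x y) = exp (z * h) * (\<pi> z y - integral {0..h} (\<lambda>t. exp (- (z * t)) * R t 0 y))"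
proof -
  define w where "w = (\<lambda>t. exp (- (z * t)) * R t 0 y)"
  have c: "continuous_on {0..h} w"
    unfolding w_def by (intro continuous_intros continuous_on_subset[OF R_continuous]) auto
  have i0: "integrable lborel (\<lambda>t. indicator {0<..} t * w t)" "(\<integral>t. indicator {0<..} t * w t \<partial>lborel) = \<pi> z y"
    using has_laplace_R[OF z, of y] by (auto simp: has_laplace_def has_bochner_integral_iff w_def)
  have si: "set_integrable lborel {0..h} w"
    by (rule borel_integrable_atLeastAtMost') (rule c)
  have I: "(\<integral>t. indicator {0..h} t * w t \<partial>lborel) = integral {0..h} w"
    using set_borel_integral_eq_integral(2)[OF si] by (simp add: set_lebesgue_integral_def)
  have "(\<integral>t. indicator {h<..} t * w t \<partial>lborel) = (\<integral>t. indicator {0<..} t * w t - indicator {0..h} t * w t \<partial>lborel)"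
  proof (rule integral_cong_AE)
    \<comment> \<open>The exceptional point is t = 0, which belongs to \<open>{0..h}\<close> but not
      to \<open>{0<..}\<close>.\<close>
    show "AE t in lborel. indicator {h<..} t * w t = indicator {0<..} t * w t - indicator {0..h} t * w t"
      using AE_lborel_singleton[of 0] by eventually_elim (use h in \<open>auto simp: indicator_def\<close>)
    have "(\<lambda>t. indicator {h<..} t * (indicator {0<..} t * w t)) \<in> borel_measurable lborel"
      by (rule borel_measurable_times[OF _ borel_measurable_integrable[OF i0(1)]]) simp
    moreover have "indicator {h<..} t * (indicator {0<..} t * w t) = indicator {h<..} t * w t" for t
      using h by (auto simp: indicator_def)
    ultimately show "(\<lambda>t. indicator {h<..} t * w t) \<in> borel_measurable lborel" by simp
  qed (use i0 si in \<open>auto simp: set_integrable_def\<close>)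
  also have "\<dots> = \<pi> z y - integral {0..h} w"
    using i0 si I by (subst Bochner_Integration.integral_diff) (auto simp: set_integrable_def)
  finally have tail: "(\<integral>t. indicator {h<..} t * w t \<partial>lborel) = \<pi> z y - integral {0..h} w" .
  have "(\<Sum>x. \<pi> z x * R h x y) = (\<integral>t. indicator {0<..} t * (exp (- (z * t)) * R (t + h) 0 y) \<partial>lborel)"
    using has_laplace_R_shift_series(1)[OF z h, of y] by (simp add: has_laplace_def has_bochner_integral_iff)
  also have "\<dots> = (\<integral>t. exp (z * h) * (indicator {h<..} (h + 1 * t) * w (h + 1 * t)) \<partial>lborel)"
  proof (rule Bochner_Integration.integral_cong[OF refl])
    fix t
    have "exp (- (z * t)) = exp (z * h) * exp (- (z * (h + t)))"
      by (simp add: exp_add[symmetric] algebra_simps)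
    then show "indicator {0<..} t * (exp (- (z * t)) * R (t + h) 0 y) = exp (z * h) * (indicator {h<..} (h + 1 * t) * w (h + 1 * t))"
      by (simp add: w_def indicator_def add.commute)
  qed
  also have "\<dots> = exp (z * h) * (\<integral>t. indicator {h<..} t * w t \<partial>lborel)"
    using lborel_integral_real_affine[of 1 "\<lambda>t. indicator {h<..} t * w t" h] by simp
  finally show ?thesis using tail by (simp only: w_def)
qed

text \<open>The right derivative of \<open>shift_series_eq\<close> at h = 0: the exponential
  contributes z \<pi> z y and the integral the initial value.\<close>

lemma resolvent_limit:
  assumes z: "0 < z"
  shows "((\<lambda>h. ((\<Sum>x. \<pi> z x * R h x y) - \<pi> z y) / h) \<longlongrightarrow> z * \<pi> z y - R 0 0 y) (at_right 0)"
proof -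
  define w where "w = (\<lambda>t. exp (- (z * t)) * R t 0 y)"
  have c: "continuous_on {0..1} w"
    unfolding w_def by (intro continuous_intros continuous_on_subset[OF R_continuous]) auto
  have at: "at 0 within {0..1} = at_right (0::real)"
    by (rule at_within_Icc_at_right) simp
  have "((\<lambda>h. integral {0..h} w) has_real_derivative w 0) (at 0 within {0..1})"
    by (rule integral_has_real_derivative[OF c]) simp
  then have d1: "((\<lambda>h. integral {0..h} w / h) \<longlongrightarrow> R 0 0 y) (at_right 0)"
    by (simp add: has_field_derivative_iff at w_def)
  have "((\<lambda>h. exp (z * h)) has_real_derivative z) (at 0 within {0..1})"
    by (auto intro!: derivative_eq_intros)
  then have d2: "((\<lambda>h. (exp (z * h) - 1) / h) \<longlongrightarrow> z) (at_right 0)"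
    by (simp add: has_field_derivative_iff at)
  have d3: "((\<lambda>h. exp (z * h)) \<longlongrightarrow> exp (z * 0)) (at_right 0)"
    by (intro tendsto_intros)
  have "((\<lambda>h. (exp (z * h) - 1) / h * \<pi> z y - exp (z * h) * (integral {0..h} w / h)) \<longlongrightarrow> z * \<pi> z y - exp (z * 0) * R 0 0 y) (at_right 0)"
    by (intro tendsto_intros d1 d2 d3)
  moreover have "\<forall>\<^sub>F h in at_right 0. (exp (z * h) - 1) / h * \<pi> z y - exp (z * h) * (integral {0..h} w / h) = ((\<Sum>x. \<pi> z x * R h x y) - \<pi> z y) / h"
    using eventually_at_right_less[of 0]
    by eventually_elim (subst shift_series_eq[OF z], simp_all add: w_def field_simps)
  ultimately show ?thesis by (auto elim: Lim_transform_eventually)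
qed

text \<open>The limit of \<open>resolvent_limit\<close> is now taken term by term. Tannery's theorem
  applies because each difference quotient is at most \<Lambda>, uniformly in the state and in h,
  and \<pi> z is summable. At y = 0 the exit rate is only lam; writing \<Lambda> on the left there
  produces the extra \<kappa> \<pi> z 0 on the right.\<close>

lemma resolvent_equation:
  assumes z: "0 < z"
  shows "(z + \<Lambda>) * \<pi> z y = (if y = 0 then 1 + \<kappa> * \<pi> z 0 else 0) + (if k \<le> y then lam * \<pi> z (y - k) else 0) + \<kappa> * \<pi> z (Suc y)"
proof -
  define q where "q = (\<lambda>x. if x = y then - (lam + (if y = 0 then 0 else \<kappa>)) else phase_rate lam \<kappa> k x y)"
  define a where "a = (\<lambda>x h. \<pi> z x * ((R h x y - (if x = y then 1 else 0)) / h))"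
  have lim: "((\<lambda>h. a x h) \<longlongrightarrow> \<pi> z x * q x) (at_right 0)" for x
  proof -
    have "((\<lambda>h. (R h x y - (if x = y then 1 else 0)) / h) \<longlongrightarrow> q x) (at_right 0)"
    proof (cases "x = y")
      case True
      have "((\<lambda>h. - ((1 - R h y y) / h)) \<longlongrightarrow> q x) (at_right 0)"
        unfolding q_def if_P[OF True] by (intro tendsto_minus R_exit)
      then show ?thesis using True by (simp add: minus_divide_left)
    qed (use R_rate[of x y] in \<open>simp add: q_def\<close>)
    then show ?thesis unfolding a_def by (rule tendsto_mult_left)
  qed
  have bound: "norm (a x h) \<le> \<pi> z x * \<Lambda>" if h: "0 < h" for x h
  proof -
    have "\<bar>R h x y - (if x = y then 1 else 0)\<bar> \<le> h * \<Lambda>"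
    proof (cases "x = y")
      case True
      then show ?thesis using R_diag_lower[OF h, of y] R_le_1[of h y y] h by simp
    next
      case False
      then show ?thesis using R_diag_lower[OF h, of x] R_off_diag[of h x y] R_nonneg[of h x y] h by simp
    qed
    then have "\<bar>(R h x y - (if x = y then 1 else 0)) / h\<bar> \<le> \<Lambda>"
      using h by (simp add: abs_divide pos_divide_le_eq mult.commute)
    then have "\<pi> z x * \<bar>(R h x y - (if x = y then 1 else 0)) / h\<bar> \<le> \<pi> z x * \<Lambda>"
      by (intro mult_left_mono \<pi>_nonneg z)
    then show ?thesis
      by (simp only: a_def real_norm_def abs_mult abs_of_nonneg[OF \<pi>_nonneg[OF z]])
  qed
  have "((\<lambda>h. suminf (\<lambda>x. a x h)) \<longlongrightarrow> suminf (\<lambda>x. \<pi> z x * q x)) (at_right 0)"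
  proof (rule tannerys_theorem[THEN conjunct2, THEN conjunct2])
    show "summable (\<lambda>x. \<pi> z x * \<Lambda>)" by (intro summable_mult2 \<pi>_summable z)
    show "\<forall>\<^sub>F (x, h) in at_top \<times>\<^sub>F at_right 0. norm (a x h) \<le> \<pi> z x * \<Lambda>"
      unfolding eventually_prod_filter
      by (rule exI[of _ "\<lambda>_. True"], rule exI[of _ "\<lambda>h. 0 < h"])
        (auto simp: bound[unfolded real_norm_def] eventually_at_right_less)
  qed (use lim in auto)
  moreover have "\<forall>\<^sub>F h in at_right 0. suminf (\<lambda>x. a x h) = ((\<Sum>x. \<pi> z x * R h x y) - \<pi> z y) / h"
    using eventually_at_right_less[of 0]
  proof eventually_elim
    case (elim h)
    have 1: "(\<lambda>x. \<pi> z x * R h x y) sums (\<Sum>x. \<pi> z x * R h x y)"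
      using has_laplace_R_shift_series(2)[OF z, of h y] elim by (simp add: summable_sums)
    have 2: "(\<lambda>x. if x = y then \<pi> z y else 0) sums \<pi> z y" using sums_single[of y "\<lambda>_. \<pi> z y"] by simp
    have "a x h = (\<pi> z x * R h x y - (if x = y then \<pi> z y else 0)) / h" for x
      by (simp add: a_def algebra_simps)
    then show ?case using sums_divide[OF sums_diff[OF 1 2], of h] by (simp add: sums_iff)
  qed
  ultimately have "((\<lambda>h. ((\<Sum>x. \<pi> z x * R h x y) - \<pi> z y) / h) \<longlongrightarrow> suminf (\<lambda>x. \<pi> z x * q x)) (at_right 0)"
    by (rule Lim_transform_eventually)
  then have "z * \<pi> z y - R 0 0 y = suminf (\<lambda>x. \<pi> z x * q x)"
    using resolvent_limit[OF z, of y] by (intro tendsto_unique[of "at_right 0"]) auto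
  also have "\<dots> = (\<Sum>x\<in>{y, Suc y} \<union> (if k \<le> y then {y - k} else {}). \<pi> z x * q x)"
    by (rule suminf_finite) (use k in \<open>auto simp: q_def phase_rate_def split: if_splits\<close>)
  also have "\<dots> = - (lam + (if y = 0 then 0 else \<kappa>)) * \<pi> z y + \<kappa> * \<pi> z (Suc y) + (if k \<le> y then lam * \<pi> z (y - k) else 0)"
    using k by (auto simp: q_def phase_rate_def)
  finally show ?thesis by (auto simp: R_0 algebra_simps)
qed

text \<open>
  Summing the resolvent equation against a bounded test function \<open>L \<mapsto> g (L + 1)\<close>; the value \<open>g 0\<close>
  belongs to the fictitious state \<open>- 1\<close>. Suitable \<open>g\<close> reduce the left side to a single term or to \<open>0\<close>,
  so no uniqueness theorem for the infinite system is needed.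
\<close>

lemma resolvent_pairing:
  assumes z: "0 < z" and g: "\<And>L. \<bar>g L\<bar> \<le> (B::real)"
  shows "(\<Sum>L. \<pi> z L * ((z + \<Lambda>) * g (Suc L) - lam * g (Suc (L + k)) - \<kappa> * g L)) = g 1 + \<kappa> * \<pi> z 0 * (g 1 - g 0)"
proof -
  have summ: "summable (\<lambda>L. \<pi> z L * g (f L))" for f
  proof (rule summable_comparison_test'[OF summable_mult2[OF \<pi>_summable[OF z], of B]])
    fix L show "norm (\<pi> z L * g (f L)) \<le> \<pi> z L * B"
      using g[of "f L"] \<pi>_nonneg[OF z, of L] by (simp add: abs_mult mult_left_mono)
  qed
  define A where "A = (\<lambda>L. \<pi> z L * g (Suc L))"
  define C where "C = (\<lambda>L. if k \<le> L then \<pi> z (L - k) * g (Suc L) else 0)"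
  define E where "E = (\<lambda>L. \<pi> z L * g L)"
  have A: "summable A" unfolding A_def by (rule summ)
  have E: "summable E" unfolding E_def by (rule summ[of "\<lambda>L. L"])
  have C_shift: "C (L + k) = \<pi> z L * g (Suc (L + k))" for L by (simp add: C_def)
  have C: "C sums (\<Sum>L. \<pi> z L * g (Suc (L + k)))"
  proof -
    have "(\<lambda>L. C (L + k)) sums (\<Sum>L. \<pi> z L * g (Suc (L + k)))"
      unfolding C_shift by (intro summable_sums summ)
    then show ?thesis by (subst (asm) sums_iff_shift) (simp add: C_def)
  qed
  have E': "(\<lambda>L. E (Suc L)) sums (suminf E - E 0)"
    using E by (simp add: sums_Suc_iff summable_sums)
  have single: "(\<lambda>L. if L = 0 then (1 + \<kappa> * \<pi> z 0) * g 1 else 0) sums ((1 + \<kappa> * \<pi> z 0) * g 1)"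
    using sums_single[of 0 "\<lambda>_. (1 + \<kappa> * \<pi> z 0) * g 1"] by simp
  have "(z + \<Lambda>) * A L = (if L = 0 then (1 + \<kappa> * \<pi> z 0) * g 1 else 0) + lam * C L + \<kappa> * E (Suc L)" for L
  proof -
    have "(z + \<Lambda>) * A L = ((z + \<Lambda>) * \<pi> z L) * g (Suc L)" by (simp add: A_def)
    also have "\<dots> = (if L = 0 then (1 + \<kappa> * \<pi> z 0) * g 1 else 0) + lam * C L + \<kappa> * E (Suc L)"
      unfolding resolvent_equation[OF z] by (auto simp: C_def E_def algebra_simps)
    finally show ?thesis .
  qed
  then have "(\<lambda>L. (z + \<Lambda>) * A L) sums ((1 + \<kappa> * \<pi> z 0) * g 1 + lam * (\<Sum>L. \<pi> z L * g (Suc (L + k))) + \<kappa> * (suminf E - E 0))"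
    using sums_add[OF sums_add[OF single sums_mult[OF C, of lam]] sums_mult[OF E', of \<kappa>]] by simp
  then have eq: "(z + \<Lambda>) * suminf A = (1 + \<kappa> * \<pi> z 0) * g 1 + lam * (\<Sum>L. \<pi> z L * g (Suc (L + k))) + \<kappa> * (suminf E - E 0)"
    using A by (simp add: sums_iff suminf_mult)
  have "(\<lambda>L. (z + \<Lambda>) * A L - lam * (\<pi> z L * g (Suc (L + k))) - \<kappa> * E L) sums
      ((z + \<Lambda>) * suminf A - lam * (\<Sum>L. \<pi> z L * g (Suc (L + k))) - \<kappa> * suminf E)"
    by (intro sums_diff sums_mult summable_sums A E summ)
  moreover have "(z + \<Lambda>) * A L - lam * (\<pi> z L * g (Suc (L + k))) - \<kappa> * E L
      = \<pi> z L * ((z + \<Lambda>) * g (Suc L) - lam * g (Suc (L + k)) - \<kappa> * g L)" for L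
    by (simp add: A_def E_def algebra_simps)
  ultimately show ?thesis using eq by (simp add: sums_iff E_def algebra_simps)
qed

end

section \<open>Lattice path series for the resolvent\<close>

text \<open>
  By the ballot theorem, the number of walks with \<open>r\<close> steps \<open>+ k\<close> and \<open>m + r k\<close> steps \<open>- 1\<close> that reach
  level \<open>- m\<close> for the first time at the last step.
\<close>

definition rothe :: "nat \<Rightarrow> nat \<Rightarrow> nat \<Rightarrow> real" where
  "rothe k m r = (if m = 0 then (if r = 0 then 1 else 0)
     else real m * fact (m + r * (k + 1) - 1) / (fact r * fact (m + r * k)))"

lemma rothe_nonneg: "0 \<le> rothe k m r"
  by (simp add: rothe_def)

lemma rothe_zero_right [simp]: "rothe k m 0 = 1"
proof (cases m)
  case (Suc j)
  then have "fact m = real m * fact (m - 1)" by simp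
  then show ?thesis using Suc by (simp add: rothe_def)
qed (simp add: rothe_def)

text \<open>Decomposition by the first step: - 1 leaves a descent by m, and + k leaves a descent by
  Suc m + k with one upward step fewer.\<close>

lemma rothe_Suc:
  "rothe k (Suc m) (Suc r) = rothe k m (Suc r) + rothe k (Suc m + k) r"
proof -
  define E where "E = m + k + r * (k + 1)"
  have n1: "Suc m + Suc r * (k + 1) - 1 = Suc E" "m + Suc r * (k + 1) - 1 = E"
    "Suc m + k + r * (k + 1) - 1 = E" by (simp_all add: E_def)
  define d where "d = m + Suc r * k"
  have d: "Suc m + Suc r * k = Suc d" "Suc m + k + r * k = Suc d" by (simp_all add: d_def)
  \<comment> \<open>Over a common denominator the recurrence reduces to this identity.\<close>
  have key: "real (Suc m) * real (Suc E) = real m * real (Suc d) + real (Suc m + k) * real (Suc r)"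
    by (simp add: E_def d_def algebra_simps)
  have 1: "rothe k (Suc m) (Suc r) = real (Suc m) * (real (Suc E) * fact E) / (real (Suc r) * fact r * (real (Suc d) * fact d))"
    unfolding rothe_def n1 d by simp
  have 2: "rothe k m (Suc r) = real m * real (Suc d) * fact E / (real (Suc r) * fact r * (real (Suc d) * fact d))"
    unfolding rothe_def n1 d_def[symmetric] by simp
  have 3: "rothe k (Suc m + k) r = real (Suc m + k) * real (Suc r) * fact E / (real (Suc r) * fact r * (real (Suc d) * fact d))"
    unfolding rothe_def n1 d by (simp del: of_nat_Suc)
  show ?thesis
    unfolding 1 2 3 add_divide_distrib[symmetric] distrib_right[symmetric] key[symmetric]
    by (simp only: mult.assoc)
qed

text \<open>For m \<ge> 1 and N = m + r (k + 1) steps the count is m / N times N choose r, and m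
  \<le> N.\<close>

lemma rothe_le: "rothe k m r \<le> 2 ^ (m + r * (k + 1))"
proof (cases m)
  case 0
  then show ?thesis by (simp add: rothe_def)
next
  case (Suc j)
  define N where "N = m + r * (k + 1)"
  have N: "N = Suc (N - 1)" "r \<le> N" "N - r = m + r * k" using Suc by (simp_all add: N_def)
  have "real m * fact (N - 1) \<le> real N * fact (N - 1)"
    by (intro mult_right_mono) (auto simp: N_def)
  also have "\<dots> = fact N" using N(1) by (metis fact_Suc of_nat_mult of_nat_fact)
  finally have "real m * fact (N - 1) / (fact r * fact (N - r)) \<le> fact N / (fact r * fact (N - r))"
    by (intro divide_right_mono) auto
  moreover have "rothe k m r = real m * fact (N - 1) / (fact r * fact (N - r))"
    unfolding rothe_def N(3) using Suc by (simp add: N_def)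
  ultimately have "rothe k m r \<le> fact N / (fact r * fact (N - r))" by simp
  also have "\<dots> = real (N choose r)" by (simp add: binomial_fact N(2))
  also have "\<dots> \<le> 2 ^ N"
    using binomial_le_pow2[of N r] by (metis of_nat_le_iff of_nat_numeral of_nat_power)
  finally show ?thesis by (simp add: N_def)
qed

section \<open>Weighted path series and their recurrences\<close>

context phase_params
begin

text \<open>Chosen so that 2 \<Lambda> \<theta> = 1 / 2: the 2 pays for the number of paths, and the
  ratio 1 / 2 is left for summation.\<close>

definition \<theta> :: real where "\<theta> = 1 / (4 * \<Lambda>)"

lemma \<theta>_pos: "0 < \<theta>" using lam \<kappa> by (simp add: \<theta>_def)

lemma weight_le:
  assumes x: "0 \<le> x" "x \<le> \<theta>" and c: "c \<le> 2 ^ (a + d)" "0 \<le> c"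
  shows "c * lam ^ a * \<kappa> ^ d * x ^ (a + d) \<le> (1 / 2) ^ (a + d)"
proof -
  have "c * lam ^ a * \<kappa> ^ d * x ^ (a + d) \<le> 2 ^ (a + d) * \<Lambda> ^ a * \<Lambda> ^ d * \<theta> ^ (a + d)"
    using lam \<kappa> x c by (intro mult_mono power_mono) auto
  also have "\<dots> = (2 * \<Lambda> * \<theta>) ^ (a + d)" by (simp only: power_add power_mult_distrib mult_ac)
  also have "2 * \<Lambda> * \<theta> = 1 / 2" using lam \<kappa> by (simp add: \<theta>_def)
  finally show ?thesis .
qed

text \<open>The weight of all paths with a arrivals and d completions. Such a path visits a + d + 1
  positions, and each contributes a factor x. The integer d lets the recurrences pass through
  infeasible displacements with value 0.\<close>

definition walk :: "real \<Rightarrow> nat \<Rightarrow> int \<Rightarrow> real" where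
  "walk x a d = (if d < 0 then 0 else
     real (a + nat d choose a) * lam ^ a * \<kappa> ^ nat d * x ^ (a + nat d + 1))"

text \<open>Pascal's rule, read as removing one arrival or one completion; the leading 1 is the
  empty path.\<close>

lemma walk_rec:
  "walk x a d = x * ((if a = 0 \<and> d = 0 then 1 else 0) + lam * (if a = 0 then 0 else walk x (a - 1) d)
      + \<kappa> * walk x a (d - 1))"
proof (cases "d < 0")
  case False
  then obtain e where d: "d = int e" by (metis nonneg_int_cases not_less)
  show ?thesis
  proof (cases e)
    case 0
    then show ?thesis by (cases a) (simp_all add: walk_def d)
  next
    case (Suc f)
    then have d1: "d - 1 = int f" by (simp add: d)
    show ?thesis
      unfolding d1 unfolding d Suc by (cases a) (simp_all add: walk_def algebra_simps nat_add_distrib)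
  qed
qed (simp add: walk_def)

lemma walk_nonneg: "0 \<le> x \<Longrightarrow> 0 \<le> walk x a d"
  using lam \<kappa> by (simp add: walk_def)

text \<open>The decay in d is given away, so that the resulting bound on G is uniform in the
  displacement.\<close>

lemma walk_le:
  assumes "0 \<le> x" "x \<le> \<theta>"
  shows "walk x a d \<le> x * (1 / 2) ^ a"
proof (cases "d < 0")
  case False
  define e where "e = nat d"
  have "real (a + e choose a) \<le> 2 ^ (a + e)"
    using binomial_le_pow2[of "a + e" a] by (metis of_nat_le_iff of_nat_numeral of_nat_power)
  then have "x * (real (a + e choose a) * lam ^ a * \<kappa> ^ e * x ^ (a + e)) \<le> x * (1 / 2) ^ (a + e)"
    using assms by (intro mult_left_mono weight_le) auto
  also have "\<dots> \<le> x * (1 / 2) ^ a"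
    using assms by (intro mult_left_mono power_decreasing) auto
  finally show ?thesis using False by (simp add: walk_def e_def mult_ac)
qed (use assms in \<open>simp add: walk_def\<close>)

text \<open>
  With \<open>x = 1 / (z + \<Lambda>)\<close>, the resolvent density at displacement \<open>j\<close> of the walk that is not stopped at \<open>0\<close>:
  \<open>a\<close> counts the arrivals and \<open>k a - j\<close> the phase completions.
\<close>

definition G :: "real \<Rightarrow> int \<Rightarrow> real" where
  "G x j = (\<Sum>a. walk x a (int (k * a) - j))"

lemma half_sums: "(\<lambda>a. (1 / 2 :: real) ^ a) sums 2"
  using geometric_sums[of "1 / 2 :: real"] by simp

lemma G_sums:
  assumes "0 \<le> x" "x \<le> \<theta>"
  shows "(\<lambda>a. walk x a (int (k * a) - j)) sums G x j"
  unfolding G_def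
  by (intro summable_sums summable_comparison_test'[OF summable_mult[OF sums_summable[OF half_sums], of x]])
    (use walk_le[OF assms] walk_nonneg[OF assms(1)] in auto)

lemma G_bound:
  assumes "0 \<le> x" "x \<le> \<theta>"
  shows "\<bar>G x j\<bar> \<le> x * 2"
proof -
  have "G x j \<le> x * 2"
    by (rule sums_le[OF _ G_sums[OF assms] sums_mult[OF half_sums]]) (rule walk_le[OF assms])
  moreover have "0 \<le> G x j"
    by (rule sums_le[OF _ sums_zero G_sums[OF assms]]) (rule walk_nonneg[OF assms(1)])
  ultimately show ?thesis by simp
qed

text \<open>Summation of \<open>walk_rec\<close> over a. Removing an arrival turns k a - j into k (a
  - 1) - (j - k), and removing a completion replaces j by j + 1.\<close>

lemma G_rec:
  assumes x: "0 \<le> x" "x \<le> \<theta>"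
  shows "G x j = x * ((if j = 0 then 1 else 0) + lam * G x (j - int k) + \<kappa> * G x (j + 1))"
proof -
  have "(\<lambda>a. if a = 0 then 0 else walk x (a - 1) (int (k * a) - j)) sums G x (j - int k)"
  proof -
    have "(\<lambda>a. if Suc a = 0 then 0 else walk x (Suc a - 1) (int (k * Suc a) - j)) sums G x (j - int k)"
      using G_sums[OF x, of "j - int k"] by (simp add: algebra_simps)
    then show ?thesis by (subst (asm) sums_Suc_iff) simp
  qed
  moreover have "(\<lambda>a. walk x a (int (k * a) - j - 1)) sums G x (j + 1)"
    using G_sums[OF x, of "j + 1"] by (simp add: algebra_simps)
  moreover have "(\<lambda>a. if a = 0 \<and> int (k * a) - j = 0 then 1 else 0) sums (if j = 0 then 1 else 0 :: real)"
    using sums_single[of 0 "\<lambda>_. if j = 0 then 1 else 0 :: real"] by (rule sums_cong[THEN iffD1, rotated]) auto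
  ultimately have "(\<lambda>a. walk x a (int (k * a) - j)) sums (x * ((if j = 0 then 1 else 0) + lam * G x (j - int k) + \<kappa> * G x (j + 1)))"
    by (subst walk_rec) (intro sums_mult sums_add)
  then show ?thesis using G_sums[OF x, of j] by (simp add: sums_iff)
qed

text \<open>The power of x is the number of steps, without the additional factor in
  \<open>walk\<close>: the sojourn at the level reached is not counted.\<close>

definition hit :: "real \<Rightarrow> nat \<Rightarrow> nat \<Rightarrow> real" where
  "hit x m r = rothe k m r * lam ^ r * \<kappa> ^ (m + r * k) * x ^ (m + r * (k + 1))"

lemma hit_nonneg: "0 \<le> x \<Longrightarrow> 0 \<le> hit x m r"
  using lam \<kappa> by (simp add: hit_def rothe_nonneg)

lemma hit_le:
  assumes "0 \<le> x" "x \<le> \<theta>"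
  shows "hit x m r \<le> (1 / 2) ^ m * (1 / 2) ^ r"
proof -
  have e: "m + r * (k + 1) = r + (m + r * k)" by (simp add: algebra_simps)
  have "hit x m r \<le> (1 / 2) ^ (r + (m + r * k))"
    unfolding hit_def e using rothe_le[of k m r] by (intro weight_le assms rothe_nonneg) (simp only: e)
  also have "\<dots> \<le> (1 / 2) ^ (m + r)" by (intro power_decreasing) auto
  finally show ?thesis by (simp add: power_add)
qed

lemma hit_rec:
  "hit x (Suc m) r = x * (\<kappa> * hit x m r + lam * (if r = 0 then 0 else hit x (Suc m + k) (r - 1)))"
proof (cases r)
  case (Suc q)
  have "Suc m + k + q * k = m + r * k + 1" "Suc m + k + q * (k + 1) = m + r * (k + 1)"
    by (simp_all add: Suc)
  then show ?thesis
    using rothe_Suc[of k m q] by (simp add: hit_def Suc algebra_simps power_add)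
qed (simp add: hit_def)

text \<open>The Laplace transform of the time in which the unrestricted walk first descends by \<open>m\<close>.\<close>

definition H :: "real \<Rightarrow> nat \<Rightarrow> real" where "H x m = (\<Sum>r. hit x m r)"

lemma H_sums:
  assumes "0 \<le> x" "x \<le> \<theta>"
  shows "hit x m sums H x m"
  unfolding H_def
  by (intro summable_sums summable_comparison_test'[OF summable_mult[OF sums_summable[OF half_sums], of "(1/2) ^ m"]])
    (use hit_le[OF assms] hit_nonneg[OF assms(1)] in auto)

lemma H_bounds:
  assumes "0 \<le> x" "x \<le> \<theta>"
  shows "0 \<le> H x m" "H x m \<le> (1 / 2) ^ m * 2"
proof -
  show "H x m \<le> (1 / 2) ^ m * 2"
    by (rule sums_le[OF _ H_sums[OF assms] sums_mult[OF half_sums]]) (rule hit_le[OF assms])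
  show "0 \<le> H x m"
    by (rule sums_le[OF _ sums_zero H_sums[OF assms]]) (rule hit_nonneg[OF assms(1)])
qed

lemma H_0: "H x 0 = 1"
proof -
  have "hit x 0 r = (if r = 0 then 1 else 0)" for r
    by (simp add: hit_def rothe_def)
  then show ?thesis using sums_single[of 0 "\<lambda>_. 1 :: real"] by (simp add: H_def sums_iff)
qed

lemma H_rec:
  assumes x: "0 \<le> x" "x \<le> \<theta>"
  shows "H x (Suc m) = x * (\<kappa> * H x m + lam * H x (Suc m + k))"
proof -
  have "(\<lambda>r. if r = 0 then 0 else hit x (Suc m + k) (r - 1)) sums H x (Suc m + k)"
  proof -
    have "(\<lambda>r. if Suc r = 0 then 0 else hit x (Suc m + k) (Suc r - 1)) sums H x (Suc m + k)"
      using H_sums[OF x, of "Suc m + k"] by simp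
    then show ?thesis by (subst (asm) sums_Suc_iff) simp
  qed
  then have "hit x (Suc m) sums (x * (\<kappa> * H x m + lam * H x (Suc m + k)))"
    by (subst hit_rec[abs_def]) (intro sums_mult sums_add H_sums x)
  then show ?thesis using H_sums[OF x, of "Suc m"] by (simp add: sums_iff)
qed

text \<open>A test function for \<open>resolvent_pairing\<close>. It inherits the recurrence of H,
  and its drop from 0 to 1 is H x 0 = 1, which isolates \<pi> z 0.\<close>

definition T :: "real \<Rightarrow> nat \<Rightarrow> real" where "T x L = (\<Sum>m. H x (m + L))"

lemma T_sums:
  assumes "0 \<le> x" "x \<le> \<theta>"
  shows "(\<lambda>m. H x (m + L)) sums T x L"
proof -
  have "summable (H x)"
    by (rule summable_comparison_test'[OF summable_mult2[OF sums_summable[OF half_sums], of 2]])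
      (use H_bounds[OF assms] in auto)
  then show ?thesis unfolding T_def by (intro summable_sums) (simp add: summable_iff_shift)
qed

lemma T_bound:
  assumes "0 \<le> x" "x \<le> \<theta>"
  shows "\<bar>T x L\<bar> \<le> 4"
proof -
  have "H x (m + L) \<le> (1 / 2) ^ m * 2" for m
  proof -
    have "H x (m + L) \<le> (1 / 2) ^ (m + L) * 2" by (rule H_bounds[OF assms])
    also have "\<dots> \<le> (1 / 2) ^ m * 2" by (intro mult_right_mono power_decreasing) auto
    finally show ?thesis .
  qed
  then have "T x L \<le> 2 * 2"
    by (intro sums_le[OF _ T_sums[OF assms] sums_mult2[OF half_sums]]) 
  moreover have "0 \<le> T x L"
    by (rule sums_le[OF _ sums_zero T_sums[OF assms]]) (rule H_bounds[OF assms])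
  ultimately show ?thesis by simp
qed

lemma T_rec:
  assumes x: "0 \<le> x" "x \<le> \<theta>"
  shows "T x (Suc L) = x * (\<kappa> * T x L + lam * T x (Suc L + k))"
proof -
  have "(\<lambda>m. x * (\<kappa> * H x (m + L) + lam * H x (m + (Suc L + k)))) sums (x * (\<kappa> * T x L + lam * T x (Suc L + k)))"
    by (intro sums_mult sums_add T_sums x)
  moreover have "x * (\<kappa> * H x (m + L) + lam * H x (m + (Suc L + k))) = H x (m + Suc L)" for m
    using H_rec[OF x, of "m + L"] by (simp add: add.assoc)
  ultimately show ?thesis using T_sums[OF x, of "Suc L"] by (simp add: sums_iff)
qed

lemma T_0:
  assumes x: "0 \<le> x" "x \<le> \<theta>"
  shows "T x 0 = 1 + T x 1"
  using T_sums[OF x, of 0] T_sums[OF x, of 1] sums_Suc_iff[of "H x" "T x 1"]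
  by (simp add: H_0 sums_iff)

end

section \<open>Path series in terms of the coefficients A, B, C and D\<close>

lemma has_sum_product:
  fixes f :: "'a \<Rightarrow> real" and g :: "'b \<Rightarrow> real"
  assumes f: "(f has_sum a) A" and g: "(g has_sum b) B"
    and nonneg: "\<And>x. x \<in> A \<Longrightarrow> 0 \<le> f x" "\<And>y. y \<in> B \<Longrightarrow> 0 \<le> g y"
  shows "((\<lambda>(x, y). f x * g y) has_sum a * b) (A \<times> B)"
proof (rule has_sum_SigmaI)
  show inner: "((\<lambda>y. case (x, y) of (x, y) \<Rightarrow> f x * g y) has_sum f x * b) B" for x
    using has_sum_cmult_right[OF g] by simp
  show outer: "((\<lambda>x. f x * b) has_sum a * b) A" by (rule has_sum_cmult_left[OF f])
  show "(\<lambda>(x, y). f x * g y) summable_on A \<times> B"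
    by (rule summable_on_SigmaI[OF inner has_sum_imp_summable[OF outer]]) (use nonneg in auto)
qed

context phase_params
begin

text \<open>The row m = 0 is removed because \<open>A0_coeff\<close> vanishes there while
  \<open>hit x 0 0\<close> is 1; the sum is therefore T x 1 and not T x 0.\<close>

lemma has_sum_hit:
  assumes x: "0 \<le> x" "x \<le> \<theta>"
  shows "((\<lambda>(m, r). if m = 0 then 0 else hit x m r) has_sum T x 1) UNIV"
proof -
  define h where "h = (\<lambda>m r. if m = 0 then 0 else hit x m r)"
  define H' where "H' = (\<lambda>m. if m = 0 then 0 else H x m)"
  have inner: "(h m has_sum H' m) UNIV" for m
    by (rule sums_nonneg_imp_has_sum)
      (auto simp: h_def H'_def hit_nonneg[OF x(1)] H_sums[OF x])
  have "(\<lambda>m. H' (Suc m)) sums T x 1"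
    using T_sums[OF x, of 1] by (simp add: H'_def)
  then have "H' sums T x 1" by (subst (asm) sums_Suc_iff) (simp add: H'_def)
  then have outer: "(H' has_sum T x 1) UNIV"
    by (rule sums_nonneg_imp_has_sum) (simp add: H'_def H_bounds[OF x])
  have "((\<lambda>(m, r). h m r) has_sum T x 1) (UNIV \<times> UNIV)"
  proof (rule has_sum_SigmaI[OF _ outer])
    show "(\<lambda>(m, r). h m r) summable_on UNIV \<times> UNIV"
      by (rule summable_on_SigmaI[OF _ has_sum_imp_summable[OF outer]])
        (use inner hit_nonneg[OF x(1)] in \<open>auto simp: h_def\<close>)
  qed (use inner in simp)
  then show ?thesis by (simp add: h_def)
qed

end

locale erlang_params = phase_params +
  fixes mu :: real
  assumes \<kappa>_eq: "\<kappa> = real k * mu"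
begin

text \<open>The factor \<kappa> restores the exponent m + r k, which is lowered by one in
  \<open>A0_coeff\<close>.\<close>

lemma has_sum_A0:
  assumes x: "0 \<le> x" "x \<le> \<theta>"
  shows "((\<lambda>(m, r). \<kappa> * A0_coeff lam mu k m r * x ^ a0_exp k m r) has_sum T x 1) UNIV"
proof -
  have "\<kappa> * A0_coeff lam mu k m r * x ^ a0_exp k m r = (if m = 0 then 0 else hit x m r)" for m r
  proof (cases m)
    case (Suc j)
    have "\<kappa> * \<kappa> ^ (m + r * k - 1) = \<kappa> ^ (m + r * k)" using Suc by simp
    then have "hit x m r = \<kappa> * (real m * lam ^ r * \<kappa> ^ (m + r * k - 1) / (fact r * fact (m + r * k)) * fact (m + r * (k + 1) - 1)) * x ^ (m + r * (k + 1))"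
      using Suc by (simp add: hit_def rothe_def del: power_Suc)
    then show ?thesis using Suc by (simp add: A0_coeff_def a0_exp_def \<kappa>_eq)
  qed (simp add: A0_coeff_def)
  then show ?thesis using has_sum_hit[OF x] by simp
qed

lemma A0_nonneg: "0 \<le> \<kappa> * A0_coeff lam mu k m r"
  using lam \<kappa> by (simp add: A0_coeff_def flip: \<kappa>_eq)

lemma B_nonneg: "0 \<le> B_coeff lam mu k n s i"
  using lam \<kappa> by (simp add: B_coeff_def flip: \<kappa>_eq)

text \<open>The state (n, s) sits at level k (n - 1) + s, which takes at least n arrivals to reach.
  The summation index is i = a - n, and k (i + 1) - s completions remain.\<close>

lemma has_sum_B:
  assumes x: "0 \<le> x" "x \<le> \<theta>" and n: "1 \<le> n" and s: "1 \<le> s" "s \<le> k"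
  shows "((\<lambda>i. B_coeff lam mu k n s i * x ^ delta_exp k n s i) has_sum G x (int (k * (n - 1) + s))) UNIV"
proof (rule sums_nonneg_imp_has_sum)
  obtain n' where n': "n = Suc n'" using n by (cases n) auto
  obtain e where e: "k = s + e" using s(2) le_Suc_ex by blast
  define f where "f = (\<lambda>a. walk x a (int (k * a) - int (k * (n - 1) + s)))"
  have "f a = 0" if "a < n" for a
  proof -
    have "k * a \<le> k * (n - 1)" using that n by (intro mult_le_mono2) auto
    then have "int (k * a) - int (k * (n - 1) + s) < 0" using s by linarith
    then show ?thesis by (simp add: f_def walk_def)
  qed
  then have "(\<lambda>i. f (i + n)) sums G x (int (k * (n - 1) + s))"
    using G_sums[OF x, of "int (k * (n - 1) + s)"] by (subst sums_iff_shift) (simp add: f_def)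
  moreover have "f (i + n) = B_coeff lam mu k n s i * x ^ delta_exp k n s i" for i
  proof -
    define d where "d = k * i + e"
    have d: "int (k * (i + n)) - int (k * (n - 1) + s) = int d" "k * (i + 1) - s = d"
      by (simp_all add: d_def n' e algebra_simps)
    have ad: "n + k + i * (k + 1) - s = n + i + d" "delta_exp k n s i = n + i + d + 1"
      by (simp_all add: delta_exp_def d_def e algebra_simps)
    have "real (n + i + d choose (n + i)) = fact (n + i + d) / (fact (n + i) * fact d)"
      by (simp add: binomial_fact)
    then show ?thesis
      unfolding f_def d B_coeff_def ad \<kappa>_eq[symmetric] by (simp add: walk_def add.commute[of i n] mult_ac)
  qed
  ultimately show "(\<lambda>i. B_coeff lam mu k n s i * x ^ delta_exp k n s i) sums G x (int (k * (n - 1) + s))"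
    by simp
qed (use B_nonneg x in auto)

lemma has_sum_C:
  assumes x: "0 \<le> x" "x \<le> \<theta>" and n: "1 \<le> n" and s: "1 \<le> s" "s \<le> k"
  shows "((\<lambda>(i, m, r). C_coeff lam mu k n s i m r * x ^ nu_exp k n s i m r) has_sum
     G x (int (k * (n - 1) + s)) * T x 1) UNIV"
proof -
  have "((\<lambda>(i, p). (B_coeff lam mu k n s i * x ^ delta_exp k n s i) *
      (case p of (m, r) \<Rightarrow> \<kappa> * A0_coeff lam mu k m r * x ^ a0_exp k m r)) has_sum
     G x (int (k * (n - 1) + s)) * T x 1) (UNIV \<times> UNIV)"
    by (rule has_sum_product[OF has_sum_B[OF x n s] has_sum_A0[OF x]])
      (use x B_nonneg A0_nonneg in auto)
  moreover have "(\<lambda>(i, p). (B_coeff lam mu k n s i * x ^ delta_exp k n s i) *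
      (case p of (m, r) \<Rightarrow> \<kappa> * A0_coeff lam mu k m r * x ^ a0_exp k m r))
    = (\<lambda>(i, m, r). C_coeff lam mu k n s i m r * x ^ nu_exp k n s i m r)"
    by (auto simp: fun_eq_iff C_coeff_def nu_exp_def power_add \<kappa>_eq)
  ultimately show ?thesis by simp
qed

lemma C_nonneg: "0 \<le> C_coeff lam mu k n s i m r"
  using mult_nonneg_nonneg[OF B_nonneg A0_nonneg, of n s i m r]
  by (simp add: C_coeff_def \<kappa>_eq mult_ac)

text \<open>The D series is the C series of the state one phase higher, which is (n, s + 1), or (n +
  1, 1) if s = k. Facts about D thus reduce to C. The truncated n - 1 makes n = 0 a case of its
  own.\<close>

lemma D_coeff_eq_C:
  assumes "s \<le> k"
  obtains n' s' where "1 \<le> n'" "1 \<le> s'" "s' \<le> k" "D_coeff lam mu k n s = C_coeff lam mu k n' s'"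
    "pi_exp k n s = nu_exp k n' s'" "k * (n' - 1) + s' = Suc (k * (n - 1) + s)"
  | "n = 0"
proof (cases "n = 0")
  case False
  show ?thesis
  proof (cases "s < k")
    case True
    show ?thesis
      by (rule that(1)[of n "s + 1"])
        (use True False in \<open>auto simp: fun_eq_iff D_coeff_def C_coeff_def pi_exp_def nu_exp_def\<close>)
  next
    case sk: False
    then have "s = k" using assms by simp
    moreover obtain n0 where "n = Suc n0" using False by (cases n) auto
    ultimately show ?thesis
      by (intro that(1)[of "n + 1" 1])
        (use k in \<open>auto simp: fun_eq_iff D_coeff_def C_coeff_def pi_exp_def nu_exp_def\<close>)
  qed
qed (rule that(2))

lemma has_sum_D:
  assumes x: "0 \<le> x" "x \<le> \<theta>" and n: "1 \<le> n" and s: "1 \<le> s" "s \<le> k"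
  shows "((\<lambda>(i, m, r). D_coeff lam mu k n s i m r * x ^ pi_exp k n s i m r) has_sum
     G x (int (k * (n - 1) + s) + 1) * T x 1) UNIV"
proof (cases rule: D_coeff_eq_C[OF s(2), of n])
  case (1 n' s')
  have "int (k * (n - 1) + s) + 1 = int (k * (n' - 1) + s')" unfolding 1(6) by simp
  then show ?thesis using has_sum_C[OF x 1(1-3)] unfolding 1(4,5) by simp
qed (use n in simp)

lemma D_nonneg: 
  assumes "1 \<le> n" "s \<le> k"
  shows "0 \<le> D_coeff lam mu k n s i m r"
  by (cases rule: D_coeff_eq_C[OF assms(2), of n]) (use assms C_nonneg in auto)

lemma delta_exp_pos: "s \<le> k \<Longrightarrow> 1 \<le> delta_exp k n s i"
  by (simp add: delta_exp_def algebra_simps)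

lemma nu_exp_pos: "s \<le> k \<Longrightarrow> 1 \<le> nu_exp k n s i m r"
  using delta_exp_pos[of s n i] by (simp add: nu_exp_def)

lemma pi_exp_pos:
  assumes "1 \<le> n" "s \<le> k"
  shows "1 \<le> pi_exp k n s i m r"
  by (cases rule: D_coeff_eq_C[OF assms(2), of n]) (use assms nu_exp_pos in auto)

end

section \<open>Solving the resolvent equation\<close>

context phase_chain
begin

text \<open>Pairing with g = T x: the recurrence of T annihilates the left side, and T x 0 - T x 1 =
  1 leaves \<kappa> \<pi> z 0 alone.\<close>

lemma resolvent_zero:
  assumes z: "0 < z" "1 / \<theta> \<le> z + \<Lambda>"
  shows "\<kappa> * \<pi> z 0 = T (1 / (z + \<Lambda>)) 1"
proof -
  define x where "x = 1 / (z + \<Lambda>)"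
  have pos: "0 < z + \<Lambda>" using z lam \<kappa> by simp
  have x: "0 \<le> x" "x \<le> \<theta>" using pos z(2) \<theta>_pos by (simp_all add: x_def field_simps)
  have "(z + \<Lambda>) * T x (Suc L) - lam * T x (Suc (L + k)) - \<kappa> * T x L = 0" for L
    using T_rec[OF x, of L] pos by (simp add: x_def field_simps)
  then have "0 = T x 1 + \<kappa> * \<pi> z 0 * (T x 1 - T x 0)"
    using resolvent_pairing[of z "T x" 4, OF z(1) T_bound[OF x]] by simp
  then show ?thesis using T_0[OF x] by (simp add: x_def)
qed

text \<open>The reflected test function g M = G x (L + 1 - M) turns the left side of the pairing
  into the single term M = L; its boundary values g 1 and g 0 are G at L and at L + 1.\<close>

lemma resolvent_eq:
  assumes z: "0 < z" "1 / \<theta> \<le> z + \<Lambda>"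
  defines "x \<equiv> 1 / (z + \<Lambda>)"
  shows "\<pi> z L = G x (int L) + G x (int L) * T x 1 - G x (int L + 1) * T x 1"
proof -
  have pos: "0 < z + \<Lambda>" using z lam \<kappa> by simp
  have x: "0 \<le> x" "x \<le> \<theta>" using pos z(2) \<theta>_pos by (simp_all add: x_def field_simps)
  define g where "g = (\<lambda>M. G x (int L + 1 - int M))"
  have "(z + \<Lambda>) * g (Suc M) - lam * g (Suc (M + k)) - \<kappa> * g M = (if M = L then 1 else 0)" for M
  proof -
    have "g (Suc M) = x * ((if M = L then 1 else 0) + lam * g (Suc (M + k)) + \<kappa> * g M)"
      using G_rec[OF x, of "int L - int M"] by (simp add: g_def algebra_simps)
    then show ?thesis using pos by (simp add: x_def field_simps)
  qed
  then have "\<pi> z M * ((z + \<Lambda>) * g (Suc M) - lam * g (Suc (M + k)) - \<kappa> * g M) = (if M = L then \<pi> z M else 0)" for M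
    by simp
  then have "(\<Sum>M. if M = L then \<pi> z M else 0) = g 1 + \<kappa> * \<pi> z 0 * (g 1 - g 0)"
    using resolvent_pairing[of z g "x * 2", OF z(1)] G_bound[OF x] by (simp add: g_def)
  moreover have "(\<Sum>M. if M = L then \<pi> z M else 0) = \<pi> z L"
    using sums_single[of L "\<pi> z"] by (simp add: sums_iff)
  ultimately show ?thesis
    using resolvent_zero[OF z] by (simp add: g_def x_def algebra_simps)
qed

end

locale erlang_chain = phase_chain + erlang_params +
  fixes n s :: nat
  assumes n: "1 \<le> n" and s: "1 \<le> s" "s \<le> k"
begin

abbreviation "KC \<equiv> (\<lambda>(i, m, r). C_coeff lam mu k n s i m r)"
abbreviation "NC \<equiv> (\<lambda>(i, m, r). nu_exp k n s i m r)"
abbreviation "KD \<equiv> (\<lambda>(i, m, r). D_coeff lam mu k n s i m r)"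
abbreviation "ND \<equiv> (\<lambda>(i, m, r). pi_exp k n s i m r)"

text \<open>Summability at \<theta> is the path series at x = \<theta>, the end of its admissible
  range.\<close>

sublocale B: phase_series \<Lambda> \<theta> "B_coeff lam mu k n s" "delta_exp k n s"
  by unfold_locales
    (use lam \<kappa> \<theta>_pos has_sum_B[OF _ order_refl n s] B_nonneg delta_exp_pos[OF s(2)]
      in \<open>auto simp: less_imp_le intro: has_sum_imp_summable\<close>)

text \<open>The index runs over all triples, so that it is a whole type; the coefficients vanish at
  m = 0.\<close>

sublocale C: phase_series \<Lambda> \<theta> KC NC
  by unfold_locales
    (use lam \<kappa> \<theta>_pos has_sum_imp_summable[OF has_sum_C[OF _ order_refl n s]] C_nonneg nu_exp_pos[OF s(2)]
      in \<open>auto simp: less_imp_le finite_prod case_prod_unfold\<close>)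

sublocale D: phase_series \<Lambda> \<theta> KD ND
  by unfold_locales
    (use lam \<kappa> \<theta>_pos has_sum_imp_summable[OF has_sum_D[OF _ order_refl n s]] D_nonneg[OF n s(2)] pi_exp_pos[OF n s(2)]
      in \<open>auto simp: less_imp_le finite_prod case_prod_unfold\<close>)

lemma transition_probability:
  assumes y: "0 \<le> y"
  shows "R y 0 (k * (n - 1) + s) = B.S y + C.S y - D.S y"
proof -
  let ?L = "k * (n - 1) + s"
  have laplace: "has_laplace (\<lambda>t. B.S t + C.S t - D.S t) z (\<pi> z ?L)" if "1 / \<theta> \<le> z" for z
  proof -
    have z: "0 < z" using that \<theta>_pos by (meson less_le_trans zero_less_divide_1_iff)
    then have z': "1 / \<theta> \<le> z + \<Lambda>" using that lam \<kappa> by simp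
    define x where "x = 1 / (z + \<Lambda>)"
    have pos: "0 < z + \<Lambda>" using z lam \<kappa> by simp
    have x: "0 \<le> x" "x \<le> \<theta>" using pos z' \<theta>_pos by (simp_all add: x_def field_simps)
    have px: "1 / (z + \<Lambda>) ^ N = x ^ N" for N by (simp add: x_def power_one_over)
    have "has_laplace B.S z (G x (int ?L))"
      using B.has_laplace_S[OF z'] infsumI[OF has_sum_B[OF x n s]] unfolding px by simp
    moreover have "has_laplace C.S z (G x (int ?L) * T x 1)"
      using C.has_laplace_S[OF z'] infsumI[OF has_sum_C[OF x n s]] unfolding px
      by (simp add: case_prod_unfold)
    moreover have "has_laplace D.S z (G x (int ?L + 1) * T x 1)"
      using D.has_laplace_S[OF z'] infsumI[OF has_sum_D[OF x n s]] unfolding px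
      by (simp add: case_prod_unfold)
    ultimately show ?thesis
      unfolding resolvent_eq[OF z z', of ?L, folded x_def] by (intro has_laplace_diff has_laplace_add)
  qed
  have S_cont: "continuous_on {0..} (\<lambda>t. B.S t + C.S t - D.S t)"
    by (intro continuous_intros B.S_continuous C.S_continuous D.S_continuous)
  have right: "(f \<longlongrightarrow> f t) (at_right t)" if "continuous_on {0..} f" "0 \<le> t" for f :: "real \<Rightarrow> real" and t
  proof -
    have "(f \<longlongrightarrow> f t) (at t within {0..})" using that by (auto simp: continuous_on_def)
    then show ?thesis by (rule tendsto_within_subset) (use that(2) in auto)
  qed
  have eq: "R t 0 ?L = B.S t + C.S t - D.S t" if "0 < t" for t
  proof (rule has_laplace_unique[of "1 / \<theta>" "\<lambda>t. R t 0 ?L" "\<lambda>z. \<pi> z ?L" "\<lambda>t. B.S t + C.S t - D.S t"])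
    show "has_laplace (\<lambda>t. R t 0 ?L) z (\<pi> z ?L)" if "1 / \<theta> \<le> z" for z
      using that \<theta>_pos by (intro has_laplace_R) (meson less_le_trans zero_less_divide_1_iff)
  qed (use laplace right[OF S_cont] right[OF R_continuous] that in auto)
  show ?thesis
  proof (cases "y = 0")
    case True
    \<comment> \<open>Uniqueness of transforms covers positive times only; at time 0 both sides have
      the same right limit.\<close>
    have "((\<lambda>t. B.S t + C.S t - D.S t) \<longlongrightarrow> R 0 0 ?L) (at_right 0)"
      by (rule Lim_transform_eventually[OF right[OF R_continuous]])
        (use eq in \<open>auto simp: eventually_at_right_less intro: eventually_mono[OF eventually_at_right_less[of 0]]\<close>)
    then show ?thesis
      using tendsto_unique[OF _ right[OF S_cont, of 0]] True by auto
  qed (use eq y in simp)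
qed

end

section \<open>The inverse subordinator\<close>

lemma inverse_process_nonneg: "0 \<le> inverse_process D t \<omega>"
  unfolding inverse_process_def by (auto intro!: cInf_greatest)

lemma inverse_process_le:
  assumes "0 < t" "0 \<le> s" "t < D s \<omega>"
  shows "inverse_process D t \<omega> \<le> s"
  using assms unfolding inverse_process_def by (auto intro!: cInf_lower bdd_belowI[of _ 0])

lemma inverse_process_ge:
  assumes "0 < t" and ex: "\<exists>s\<ge>0. t < D s \<omega>" and "\<And>s. 0 \<le> s \<Longrightarrow> t < D s \<omega> \<Longrightarrow> u \<le> s"
  shows "u \<le> inverse_process D t \<omega>"
  using assms unfolding inverse_process_def by (auto intro!: cInf_greatest)

lemma inverse_process_mono:
  assumes "0 < t" "t \<le> t'" and ex: "\<exists>s\<ge>0. t' < D s \<omega>"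
  shows "inverse_process D t \<omega> \<le> inverse_process D t' \<omega>"
proof (rule inverse_process_ge)
  show "0 < t'" using assms by simp
  show "\<exists>s\<ge>0. t' < D s \<omega>" by (rule ex)
  fix s assume "0 \<le> s" "t' < D s \<omega>"
  then show "inverse_process D t \<omega> \<le> s" using assms by (intro inverse_process_le) auto
qed

text \<open>Some s barely above the infimum satisfies t < D s, and this strict inequality survives a
  small increase of t. Monotonicity in t gives the other bound.\<close>

lemma inverse_process_right_continuous:
  assumes t: "0 < t"
  shows "((\<lambda>u. inverse_process D u \<omega>) \<longlongrightarrow> inverse_process D t \<omega>) (at_right t)"
proof (cases "\<exists>s\<ge>0. t < D s \<omega>")
  case False
  \<comment> \<open>If the level t is never exceeded, neither is any higher one, and the default
    value 0 is taken throughout.\<close>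
  then have "inverse_process D u \<omega> = inverse_process D t \<omega>" if "t < u" for u
    using that by (force simp: inverse_process_def)
  then show ?thesis
    by (intro tendsto_eventually) (auto simp: eventually_at_filter)
next
  case True
  show ?thesis
  proof (rule tendstoI)
    fix e :: real assume e: "0 < e"
    have "\<exists>s. 0 \<le> s \<and> t < D s \<omega> \<and> s < inverse_process D t \<omega> + e"
    proof (rule ccontr)
      assume "\<not> ?thesis"
      then have "inverse_process D t \<omega> + e \<le> inverse_process D t \<omega>"
        using True t by (intro inverse_process_ge) (auto simp: not_less)
      then show False using e by simp
    qed
    then obtain s where s: "0 \<le> s" "t < D s \<omega>" "s < inverse_process D t \<omega> + e" by blast
    have "\<forall>\<^sub>F u in at_right t. u < D s \<omega>" "\<forall>\<^sub>F u in at_right t. t < u"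
      using s(2) by (auto simp: eventually_at_right_less intro: eventually_at_right_real[THEN eventually_mono])
    then show "\<forall>\<^sub>F u in at_right t. dist (inverse_process D u \<omega>) (inverse_process D t \<omega>) < e"
    proof eventually_elim
      case (elim u)
      then have "inverse_process D u \<omega> \<le> s" using t s by (intro inverse_process_le) auto
      moreover have "inverse_process D t \<omega> \<le> inverse_process D u \<omega>"
        using elim t s by (intro inverse_process_mono) auto
      ultimately show ?case using s(3) by (simp add: dist_real_def)
    qed
  qed
qed

text \<open>In contrast to \<open>phase_density_bound\<close> the estimate is uniform in y, so a
  constant dominates under the expectation.\<close>

lemma phase_density_le:
  assumes "0 < \<Lambda>" "0 \<le> y"
  shows "phase_density \<Lambda> N y \<le> (1 / \<Lambda>) ^ (N - 1)"
proof -
  have "phase_density \<Lambda> N y = (1 / \<Lambda>) ^ (N - 1) * ((\<Lambda> * y) ^ (N - 1) / fact (N - 1) * exp (- (\<Lambda> * y)))"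
    using assms by (simp add: phase_density_def power_mult_distrib power_one_over field_simps)
  also have "\<dots> \<le> (1 / \<Lambda>) ^ (N - 1) * (exp (\<Lambda> * y) * exp (- (\<Lambda> * y)))"
    using assms by (intro mult_left_mono mult_right_mono power_div_fact_le_exp) auto
  finally show ?thesis by (simp add: exp_minus)
qed

lemma phase_density_abs_le:
  assumes "0 < \<Lambda>" "0 \<le> y"
  shows "\<bar>phase_density \<Lambda> N y\<bar> \<le> (1 / \<Lambda>) ^ (N - 1)"
  by (simp only: abs_of_nonneg[OF phase_density_nonneg[OF assms(2)]] phase_density_le[OF assms])

text \<open>The grid point strictly above u. Approximation from the right is what right-continuous
  paths admit, and each grid is countable.\<close>

definition grid_above :: "nat \<Rightarrow> real \<Rightarrow> real" where
  "grid_above m u = (real_of_int \<lfloor>real (Suc m) * u\<rfloor> + 1) / real (Suc m)"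

lemma grid_above_at_right: "filterlim (\<lambda>m. grid_above m u) (at_right u) sequentially"
proof -
  have r: "u < grid_above m u" "grid_above m u \<le> u + 1 / real (Suc m)" for m
  proof -
    have "real (Suc m) * u < real_of_int \<lfloor>real (Suc m) * u\<rfloor> + 1" by linarith
    then show "u < grid_above m u"
      by (simp add: grid_above_def pos_less_divide_eq mult.commute del: of_nat_Suc)
    have "real_of_int \<lfloor>real (Suc m) * u\<rfloor> + 1 \<le> real (Suc m) * u + 1" by linarith
    then have "grid_above m u \<le> (real (Suc m) * u + 1) / real (Suc m)"
      unfolding grid_above_def by (intro divide_right_mono) auto
    then show "grid_above m u \<le> u + 1 / real (Suc m)" by (simp add: add_divide_distrib del: of_nat_Suc)
  qed
  have "(\<lambda>m. u + 1 / real (Suc m)) \<longlonglongrightarrow> u + 0"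
    by (intro tendsto_intros LIMSEQ_Suc[OF lim_1_over_n])
  then have up: "(\<lambda>m. u + 1 / real (Suc m)) \<longlonglongrightarrow> u" by simp
  have "(\<lambda>m. grid_above m u) \<longlonglongrightarrow> u"
    by (rule real_tendsto_sandwich[OF _ _ tendsto_const up])
      (simp_all only: r less_imp_le[OF r(1)] eventually_True)
  then show ?thesis
    using r(1) by (simp add: filterlim_at less_imp_neq[OF r(1), symmetric])
qed

text \<open>\<open>inverse_measurable\<close> will come from the independence hypothesis, whose
  event families consist of measurable sets.\<close>

locale inverse_subordinator = prob_space M for M :: "'w measure" +
  fixes D :: "real \<Rightarrow> 'w \<Rightarrow> real" and \<alpha>1 \<alpha>2 c1 c2 :: real
  assumes subordinator: "mixed_stable_subordinator M \<alpha>1 \<alpha>2 c1 c2 D"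
    and \<alpha>2: "0 < \<alpha>2" "\<alpha>2 < \<alpha>1" and \<alpha>1: "\<alpha>1 < 1" and c1: "0 < c1" and c2: "0 \<le> c2"
    and inverse_measurable: "\<And>t. 0 \<le> t \<Longrightarrow> inverse_process D t \<in> borel_measurable M"
begin

abbreviation Y :: "real \<Rightarrow> 'w \<Rightarrow> real" where "Y \<equiv> inverse_process D"

abbreviation \<psi> :: "real \<Rightarrow> real" where "\<psi> \<equiv> mixed_exponent \<alpha>1 \<alpha>2 c1 c2"

lemma D_measurable: "0 \<le> t \<Longrightarrow> D t \<in> borel_measurable M"
  and D_right: "\<omega> \<in> space M \<Longrightarrow> 0 \<le> t \<Longrightarrow> ((\<lambda>u. D u \<omega>) \<longlongrightarrow> D t \<omega>) (at_right t)"
  and D_mono: "\<omega> \<in> space M \<Longrightarrow> mono_on {0..} (\<lambda>t. D t \<omega>)"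
  and D_0: "AE \<omega> in M. D 0 \<omega> = 0"
  using subordinator by (auto simp: mixed_stable_subordinator_def levy_process_def)

lemma D_laplace:
  assumes "0 \<le> t" "0 < z"
  shows "expectation (\<lambda>\<omega>. exp (- z * D t \<omega>)) = exp (- t * \<psi> z)"
  using subordinator assms by (simp add: mixed_stable_subordinator_def mixed_exponent_def)

lemma \<psi>_pos: "0 < z \<Longrightarrow> 0 < \<psi> z"
  using c1 c2 by (auto simp: mixed_exponent_def intro!: add_pos_nonneg)

lemma \<psi>_unbounded:
  assumes "0 \<le> c"
  obtains z where "0 < z" "c < \<psi> z"
proof
  \<comment> \<open>The solution of c1 z powr \<alpha>1 = c + 1; the other summand of \<psi> is
    nonnegative.\<close>
  define z where "z = ((c + 1) / c1) powr (1 / \<alpha>1)"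
  have pos: "0 < (c + 1) / c1" using assms c1 by simp
  then have "(c + 1) / c1 \<noteq> 0" by (rule less_imp_neq[symmetric])
  then show "0 < z" by (simp add: z_def)
  have "z powr \<alpha>1 = ((c + 1) / c1) powr 1"
    unfolding z_def powr_powr using \<alpha>2 by simp
  then have "z powr \<alpha>1 = (c + 1) / c1" using powr_one[OF less_imp_le[OF pos]] by (simp only:)
  then show "c < \<psi> z" using c1 c2 by (simp add: mixed_exponent_def add_strict_increasing2 add_pos_nonneg)
qed

lemma D_nonneg: "AE \<omega> in M. \<forall>t\<ge>0. 0 \<le> D t \<omega>"
  using D_0 AE_space
proof eventually_elim
  case (elim \<omega>)
  then show ?case using mono_onD[OF D_mono[of \<omega>], of 0] by auto
qed

text \<open>A Chernoff bound at integer times: staying below N up to time m has probability at most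
  exp N exp (- m \<psi> 1), which vanishes as m grows.\<close>

lemma D_unbounded: "AE \<omega> in M. \<forall>u. \<exists>s\<ge>0. u < D s \<omega>"
proof -
  have "AE \<omega> in M. \<exists>m::nat. real N < D (real m) \<omega>" for N :: nat
  proof -
    have [measurable]: "D (real m) \<in> borel_measurable M" for m by (rule D_measurable) simp
    define A where "A = {\<omega>\<in>space M. \<forall>m::nat. D (real m) \<omega> \<le> real N}"
    have A[measurable]: "A \<in> sets M" unfolding A_def by measurable
    have "prob A \<le> exp (real N) * exp (- \<psi> 1) ^ m" for m
    proof -
      \<comment> \<open>A non-integrable function would have integral 0 by convention, but the
        integral here is an exponential.\<close>
      have int: "integrable M (\<lambda>\<omega>. exp (- 1 * D (real m) \<omega>))"
        using D_laplace[of "real m" 1] not_integrable_integral_eq by force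
      have "prob A * exp (- real N) = expectation (\<lambda>\<omega>. indicator A \<omega> * exp (- real N))" by simp
      also have "\<dots> \<le> expectation (\<lambda>\<omega>. exp (- 1 * D (real m) \<omega>))"
      proof (rule integral_mono[OF _ int])
        show "integrable M (\<lambda>\<omega>. indicator A \<omega> * exp (- real N))"
          by (intro integrable_mult_left integrable_real_indicator A) (simp add: less_top[symmetric])
      qed (auto simp: A_def indicator_def)
      also have "\<dots> = exp (- real m * \<psi> 1)" by (rule D_laplace) auto
      also have "\<dots> = exp (- \<psi> 1) ^ m" by (simp add: exp_of_nat_mult[symmetric])
      finally have "prob A * exp (- real N) * exp (real N) \<le> exp (- \<psi> 1) ^ m * exp (real N)"
        by (intro mult_right_mono) auto
      moreover have "prob A * exp (- real N) * exp (real N) = prob A" by (simp add: exp_minus)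
      ultimately show ?thesis by (simp only: mult.commute)
    qed
    note le = this
    have lim: "(\<lambda>m. exp (real N) * exp (- \<psi> 1) ^ m) \<longlonglongrightarrow> exp (real N) * 0"
      using \<psi>_pos[of 1] by (intro tendsto_mult_left LIMSEQ_realpow_zero) auto
    have "prob A \<le> exp (real N) * 0" by (rule LIMSEQ_le_const[OF lim]) (use le in blast)
    then have "A \<in> null_sets M" by (simp add: null_sets_def emeasure_eq_measure measure_le_0_iff)
    then show ?thesis
      by (rule AE_I') (auto simp: A_def not_less)
  qed
  then have "AE \<omega> in M. \<forall>N::nat. \<exists>m::nat. real N < D (real m) \<omega>" by (simp add: AE_all_countable)
  then show ?thesis
  proof eventually_elim
    case (elim \<omega>)
    show ?case
    proof
      fix u
      obtain N :: nat where "u < real N" using reals_Archimedean2 by blast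
      moreover obtain m :: nat where "real N < D (real m) \<omega>" using elim by blast
      ultimately show "\<exists>s\<ge>0. u < D s \<omega>" by (intro exI[of _ "real m"]) auto
    qed
  qed
qed

lemma Y_measurable: "Y t \<in> borel_measurable M"
proof (cases "0 \<le> t")
  case False
  then have "Y t = (\<lambda>_. 0)" by (auto simp: inverse_process_def)
  then show ?thesis by simp
qed (rule inverse_measurable)

text \<open>Right-continuity in t makes Y the limit of functions that depend on t through a
  countable grid only.\<close>

lemma Y_jointly_measurable [measurable]: "(\<lambda>p. Y (fst p) (snd p)) \<in> borel_measurable (borel \<Otimes>\<^sub>M M)"
proof -
  define u where "u = (\<lambda>m p. if 0 < fst p then Y (grid_above m (fst p)) (snd p) else 0)"
  have "(\<lambda>p. Y (fst p) (snd p)) \<in> borel_measurable (borel \<Otimes>\<^sub>M M)"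
  proof (rule borel_measurable_LIMSEQ_real)
    fix p :: "real \<times> 'w" assume "p \<in> space (borel \<Otimes>\<^sub>M M)"
    show "(\<lambda>m. u m p) \<longlonglongrightarrow> Y (fst p) (snd p)"
    proof (cases "0 < fst p")
      case True
      from filterlim_compose[OF inverse_process_right_continuous[OF True] grid_above_at_right]
      show ?thesis using True by (simp add: u_def)
    next
      case False
      then show ?thesis by (simp add: u_def inverse_process_def)
    qed
  next
    fix m
    have "(\<lambda>p. Y (real_of_int (\<lfloor>real (Suc m) * fst p\<rfloor> + 1) / real (Suc m)) (snd p)) \<in> borel_measurable (borel \<Otimes>\<^sub>M M)"
    proof (rule measurable_compose_countable[where f="\<lambda>i p. Y (real_of_int (i + 1) / real (Suc m)) (snd p)"])
      show "(\<lambda>p. Y (real_of_int (i + 1) / real (Suc m)) (snd p)) \<in> borel_measurable (borel \<Otimes>\<^sub>M M)" for i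
        by (rule measurable_compose[OF measurable_snd Y_measurable])
      show "(\<lambda>p. \<lfloor>real (Suc m) * fst p\<rfloor>) \<in> measurable (borel \<Otimes>\<^sub>M M) (count_space UNIV)"
        by measurable
    qed
    then have "(\<lambda>p. Y (grid_above m (fst p)) (snd p)) \<in> borel_measurable (borel \<Otimes>\<^sub>M M)"
      by (simp add: grid_above_def)
    then show "u m \<in> borel_measurable (borel \<Otimes>\<^sub>M M)"
      unfolding u_def by (intro measurable_If) auto
  qed
  then show ?thesis .
qed

section \<open>The inverse process at an exponential time\<close>

abbreviation exp_measure :: "real \<Rightarrow> real measure" where
  "exp_measure z \<equiv> density lborel (exponential_density z)"

text \<open>Clearly t < D a forces Y t \<le> a. Conversely, if t exceeded D a, then by
  right-continuity D would stay below t a little beyond a, so Y t > a. Only t = D a is undecided,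
  and it is a null set.\<close>

lemma emeasure_Y_le:
  assumes z: "0 < z" and a: "0 \<le> a" and \<omega>: "\<omega> \<in> space M" and nonneg: "0 \<le> D a \<omega>"
    and unb: "\<forall>u. \<exists>s\<ge>0. u < D s \<omega>" and meas: "{t. Y t \<omega> \<le> a} \<in> sets borel"
  shows "emeasure (exp_measure z) {t. Y t \<omega> \<le> a} = ennreal (1 - exp (- z * D a \<omega>))"
proof -
  have 1: "Y t \<omega> \<le> a" if "t < D a \<omega>" for t
  proof (cases "0 < t")
    case True
    then show ?thesis using that a by (intro inverse_process_le) auto
  qed (use a in \<open>simp add: inverse_process_def\<close>)
  have 2: "t \<le> D a \<omega>" if "Y t \<omega> \<le> a" for t
  proof (rule ccontr)
    assume "\<not> t \<le> D a \<omega>"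
    then have "\<forall>\<^sub>F u in at_right a. D u \<omega> < t"
      using D_right[OF \<omega> a] by (intro order_tendstoD) auto
    then obtain b where b: "a < b" "\<And>u. a < u \<Longrightarrow> u < b \<Longrightarrow> D u \<omega> < t"
      by (auto simp: eventually_at_right_field)
    define s where "s = (a + b) / 2"
    have s: "a < s" "D s \<omega> < t" using b by (auto simp: s_def)
    have "s \<le> Y t \<omega>"
    proof (rule inverse_process_ge)
      show "0 < t" using nonneg \<open>\<not> t \<le> D a \<omega>\<close> by simp
      show "\<exists>s\<ge>0. t < D s \<omega>" using unb by blast
      fix v assume v: "0 \<le> v" "t < D v \<omega>"
      show "s \<le> v"
      proof (rule ccontr)
        assume "\<not> s \<le> v"
        then have "D v \<omega> \<le> D s \<omega>" using v a s by (intro mono_onD[OF D_mono[OF \<omega>]]) auto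
        then show False using v s by simp
      qed
    qed
    then show False using that s by simp
  qed
  have "emeasure (exp_measure z) {t. Y t \<omega> \<le> a} = emeasure (exp_measure z) {..D a \<omega>}"
  proof (rule emeasure_eq_AE)
    have "AE t in lborel. t \<noteq> D a \<omega>" by (rule AE_lborel_singleton)
    then have "AE t in exp_measure z. t \<noteq> D a \<omega>"
      by (subst AE_density) auto
    then show "AE t in exp_measure z. (t \<in> {t. Y t \<omega> \<le> a}) = (t \<in> {..D a \<omega>})"
      by eventually_elim (use 1 2 in force)
  qed (use meas in auto)
  then show ?thesis using nonneg by (simp add: emeasure_erlang_density z erlang_CDF_0)
qed

text \<open>
  At an independent exponential time of rate \<open>z\<close> the inverse process is exponential of rate \<open>\<psi> z\<close>, since
  \<open>Y t > a\<close> agrees up to a single \<open>t\<close> with \<open>t > D a\<close>.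
\<close>

lemma Y_exponential:
  assumes z: "0 < z"
  shows "distributed (exp_measure z \<Otimes>\<^sub>M M) lborel (\<lambda>p. Y (fst p) (snd p)) (exponential_density (\<psi> z))"
proof -
  interpret E: prob_space "exp_measure z" by (rule prob_space_exponential_density[OF z])
  interpret EM: pair_prob_space "exp_measure z" M ..
  have meas: "(\<lambda>p. Y (fst p) (snd p)) \<in> borel_measurable (exp_measure z \<Otimes>\<^sub>M M)"
    using Y_jointly_measurable by (simp cong: measurable_cong_sets sets_pair_measure_cong)
  show ?thesis
  proof (rule exponential_distributedI[OF meas \<psi>_pos[OF z]])
    fix a :: real assume a: "0 \<le> a"
    let ?A = "{p \<in> space (exp_measure z \<Otimes>\<^sub>M M). Y (fst p) (snd p) \<le> a}"
    have A: "?A \<in> sets (exp_measure z \<Otimes>\<^sub>M M)" using meas by measurable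
    have [measurable]: "D a \<in> borel_measurable M" by (rule D_measurable) fact
    have nonneg: "AE \<omega> in M. 0 \<le> 1 - exp (- z * D a \<omega>)"
      using D_nonneg by eventually_elim (use z a in auto)
    have int: "integrable M (\<lambda>\<omega>. exp (- z * D a \<omega>))"
      using D_laplace[OF a z] not_integrable_integral_eq by force
    have "emeasure (exp_measure z \<Otimes>\<^sub>M M) ?A = (\<integral>\<^sup>+ \<omega>. emeasure (exp_measure z) ((\<lambda>t. (t, \<omega>)) -` ?A) \<partial>M)"
      by (rule EM.emeasure_pair_measure_alt2[OF A])
    also have "\<dots> = (\<integral>\<^sup>+ \<omega>. ennreal (1 - exp (- z * D a \<omega>)) \<partial>M)"
    proof (rule nn_integral_cong_AE)
      show "AE \<omega> in M. emeasure (exp_measure z) ((\<lambda>t. (t, \<omega>)) -` ?A) = ennreal (1 - exp (- z * D a \<omega>))"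
        using D_nonneg D_unbounded AE_space
      proof eventually_elim
        case (elim \<omega>)
        have eq: "(\<lambda>t. (t, \<omega>)) -` ?A = {t. Y t \<omega> \<le> a}"
          using elim by (auto simp: space_pair_measure)
        have "(\<lambda>t. (t, \<omega>)) -` ?A \<in> sets borel"
          using sets_Pair2[OF A, of \<omega>] by simp
        then show ?case unfolding eq using elim a by (intro emeasure_Y_le z) auto
      qed
    qed
    also have "\<dots> = ennreal (expectation (\<lambda>\<omega>. 1 - exp (- z * D a \<omega>)))"
      using int nonneg by (intro nn_integral_eq_integral) auto
    also have "expectation (\<lambda>\<omega>. 1 - exp (- z * D a \<omega>)) = 1 - exp (- a * \<psi> z)"
      using int by (simp add: D_laplace[OF a z, simplified] prob_space)
    finally show "emeasure (exp_measure z \<Otimes>\<^sub>M M) ?A = 1 - ennreal (exp (- a * \<psi> z))"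
      using ennreal_minus[of "exp (- a * \<psi> z)" 1] by simp
  qed
qed

text \<open>For nonnegative F no integrability has to be known in advance, so the identity serves
  both the exponential moments and the transforms.\<close>

lemma nn_integral_Y:
  assumes z: "0 < z" and [measurable]: "F \<in> borel_measurable borel"
  shows "(\<integral>\<^sup>+t. (\<integral>\<^sup>+\<omega>. F (Y t \<omega>) \<partial>M) \<partial>exp_measure z) = (\<integral>\<^sup>+y. ennreal (exponential_density (\<psi> z) y) * F y \<partial>lborel)"
proof -
  have meas: "(\<lambda>p. Y (fst p) (snd p)) \<in> borel_measurable (exp_measure z \<Otimes>\<^sub>M M)"
    using Y_jointly_measurable by (simp cong: measurable_cong_sets sets_pair_measure_cong)
  have "(\<integral>\<^sup>+y. ennreal (exponential_density (\<psi> z) y) * F y \<partial>lborel) = (\<integral>\<^sup>+p. F (Y (fst p) (snd p)) \<partial>(exp_measure z \<Otimes>\<^sub>M M))"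
    by (rule distributed_nn_integral[OF Y_exponential[OF z]]) simp
  also have "\<dots> = (\<integral>\<^sup>+t. (\<integral>\<^sup>+\<omega>. F (Y t \<omega>) \<partial>M) \<partial>exp_measure z)"
    using nn_integral_fst[of "\<lambda>p. F (Y (fst p) (snd p))" "exp_measure z", symmetric]
      measurable_compose[OF meas, of F] by simp
  finally show ?thesis ..
qed

text \<open>If \<psi> z > c, the moment averaged over an exponential time is finite. Finiteness at
  the given t0 follows because Y is almost surely nondecreasing in t and the times after t0 have
  positive mass.\<close>

lemma Y_exponential_moment:
  assumes c: "0 \<le> c" and t0: "0 < t0"
  shows "integrable M (\<lambda>\<omega>. exp (c * Y t0 \<omega>))"
proof -
  obtain z where z: "0 < z" "c < \<psi> z" using \<psi>_unbounded[OF c] .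
  interpret E: prob_space "exp_measure z" by (rule prob_space_exponential_density[OF z(1)])
  define h where "h = (\<lambda>t. \<integral>\<^sup>+\<omega>. ennreal (exp (c * Y t \<omega>)) \<partial>M)"
  have "(\<integral>\<^sup>+t. h t \<partial>exp_measure z) = (\<integral>\<^sup>+y. ennreal (exponential_density (\<psi> z) y) * ennreal (exp (c * y)) \<partial>lborel)"
    unfolding h_def by (rule nn_integral_Y[OF z(1)]) measurable
  also have "\<dots> = (\<integral>\<^sup>+y. ennreal (\<psi> z / (\<psi> z - c)) * ennreal (exponential_density (\<psi> z - c) y) \<partial>lborel)"
  proof (rule nn_integral_cong)
    fix y :: real
    have "exponential_density (\<psi> z) y * exp (c * y) = \<psi> z / (\<psi> z - c) * exponential_density (\<psi> z - c) y"
    proof (cases "y < 0")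
      case False
      have "exp (- y * \<psi> z) * exp (c * y) = exp (- y * (\<psi> z - c))"
        by (simp add: exp_add[symmetric] algebra_simps)
      then show ?thesis using z False by (simp add: exponential_density_def)
    qed (simp add: exponential_density_def)
    then show "ennreal (exponential_density (\<psi> z) y) * ennreal (exp (c * y)) = ennreal (\<psi> z / (\<psi> z - c)) * ennreal (exponential_density (\<psi> z - c) y)"
      using z \<psi>_pos[of z] by (simp flip: ennreal_mult)
  qed
  also have "\<dots> = ennreal (\<psi> z / (\<psi> z - c)) * (\<integral>\<^sup>+y. ennreal (exponential_density (\<psi> z - c) y) \<partial>lborel)"
    by (rule nn_integral_cmult) simp
  also have "(\<integral>\<^sup>+y. ennreal (exponential_density (\<psi> z - c) y) \<partial>lborel) = 1"
    using prob_space.emeasure_space_1[OF prob_space_exponential_density[of "\<psi> z - c"]] z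
    by (simp add: emeasure_density)
  finally have fin: "(\<integral>\<^sup>+t. h t \<partial>exp_measure z) < \<infinity>" by (simp add: less_top)
  have "h t0 * emeasure (exp_measure z) {t0<..} = (\<integral>\<^sup>+t. h t0 * indicator {t0<..} t \<partial>exp_measure z)"
    by (rule nn_integral_cmult_indicator[symmetric]) simp
  also have "\<dots> \<le> (\<integral>\<^sup>+t. h t \<partial>exp_measure z)"
  proof (rule nn_integral_mono)
    fix t
    have "h t0 \<le> h t" if "t0 < t"
      unfolding h_def
    proof (rule nn_integral_mono_AE)
      show "AE \<omega> in M. ennreal (exp (c * Y t0 \<omega>)) \<le> ennreal (exp (c * Y t \<omega>))"
        using D_unbounded
        by eventually_elim (use that t0 c in \<open>auto intro!: ennreal_leI mult_left_mono inverse_process_mono\<close>)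
    qed
    then show "h t0 * indicator {t0<..} t \<le> h t" by (simp add: indicator_def)
  qed
  finally have "h t0 * emeasure (exp_measure z) {t0<..} < \<infinity>" using fin by (rule le_less_trans)
  moreover have "emeasure (exp_measure z) {t0<..} \<noteq> 0"
  proof -
    have "{t0<..} = space (exp_measure z) - {..t0}" by auto
    then have "emeasure (exp_measure z) {t0<..} = 1 - ennreal (1 - exp (- z * t0))"
      using emeasure_compl[of "{..t0}" "exp_measure z"] E.emeasure_space_1 z t0
      by (simp add: emeasure_erlang_density erlang_CDF_0 E.emeasure_finite)
    also have "\<dots> = ennreal (exp (- z * t0))"
      using z t0 by (simp add: ennreal_minus flip: ennreal_1)
    finally show ?thesis by simp
  qed
  ultimately have "h t0 < \<infinity>" by (auto simp: ennreal_mult_less_top less_top)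
  then show ?thesis
    using Y_measurable[of t0] by (intro integrableI_bounded) (auto simp: h_def)
qed

definition phase_mean :: "real \<Rightarrow> nat \<Rightarrow> real \<Rightarrow> real" where
  "phase_mean \<Lambda> N t = expectation (\<lambda>\<omega>. phase_density \<Lambda> N (Y t \<omega>))"

lemma phase_density_Y_integrable:
  assumes "0 < \<Lambda>"
  shows "integrable M (\<lambda>\<omega>. phase_density \<Lambda> N (Y t \<omega>))"
proof (rule integrable_const_bound[of _ "(1 / \<Lambda>) ^ (N - 1)"])
  show "AE \<omega> in M. norm (phase_density \<Lambda> N (Y t \<omega>)) \<le> (1 / \<Lambda>) ^ (N - 1)"
    by (intro AE_I2) (simp only: real_norm_def phase_density_abs_le[OF assms inverse_process_nonneg])
  show "(\<lambda>\<omega>. phase_density \<Lambda> N (Y t \<omega>)) \<in> borel_measurable M"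
    by (rule measurable_compose[OF Y_measurable]) simp
qed

lemma phase_mean_nonneg: "0 \<le> phase_mean \<Lambda> N t"
  unfolding phase_mean_def by (intro integral_nonneg_AE AE_I2 phase_density_nonneg inverse_process_nonneg)

text \<open>By \<open>nn_integral_Y\<close>, z times this transform at z equals \<psi> z times the
  transform of the phase density at \<psi> z.\<close>

lemma has_laplace_phase_mean:
  assumes \<Lambda>: "0 < \<Lambda>" and N: "1 \<le> N" and z: "0 < z"
  shows "has_laplace (phase_mean \<Lambda> N) z (\<psi> z / z * (1 / (\<psi> z + \<Lambda>) ^ N))"
proof -
  have pos: "0 < \<psi> z" by (rule \<psi>_pos[OF z])
  have phase_mean_meas[measurable]: "phase_mean \<Lambda> N \<in> borel_measurable borel"
  proof -
    have "(\<lambda>p. phase_density \<Lambda> N (Y (fst p) (snd p))) \<in> borel_measurable (borel \<Otimes>\<^sub>M M)" by measurable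
    then have "(\<lambda>t. \<integral>\<omega>. phase_density \<Lambda> N (Y t \<omega>) \<partial>M) \<in> borel_measurable borel"
      by (intro borel_measurable_lebesgue_integral) (simp add: case_prod_unfold)
    then show ?thesis by (simp add: phase_mean_def[abs_def])
  qed
  have phase_mean_nn: "ennreal (phase_mean \<Lambda> N t) = (\<integral>\<^sup>+\<omega>. ennreal (phase_density \<Lambda> N (Y t \<omega>)) \<partial>M)" for t
    unfolding phase_mean_def
    by (rule nn_integral_eq_integral[symmetric, OF phase_density_Y_integrable[OF \<Lambda>]])
      (simp add: phase_density_nonneg inverse_process_nonneg)
  have pd: "has_bochner_integral lborel (\<lambda>t. indicator {0<..} t * (exp (- (\<psi> z * t)) * phase_density \<Lambda> N t)) (1 / (\<psi> z + \<Lambda>) ^ N)"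
    using has_laplace_phase_density[OF N, of "\<psi> z" \<Lambda>] pos \<Lambda> by (simp add: has_laplace_def)
  have pd_nn: "(\<integral>\<^sup>+y. ennreal (indicator {0<..} y * (exp (- (\<psi> z * y)) * phase_density \<Lambda> N y)) \<partial>lborel) = ennreal (1 / (\<psi> z + \<Lambda>) ^ N)"
    using nn_integral_eq_integral[of lborel "\<lambda>y. indicator {0<..} y * (exp (- (\<psi> z * y)) * phase_density \<Lambda> N y)"] pd
    by (auto simp: has_bochner_integral_iff indicator_def phase_density_nonneg)
  have swap: "(\<integral>\<^sup>+t. ennreal (exponential_density v t) * f t \<partial>lborel) = ennreal v * (\<integral>\<^sup>+t. ennreal (indicator {0<..} t * exp (- (v * t))) * f t \<partial>lborel)"
    if v: "0 < v" and [measurable]: "f \<in> borel_measurable borel" for v and f :: "real \<Rightarrow> ennreal"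
  proof -
    have "(\<integral>\<^sup>+t. ennreal (exponential_density v t) * f t \<partial>lborel) = (\<integral>\<^sup>+t. ennreal v * (ennreal (indicator {0<..} t * exp (- (v * t))) * f t) \<partial>lborel)"
    proof (rule nn_integral_cong_AE)
      show "AE t in lborel. ennreal (exponential_density v t) * f t = ennreal v * (ennreal (indicator {0<..} t * exp (- (v * t))) * f t)"
        using AE_lborel_singleton[of 0]
      proof eventually_elim
        case (elim t)
        have "exponential_density v t = v * (indicator {0<..} t * exp (- (v * t)))"
          using elim by (simp add: exponential_density_def indicator_def mult.commute)
        then show ?case using v by (simp add: ennreal_mult mult.assoc)
      qed
    qed
    also have "\<dots> = ennreal v * (\<integral>\<^sup>+t. ennreal (indicator {0<..} t * exp (- (v * t))) * f t \<partial>lborel)"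
      by (rule nn_integral_cmult) measurable
    finally show ?thesis .
  qed
  define X where "X = (\<integral>\<^sup>+t. ennreal (indicator {0<..} t * exp (- (z * t))) * ennreal (phase_mean \<Lambda> N t) \<partial>lborel)"
  have "ennreal z * X = (\<integral>\<^sup>+t. ennreal (phase_mean \<Lambda> N t) \<partial>exp_measure z)"
    unfolding X_def by (subst swap[OF z, symmetric]) (simp_all add: nn_integral_density)
  also have "\<dots> = (\<integral>\<^sup>+y. ennreal (exponential_density (\<psi> z) y) * ennreal (phase_density \<Lambda> N y) \<partial>lborel)"
    unfolding phase_mean_nn by (rule nn_integral_Y[OF z]) measurable
  also have "\<dots> = ennreal (\<psi> z) * ennreal (1 / (\<psi> z + \<Lambda>) ^ N)"
  proof -
    have "ennreal (indicator {0<..} y * exp (- (\<psi> z * y))) * ennreal (phase_density \<Lambda> N y)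
      = ennreal (indicator {0<..} y * (exp (- (\<psi> z * y)) * phase_density \<Lambda> N y))" for y
      by (cases "0 < y") (simp_all add: phase_density_nonneg ennreal_mult)
    then show ?thesis unfolding pd_nn[symmetric] by (subst swap[OF pos]) simp_all
  qed
  also have "\<dots> = ennreal (\<psi> z * (1 / (\<psi> z + \<Lambda>) ^ N))"
    using pos \<Lambda> by (intro ennreal_mult[symmetric]) auto
  finally have "ennreal (1 / z) * (ennreal z * X) = ennreal (1 / z) * ennreal (\<psi> z * (1 / (\<psi> z + \<Lambda>) ^ N))"
    by simp
  also have "\<dots> = ennreal (1 / z * (\<psi> z * (1 / (\<psi> z + \<Lambda>) ^ N)))"
    using pos z \<Lambda> by (intro ennreal_mult[symmetric]) auto
  also have "ennreal (1 / z) * (ennreal z * X) = X"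
    using ennreal_mult[of "1 / z" z] z by (simp add: mult.assoc[symmetric])
  finally have "X = ennreal (\<psi> z / z * (1 / (\<psi> z + \<Lambda>) ^ N))" by simp
  moreover have "X = (\<integral>\<^sup>+t. ennreal (indicator {0<..} t * (exp (- (z * t)) * phase_mean \<Lambda> N t)) \<partial>lborel)"
    unfolding X_def by (intro nn_integral_cong) (simp add: phase_mean_nonneg ennreal_mult mult.assoc)
  ultimately have "(\<integral>\<^sup>+t. ennreal (indicator {0<..} t * (exp (- (z * t)) * phase_mean \<Lambda> N t)) \<partial>lborel) = ennreal (\<psi> z / z * (1 / (\<psi> z + \<Lambda>) ^ N))"
    by simp
  then show ?thesis
    unfolding has_laplace_def using pos z \<Lambda>
    by (intro has_bochner_integral_nn_integral) (auto simp: phase_mean_nonneg)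
qed

lemma phase_mean_right_continuous:
  assumes \<Lambda>: "0 < \<Lambda>" and t: "0 < t"
  shows "(phase_mean \<Lambda> N \<longlongrightarrow> phase_mean \<Lambda> N t) (at_right t)"
proof (rule tendsto_at_right_sequentially[of t "t + 1"])
  fix S :: "nat \<Rightarrow> real" assume S: "\<And>n. t < S n" "S \<longlonglongrightarrow> t"
  then have lim: "filterlim S (at_right t) sequentially"
    by (auto simp: filterlim_at intro!: always_eventually)
  have cont: "isCont (phase_density \<Lambda> N) y" for y
    unfolding phase_density_def by (intro continuous_intros) auto
  show "(\<lambda>n. phase_mean \<Lambda> N (S n)) \<longlonglongrightarrow> phase_mean \<Lambda> N t"
    unfolding phase_mean_def
  proof (rule integral_dominated_convergence[where w="\<lambda>_. (1 / \<Lambda>) ^ (N - 1)"])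
    show "AE \<omega> in M. (\<lambda>n. phase_density \<Lambda> N (Y (S n) \<omega>)) \<longlonglongrightarrow> phase_density \<Lambda> N (Y t \<omega>)"
      by (intro AE_I2 isCont_tendsto_compose[OF cont] filterlim_compose[OF inverse_process_right_continuous[OF t] lim])
    show "AE \<omega> in M. norm (phase_density \<Lambda> N (Y (S n) \<omega>)) \<le> (1 / \<Lambda>) ^ (N - 1)" for n
      by (intro AE_I2) (simp only: real_norm_def phase_density_abs_le[OF \<Lambda> inverse_process_nonneg])
  qed (auto intro!: borel_measurable_integrable[OF phase_density_Y_integrable[OF \<Lambda>]])
qed auto

lemma phase_mean_eq_mixed_conv:
  assumes \<Lambda>: "0 < \<Lambda>" and N: "1 \<le> N" and t: "0 < t"
  shows "phase_mean \<Lambda> N t = mixed_conv \<Lambda> \<alpha>1 \<alpha>2 c1 c2 N t / c1 ^ N"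
proof -
  interpret MK: mixed_kernels \<Lambda> \<alpha>1 \<alpha>2 c1 c2
    by unfold_locales (use \<Lambda> \<alpha>2 \<alpha>1 c1 c2 in auto)
  obtain z0 where z0: "0 < z0" "\<And>z. z0 \<le> z \<Longrightarrow> has_laplace (\<lambda>t. mixed_conv \<Lambda> \<alpha>1 \<alpha>2 c1 c2 N t / c1 ^ N) z (\<psi> z / z * (1 / (\<psi> z + \<Lambda>) ^ N))"
    using MK.has_laplace_mixed_conv N by metis
  have "isCont (mixed_conv \<Lambda> \<alpha>1 \<alpha>2 c1 c2 N) t"
    using MK.mixed_conv_continuous[OF N] t by (subst (asm) continuous_on_eq_continuous_at) auto
  then have "(mixed_conv \<Lambda> \<alpha>1 \<alpha>2 c1 c2 N \<longlongrightarrow> mixed_conv \<Lambda> \<alpha>1 \<alpha>2 c1 c2 N t) (at_right t)"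
    unfolding continuous_at by (rule tendsto_within_subset) auto
  then have right: "((\<lambda>t. mixed_conv \<Lambda> \<alpha>1 \<alpha>2 c1 c2 N t / c1 ^ N) \<longlongrightarrow> mixed_conv \<Lambda> \<alpha>1 \<alpha>2 c1 c2 N t / c1 ^ N) (at_right t)"
    using c1 by (intro tendsto_divide tendsto_const) auto
  show ?thesis
    by (rule has_laplace_unique[of z0 "phase_mean \<Lambda> N" "\<lambda>z. \<psi> z / z * (1 / (\<psi> z + \<Lambda>) ^ N)" "\<lambda>t. mixed_conv \<Lambda> \<alpha>1 \<alpha>2 c1 c2 N t / c1 ^ N"])
      (use z0 has_laplace_phase_mean[OF \<Lambda> N] phase_mean_right_continuous[OF \<Lambda> t] right t in auto)
qed

end

section \<open>The time-changed queue\<close>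

text \<open>At each point at most one term is nonzero, so the sum always exists, and the integrals
  are dominated by the summable probabilities of the cells.\<close>

lemma has_bochner_integral_partition:
  fixes g :: "nat \<Rightarrow> 'a \<Rightarrow> real"
  assumes "prob_space M" and B: "\<And>j. B j \<in> sets M" "disjoint_family B"
    and g: "\<And>j. g j \<in> borel_measurable M" "\<And>j \<omega>. \<bar>g j \<omega>\<bar> \<le> 1"
  shows "has_bochner_integral M (\<lambda>\<omega>. \<Sum>\<^sub>\<infinity>j. indicator (B j) \<omega> * g j \<omega>) (\<Sum>\<^sub>\<infinity>j. \<integral>\<omega>. indicator (B j) \<omega> * g j \<omega> \<partial>M)"
proof (rule has_bochner_integral_infsum)
  interpret prob_space M by fact
  note [measurable] = B(1) g(1)
  have int_B: "integrable M (\<lambda>\<omega>. indicator (B j) \<omega> :: real)" for j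
    by (intro integrable_real_indicator B) (simp add: less_top[symmetric])
  have le: "\<bar>indicator (B j) \<omega> * g j \<omega>\<bar> \<le> indicator (B j) \<omega>" for j \<omega>
    using g(2)[of j \<omega>] by (simp add: indicator_def)
  show int: "integrable M (\<lambda>\<omega>. indicator (B j) \<omega> * g j \<omega>)" for j
    by (rule Bochner_Integration.integrable_bound[OF int_B[of j]]) (use le[of j] in auto)
  have "(\<lambda>j. prob (B j)) sums prob (\<Union>j. B j)"
    using B by (intro finite_measure_UNION) auto
  then have "(\<lambda>j. prob (B j)) summable_on UNIV"
    by (simp add: summable_on_UNIV_nonneg_real_iff sums_iff)
  then show "(\<lambda>j. \<integral>\<omega>. \<bar>indicator (B j) \<omega> * g j \<omega>\<bar> \<partial>M) summable_on UNIV"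
  proof (rule summable_on_comparison_test)
    fix j
    have "(\<integral>\<omega>. \<bar>indicator (B j) \<omega> * g j \<omega>\<bar> \<partial>M) \<le> (\<integral>\<omega>. indicator (B j) \<omega> \<partial>M)"
      by (rule integral_mono[OF _ int_B le]) (use int in auto)
    then show "(\<integral>\<omega>. \<bar>indicator (B j) \<omega> * g j \<omega>\<bar> \<partial>M) \<le> prob (B j)"
      using B(1)[of j] by simp
  qed simp
  fix \<omega>
  show "(\<lambda>j. indicator (B j) \<omega> * g j \<omega>) summable_on UNIV"
  proof (cases "\<exists>j. \<omega> \<in> B j")
    case True
    then obtain i where i: "\<omega> \<in> B i" by blast
    have "{j \<in> UNIV. indicator (B j) \<omega> * g j \<omega> \<noteq> 0} \<subseteq> {i}"
    proof
      fix j assume "j \<in> {j \<in> UNIV. indicator (B j) \<omega> * g j \<omega> \<noteq> 0}"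
      then have "\<omega> \<in> B j" by (cases "\<omega> \<in> B j") simp_all
      then have "j = i" using i disjoint_family_onD[OF B(2), of i j] by blast
      then show "j \<in> {i}" by simp
    qed
    then have "finite {j \<in> UNIV. indicator (B j) \<omega> * g j \<omega> \<noteq> 0}"
      by (rule finite_subset) simp
    then show ?thesis by (rule finite_nonzero_values_imp_summable_on)
  qed simp
qed simp

text \<open>For a random time on a grid, independence factorises cell by cell. Refining the grid
  from above, the indicators become eventually constant because paths are right-continuous for the
  discrete topology, while p converges by continuity; both limits are dominated by 1. Measurability
  of the event also comes from this limit.\<close>

lemma (in prob_space) prob_at_independent_time:
  fixes X :: "real \<Rightarrow> 'a \<Rightarrow> 's" and Z :: "real \<Rightarrow> 'a \<Rightarrow> real"
  assumes indep: "indep_set (process_events M (count_space S) X) (process_events M borel Z)"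
    and t: "0 \<le> t" and Z_nonneg: "\<And>\<omega>. 0 \<le> Z t \<omega>" and x: "x \<in> S"
    and right: "\<And>\<omega> u. \<omega> \<in> space M \<Longrightarrow> 0 \<le> u \<Longrightarrow> \<forall>\<^sub>F v in at_right u. X v \<omega> = X u \<omega>"
    and p: "\<And>u. 0 \<le> u \<Longrightarrow> prob {\<omega> \<in> space M. X u \<omega> = x} = p u" "continuous_on {0..} p"
  shows "{\<omega> \<in> space M. X (Z t \<omega>) \<omega> = x} \<in> events"
    and "prob {\<omega> \<in> space M. X (Z t \<omega>) \<omega> = x} = expectation (\<lambda>\<omega>. p (Z t \<omega>))"
proof -
  have X_ev: "X u -` A \<inter> space M \<in> process_events M (count_space S) X" if "0 \<le> u" "A \<subseteq> S" for u A
    unfolding process_events_def using that by (intro sigma_sets.Basic) auto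
  have Z_ev: "Z t -` A \<inter> space M \<in> process_events M borel Z" if "A \<in> sets borel" for A
    unfolding process_events_def using that t by (intro sigma_sets.Basic) auto
  have sub: "process_events M (count_space S) X \<subseteq> events" "process_events M borel Z \<subseteq> events"
    using indep by (auto simp: indep_sets2_eq)
  \<comment> \<open>On \<open>B m j\<close> the grid point above the random time is
    \<open>q m j\<close>. Natural indices suffice since the time is nonnegative.\<close>
  define B where "B = (\<lambda>m j. Z t -` {u. \<lfloor>real (Suc m) * u\<rfloor> = int j} \<inter> space M)"
  define q where "q = (\<lambda>m j. (real j + 1) / real (Suc m))"
  define E where "E = (\<lambda>u. X u -` {x} \<inter> space M)"
  have q_nonneg: "0 \<le> q m j" for m j by (simp add: q_def)
  have B_ev: "B m j \<in> process_events M borel Z" for m j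
    unfolding B_def by (rule Z_ev) measurable
  have E_ev: "E u \<in> process_events M (count_space S) X" if "0 \<le> u" for u
    unfolding E_def using that x by (intro X_ev) auto
  have B_sets: "B m j \<in> events" for m j using B_ev sub by blast
  have E_sets: "E (q m j) \<in> events" for m j using E_ev[OF q_nonneg] sub by blast
  have prob_E: "prob (E u) = p u" if "0 \<le> u" for u
    using p(1)[OF that] by (simp add: E_def vimage_def Int_def conj_commute)
  have p_bound: "\<bar>p u\<bar> \<le> 1" if "0 \<le> u" for u
    using prob_E[OF that] by (metis abs_of_nonneg measure_nonneg prob_le_1)
  have disj: "disjoint_family (B m)" for m
    by (auto simp: disjoint_family_on_def B_def)
  have grid_bin: "grid_above m (Z t \<omega>) = q m (nat \<lfloor>real (Suc m) * Z t \<omega>\<rfloor>)"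
    and in_bin: "\<omega> \<in> space M \<Longrightarrow> \<omega> \<in> B m j \<longleftrightarrow> j = nat \<lfloor>real (Suc m) * Z t \<omega>\<rfloor>" for m j \<omega>
  proof -
    have "0 \<le> \<lfloor>real (Suc m) * Z t \<omega>\<rfloor>" using Z_nonneg[of \<omega>] by simp
    then show "grid_above m (Z t \<omega>) = q m (nat \<lfloor>real (Suc m) * Z t \<omega>\<rfloor>)"
      "\<omega> \<in> space M \<Longrightarrow> \<omega> \<in> B m j \<longleftrightarrow> j = nat \<lfloor>real (Suc m) * Z t \<omega>\<rfloor>"
      by (auto simp: grid_above_def q_def B_def)
  qed
  have bin_sum: "(\<Sum>\<^sub>\<infinity>j. indicator (B m j) \<omega> * g (q m j)) = g (grid_above m (Z t \<omega>))"
    if "\<omega> \<in> space M" for m \<omega> and g :: "real \<Rightarrow> real"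
    unfolding grid_bin
    by (rule infsumI, rule has_sum_finite_neutralI[of "{nat \<lfloor>real (Suc m) * Z t \<omega>\<rfloor>}"])
      (use in_bin[OF that] in \<open>auto simp: indicator_def\<close>)
  define f where "f = (\<lambda>m \<omega>. indicator (E (grid_above m (Z t \<omega>))) \<omega> :: real)"
  have f: "has_bochner_integral M (f m) (\<Sum>\<^sub>\<infinity>j. prob (B m j) * p (q m j))" for m
  proof -
    have "has_bochner_integral M (\<lambda>\<omega>. \<Sum>\<^sub>\<infinity>j. indicat_real (B m j) \<omega> * indicat_real (E (q m j)) \<omega>) (\<Sum>\<^sub>\<infinity>j. expectation (\<lambda>\<omega>. indicat_real (B m j) \<omega> * indicat_real (E (q m j)) \<omega>))"
      using B_sets E_sets disj by (intro has_bochner_integral_partition prob_space_axioms) auto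
    moreover have "expectation (\<lambda>\<omega>. indicat_real (B m j) \<omega> * indicat_real (E (q m j)) \<omega>) = prob (B m j) * p (q m j)" for j
    proof -
      have "expectation (\<lambda>\<omega>. indicat_real (B m j) \<omega> * indicat_real (E (q m j)) \<omega>) = prob (E (q m j) \<inter> B m j)"
        using B_sets E_sets by (simp flip: indicator_inter_arith add: Int_commute)
      also have "\<dots> = prob (E (q m j)) * prob (B m j)"
        by (rule indep_setD[OF indep E_ev[OF q_nonneg] B_ev])
      finally show ?thesis using prob_E[OF q_nonneg] by simp
    qed
    moreover have "(\<Sum>\<^sub>\<infinity>j. indicat_real (B m j) \<omega> * indicat_real (E (q m j)) \<omega>) = f m \<omega>" if "\<omega> \<in> space M" for \<omega>
      using bin_sum[OF that, of m "\<lambda>u. indicat_real (E u) \<omega>"] by (simp add: f_def)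
    ultimately show ?thesis
      by (subst (asm) has_bochner_integral_cong[OF refl _ refl]) auto
  qed
  have pg: "has_bochner_integral M (\<lambda>\<omega>. p (grid_above m (Z t \<omega>))) (\<Sum>\<^sub>\<infinity>j. prob (B m j) * p (q m j))" for m
  proof -
    have "has_bochner_integral M (\<lambda>\<omega>. \<Sum>\<^sub>\<infinity>j. indicator (B m j) \<omega> * p (q m j)) (\<Sum>\<^sub>\<infinity>j. expectation (\<lambda>\<omega>. indicator (B m j) \<omega> * p (q m j)))"
      using B_sets disj p_bound[OF q_nonneg] by (intro has_bochner_integral_partition prob_space_axioms) auto
    then show ?thesis
      using B_sets bin_sum by (subst (asm) has_bochner_integral_cong[OF refl _ refl]) auto
  qed
  have grid_nonneg: "0 \<le> grid_above m (Z t \<omega>)" for m \<omega>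
    unfolding grid_bin by (rule q_nonneg)
  have lim_f: "(\<lambda>m. f m \<omega>) \<longlonglongrightarrow> indicat_real (E (Z t \<omega>)) \<omega>" if "\<omega> \<in> space M" for \<omega>
  proof (rule tendsto_eventually)
    have "\<forall>\<^sub>F m in sequentially. X (grid_above m (Z t \<omega>)) \<omega> = X (Z t \<omega>) \<omega>"
      using grid_above_at_right right[OF that Z_nonneg] by (rule filterlim_iff[THEN iffD1, rule_format])
    then show "\<forall>\<^sub>F m in sequentially. f m \<omega> = indicat_real (E (Z t \<omega>)) \<omega>"
      by eventually_elim (simp add: f_def E_def indicator_def)
  qed
  have lim_p: "(\<lambda>m. p (grid_above m (Z t \<omega>))) \<longlonglongrightarrow> p (Z t \<omega>)" for \<omega>
  proof (rule continuous_on_tendsto_compose[OF p(2)])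
    show "(\<lambda>m. grid_above m (Z t \<omega>)) \<longlonglongrightarrow> Z t \<omega>"
      using grid_above_at_right[of "Z t \<omega>"] by (simp add: filterlim_at)
  qed (use Z_nonneg grid_nonneg in auto)
  have f_meas: "f m \<in> borel_measurable M" for m using f[of m] by (auto simp: has_bochner_integral_iff)
  have pg_meas: "(\<lambda>\<omega>. p (grid_above m (Z t \<omega>))) \<in> borel_measurable M" for m
    using pg[of m] by (auto simp: has_bochner_integral_iff)
  have E_meas: "(\<lambda>\<omega>. indicat_real (E (Z t \<omega>)) \<omega> :: real) \<in> borel_measurable M"
    by (rule borel_measurable_LIMSEQ_real[OF lim_f f_meas])
  have p_meas: "(\<lambda>\<omega>. p (Z t \<omega>)) \<in> borel_measurable M"
    by (rule borel_measurable_LIMSEQ_real[OF lim_p pg_meas])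
  have "(\<lambda>m. expectation (f m)) \<longlonglongrightarrow> expectation (\<lambda>\<omega>. indicat_real (E (Z t \<omega>)) \<omega>)"
    by (rule integral_dominated_convergence[where w="\<lambda>_. 1"])
      (use f_meas E_meas lim_f in \<open>auto simp: f_def indicator_def\<close>)
  moreover have "(\<lambda>m. expectation (\<lambda>\<omega>. p (grid_above m (Z t \<omega>)))) \<longlonglongrightarrow> expectation (\<lambda>\<omega>. p (Z t \<omega>))"
    by (rule integral_dominated_convergence[where w="\<lambda>_. 1"])
      (use pg_meas p_meas lim_p p_bound[OF grid_nonneg] in auto)
  moreover have "expectation (f m) = expectation (\<lambda>\<omega>. p (grid_above m (Z t \<omega>)))" for m
    using f[of m] pg[of m] by (simp add: has_bochner_integral_iff)
  ultimately have "expectation (\<lambda>\<omega>. indicat_real (E (Z t \<omega>)) \<omega>) = expectation (\<lambda>\<omega>. p (Z t \<omega>))"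
    using LIMSEQ_unique by fastforce
  then have lim_eq: "expectation (\<lambda>\<omega>. indicat_real (E (Z t \<omega>)) \<omega>) = expectation (\<lambda>\<omega>. p (Z t \<omega>))" .
  define A where "A = {\<omega> \<in> space M. X (Z t \<omega>) \<omega> = x}"
  have eq: "indicat_real (E (Z t \<omega>)) \<omega> = (indicator A \<omega> :: real)" if "\<omega> \<in> space M" for \<omega>
    using that by (simp add: A_def E_def indicator_def)
  have "(\<lambda>\<omega>. indicator A \<omega> :: real) \<in> borel_measurable M"
    using E_meas by (rule measurable_cong[THEN iffD1, rotated]) (rule eq)
  moreover have "A \<inter> space M = A" by (auto simp: A_def)
  ultimately have A: "A \<in> events" by (simp add: borel_measurable_indicator_iff)
  then show "{\<omega> \<in> space M. X (Z t \<omega>) \<omega> = x} \<in> events" by (simp add: A_def)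
  have "expectation (\<lambda>\<omega>. indicat_real (E (Z t \<omega>)) \<omega>) = expectation (\<lambda>\<omega>. indicat_real A \<omega>)"
    by (rule Bochner_Integration.integral_cong[OF refl eq])
  then show "prob {\<omega> \<in> space M. X (Z t \<omega>) \<omega> = x} = expectation (\<lambda>\<omega>. p (Z t \<omega>))"
    using A lim_eq by (simp add: A_def)
qed

lemma infsum_triple:
  fixes f :: "'a \<Rightarrow> 'b \<Rightarrow> 'c \<Rightarrow> real"
  assumes "(\<lambda>(i, m, r). f i m r) summable_on A \<times> B \<times> C"
  shows "(\<Sum>\<^sub>\<infinity>i\<in>A. \<Sum>\<^sub>\<infinity>m\<in>B. \<Sum>\<^sub>\<infinity>r\<in>C. f i m r) = infsum (\<lambda>(i, m, r). f i m r) (A \<times> B \<times> C)"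
proof -
  have s: "(\<lambda>(i, p). (case p of (m, r) \<Rightarrow> f i m r)) summable_on A \<times> (B \<times> C)"
    using assms by (simp add: case_prod_unfold)
  have "(\<Sum>\<^sub>\<infinity>m\<in>B. \<Sum>\<^sub>\<infinity>r\<in>C. f i m r) = infsum (\<lambda>(m, r). f i m r) (B \<times> C)" if "i \<in> A" for i
    using summable_on_SigmaD1[OF s that] by (intro infsum_Sigma'_banach)
  then have "(\<Sum>\<^sub>\<infinity>i\<in>A. \<Sum>\<^sub>\<infinity>m\<in>B. \<Sum>\<^sub>\<infinity>r\<in>C. f i m r) = (\<Sum>\<^sub>\<infinity>i\<in>A. infsum (\<lambda>(m, r). f i m r) (B \<times> C))"
    by (intro infsum_cong)
  also have "\<dots> = infsum (\<lambda>(i, p). (case p of (m, r) \<Rightarrow> f i m r)) (A \<times> (B \<times> C))"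
    by (rule infsum_Sigma'_banach[OF s])
  finally show ?thesis by simp
qed

text \<open>Passes from the full index type of the C and D series to iterated sums with m starting
  at 1.\<close>

lemma infsum_triple_pos_middle:
  fixes f :: "nat \<Rightarrow> nat \<Rightarrow> nat \<Rightarrow> real"
  assumes s: "(\<lambda>(i, m, r). f i m r) summable_on UNIV" and z: "\<And>i r. f i 0 r = 0"
  shows "(\<lambda>(i, m, r). f i m r) summable_on UNIV \<times> {1..} \<times> UNIV"
    and "(\<Sum>\<^sub>\<infinity>i. \<Sum>\<^sub>\<infinity>m\<in>{1..}. \<Sum>\<^sub>\<infinity>r. f i m r) = infsum (\<lambda>(i, m, r). f i m r) UNIV"
proof -
  show s': "(\<lambda>(i, m, r). f i m r) summable_on UNIV \<times> {1..} \<times> UNIV"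
    by (rule summable_on_subset[OF s]) simp
  have "infsum (\<lambda>(i, m, r). f i m r) (UNIV \<times> {1..} \<times> UNIV) = infsum (\<lambda>(i, m, r). f i m r) UNIV"
    by (rule infsum_cong_neutral) (use z in \<open>auto simp: Suc_le_eq intro!: gr0I\<close>)
  then show "(\<Sum>\<^sub>\<infinity>i. \<Sum>\<^sub>\<infinity>m\<in>{1..}. \<Sum>\<^sub>\<infinity>r. f i m r) = infsum (\<lambda>(i, m, r). f i m r) UNIV"
    using infsum_triple[OF s'] by simp
qed

lemma erlang_queue_transition:
  assumes "prob_space M" and Q: "erlang_queue M lam mu k Q"
  obtains P where "transition_function (queue_states k) (erlang_rate lam mu k) P"
    "\<And>t x. 0 \<le> t \<Longrightarrow> x \<in> queue_states k \<Longrightarrow> measure M {\<omega> \<in> space M. Q t \<omega> = x} = P t (0, 0) x"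
proof -
  interpret prob_space M by fact
  obtain P where P: "transition_function (queue_states k) (erlang_rate lam mu k) P"
    and fdd: "\<And>(n::nat) (\<tau> :: nat \<Rightarrow> real) (x :: nat \<Rightarrow> nat \<times> nat).
           0 \<le> \<tau> 0 \<Longrightarrow> (\<forall>i\<le>n. \<tau> i < \<tau> (Suc i)) \<Longrightarrow> (\<forall>i\<le>Suc n. x i \<in> queue_states k) \<Longrightarrow>
           0 < \<P>(\<omega> in M. \<forall>i\<le>n. Q (\<tau> i) \<omega> = x i) \<Longrightarrow>
           \<P>(\<omega> in M. Q (\<tau> (Suc n)) \<omega> = x (Suc n) \<bar> \<forall>i\<le>n. Q (\<tau> i) \<omega> = x i)
             = P (\<tau> (Suc n) - \<tau> n) (x n) (x (Suc n))"
    using Q unfolding erlang_queue_def ctmc_def by blast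
  have meas: "Q t \<in> measurable M (count_space (queue_states k))" if "0 \<le> t" for t
    using Q that unfolding erlang_queue_def ctmc_def by blast
  have Q0: "AE \<omega> in M. Q 0 \<omega> = (0, 0)"
    using Q unfolding erlang_queue_def ctmc_def by blast
  have ev: "{\<omega> \<in> space M. Q t \<omega> = x} \<in> events" if "0 \<le> t" "x \<in> queue_states k" for t x
    using measurable_sets[OF meas[OF that(1)], of "{x}"] that(2)
    by (simp add: vimage_def Int_def conj_commute)
  have S0: "(0, 0) \<in> queue_states k" by (simp add: queue_states_def)
  have prob0: "prob {\<omega> \<in> space M. Q 0 \<omega> = (0, 0)} = 1"
    using Q0 ev[OF order_refl S0] by (subst prob_Collect_eq_1) auto
  show thesis
  proof (rule that[OF P])
    fix t :: real and x assume t: "0 \<le> t" and x: "x \<in> queue_states k"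
    show "prob {\<omega> \<in> space M. Q t \<omega> = x} = P t (0, 0) x"
    \<comment> \<open>The finite-dimensional formula asks for strictly increasing times, so the
      value at 0 comes from the initial condition instead.\<close>
    proof (cases "t = 0")
      case True
      have "P 0 (0, 0) x = (if (0, 0) = x then 1 else 0)"
        using P S0 x unfolding transition_function_def by blast
      moreover have "prob {\<omega> \<in> space M. Q 0 \<omega> = x} = 0" if "x \<noteq> (0, 0)"
      proof -
        have "AE \<omega> in M. Q 0 \<omega> \<noteq> x" using Q0 by eventually_elim (use that in auto)
        then show ?thesis using ev[OF order_refl x] by (subst prob_Collect_eq_0) auto
      qed
      ultimately show ?thesis using True prob0 by auto
    next
      case False
      define \<tau> where "\<tau> = (\<lambda>i::nat. if i = 0 then 0 else t)"
      define y where "y = (\<lambda>i::nat. if i = 0 then (0, 0) else x)"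
      have "\<P>(\<omega> in M. Q (\<tau> (Suc 0)) \<omega> = y (Suc 0) \<bar> \<forall>i\<le>0. Q (\<tau> i) \<omega> = y i) = P (\<tau> (Suc 0) - \<tau> 0) (y 0) (y (Suc 0))"
        by (rule fdd) (use t False S0 x prob0 in \<open>auto simp: \<tau>_def y_def\<close>)
      then have "prob {\<omega> \<in> space M. Q t \<omega> = x \<and> Q 0 \<omega> = (0, 0)} = P t (0, 0) x"
        by (simp add: cond_prob_def \<tau>_def y_def prob0)
      moreover have "prob {\<omega> \<in> space M. Q t \<omega> = x \<and> Q 0 \<omega> = (0, 0)} = prob {\<omega> \<in> space M. Q t \<omega> = x}"
      proof (rule prob_eq_AE)
        show "AE \<omega> in M. Q t \<omega> = x \<and> Q 0 \<omega> = (0, 0) \<longleftrightarrow> Q t \<omega> = x"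
          using Q0 by eventually_elim simp
        show "{\<omega> \<in> space M. Q t \<omega> = x \<and> Q 0 \<omega> = (0, 0)} \<in> events"
          using sets.Int[OF ev[OF t x] ev[OF order_refl S0]]
          by (rule back_subst[of "\<lambda>A. A \<in> events"]) auto
      qed (rule ev[OF t x])
      ultimately show ?thesis by simp
    qed
  qed
qed

theorem theorem3p3:
  fixes M :: "'w measure"
    and Q :: "real \<Rightarrow> 'w \<Rightarrow> nat \<times> nat"
    and D :: "real \<Rightarrow> 'w \<Rightarrow> real"
    and lam mu \<alpha>1 \<alpha>2 c1 c2 t :: real
    and k n s :: nat
  assumes "0 < lam" and "0 < mu" and "1 \<le> k"
    and "0 < \<alpha>2" and "\<alpha>2 < \<alpha>1" and "\<alpha>1 < 1"
    and "0 < c1" and "0 \<le> c2" and "c1 + c2 = 1"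
    and "prob_space M"
    and "erlang_queue M lam mu k Q"
    and "mixed_stable_subordinator M \<alpha>1 \<alpha>2 c1 c2 D"
    and "prob_space.indep_set M (process_events M (count_space (queue_states k)) Q)
           (process_events M borel (inverse_process D))"
    and "1 \<le> n" and "1 \<le> s" and "s \<le> k" and "0 < t"
  shows
    "(\<lambda>i. B_coeff lam mu k n s i / c1 ^ delta_exp k n s i *
        mixed_conv (lam + real k * mu) \<alpha>1 \<alpha>2 c1 c2 (delta_exp k n s i) t) summable_on UNIV \<and>
    (\<lambda>(i, m, r). C_coeff lam mu k n s i m r / c1 ^ nu_exp k n s i m r *
        mixed_conv (lam + real k * mu) \<alpha>1 \<alpha>2 c1 c2 (nu_exp k n s i m r) t) summable_on UNIV \<times> {1..} \<times> UNIV \<and>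
    (\<lambda>(i, m, r). D_coeff lam mu k n s i m r / c1 ^ pi_exp k n s i m r *
        mixed_conv (lam + real k * mu) \<alpha>1 \<alpha>2 c1 c2 (pi_exp k n s i m r) t) summable_on UNIV \<times> {1..} \<times> UNIV \<and>
    state_prob M (time_change Q (inverse_process D)) n s t =
       (\<Sum>\<^sub>\<infinity>i. B_coeff lam mu k n s i / c1 ^ delta_exp k n s i *
          mixed_conv (lam + real k * mu) \<alpha>1 \<alpha>2 c1 c2 (delta_exp k n s i) t)
       + (\<Sum>\<^sub>\<infinity>i. \<Sum>\<^sub>\<infinity>m\<in>{1..}. \<Sum>\<^sub>\<infinity>r. C_coeff lam mu k n s i m r / c1 ^ nu_exp k n s i m r *
          mixed_conv (lam + real k * mu) \<alpha>1 \<alpha>2 c1 c2 (nu_exp k n s i m r) t)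
       - (\<Sum>\<^sub>\<infinity>i. \<Sum>\<^sub>\<infinity>m\<in>{1..}. \<Sum>\<^sub>\<infinity>r. D_coeff lam mu k n s i m r / c1 ^ pi_exp k n s i m r *
          mixed_conv (lam + real k * mu) \<alpha>1 \<alpha>2 c1 c2 (pi_exp k n s i m r) t)"
proof -
  interpret prob_space M by fact
  note Q = \<open>erlang_queue M lam mu k Q\<close>
  obtain P where P: "transition_function (queue_states k) (erlang_rate lam mu k) P"
    and prob_Q: "\<And>t x. 0 \<le> t \<Longrightarrow> x \<in> queue_states k \<Longrightarrow> prob {\<omega> \<in> space M. Q t \<omega> = x} = P t (0, 0) x"
    using erlang_queue_transition[OF \<open>prob_space M\<close> Q] by metis
  define R where "R = (\<lambda>t x y. P t (nth_state k x) (nth_state k y))"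
  interpret erlang_chain lam "real k * mu" k R mu n s
    using transition_function_nth_state[OF \<open>1 \<le> k\<close> P] assms
    by unfold_locales (auto simp: R_def)
  \<comment> \<open>Independence of the two families includes that their members are events, which
    supplies the measurability of the inverse process.\<close>
  have sub: "process_events M borel (inverse_process D) \<subseteq> events"
    using assms(13) by (simp add: indep_sets2_eq)
  interpret Y: inverse_subordinator M D \<alpha>1 \<alpha>2 c1 c2
  proof
    fix u :: real assume u: "0 \<le> u"
    show "inverse_process D u \<in> borel_measurable M"
    proof (rule measurableI)
      fix A :: "real set" assume "A \<in> sets borel"
      then have "inverse_process D u -` A \<inter> space M \<in> process_events M borel (inverse_process D)"
        unfolding process_events_def using u by (intro sigma_sets.Basic) auto
      then show "inverse_process D u -` A \<inter> space M \<in> events" using sub by blast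
    qed simp
  qed (use assms in auto)
  define W where "W = (\<lambda>N. mixed_conv \<Lambda> \<alpha>1 \<alpha>2 c1 c2 N t / c1 ^ N)"
  have \<Lambda>: "0 < \<Lambda>" using lam \<kappa> by simp
  have W: "W N = expectation (\<lambda>\<omega>. phase_density \<Lambda> N (Y.Y t \<omega>))" if "1 \<le> N" for N
    using Y.phase_mean_eq_mixed_conv[OF \<Lambda> that \<open>0 < t\<close>] by (simp add: W_def Y.phase_mean_def)
  have int: "integrable M (\<lambda>\<omega>. exp (Y.Y t \<omega> / \<theta>))"
    using Y.Y_exponential_moment[of "1 / \<theta>" t] \<theta>_pos \<open>0 < t\<close> by simp
  note E = B.expectation_S[OF Y.Y_measurable inverse_process_nonneg int]
    C.expectation_S[OF Y.Y_measurable inverse_process_nonneg int]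
    D.expectation_S[OF Y.Y_measurable inverse_process_nonneg int]
  have EB: "(\<lambda>i. B_coeff lam mu k n s i * W (delta_exp k n s i)) summable_on UNIV"
    "has_bochner_integral M (\<lambda>\<omega>. B.S (Y.Y t \<omega>)) (\<Sum>\<^sub>\<infinity>i. B_coeff lam mu k n s i * W (delta_exp k n s i))"
    using E(1,2) W[OF delta_exp_pos[OF s(2)]] by simp_all
  have EC: "(\<lambda>(i, m, r). C_coeff lam mu k n s i m r * W (nu_exp k n s i m r)) summable_on UNIV"
    "has_bochner_integral M (\<lambda>\<omega>. C.S (Y.Y t \<omega>)) (\<Sum>\<^sub>\<infinity>(i, m, r). C_coeff lam mu k n s i m r * W (nu_exp k n s i m r))"
    using E(3,4) W[OF nu_exp_pos[OF s(2)]] by (simp_all add: case_prod_unfold)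
  have ED: "(\<lambda>(i, m, r). D_coeff lam mu k n s i m r * W (pi_exp k n s i m r)) summable_on UNIV"
    "has_bochner_integral M (\<lambda>\<omega>. D.S (Y.Y t \<omega>)) (\<Sum>\<^sub>\<infinity>(i, m, r). D_coeff lam mu k n s i m r * W (pi_exp k n s i m r))"
    using E(5,6) W[OF pi_exp_pos[OF n s(2)]] by (simp_all add: case_prod_unfold)
  have zero: "C_coeff lam mu k n s i 0 r = 0" "D_coeff lam mu k n s i 0 r = 0" for i r
    by (simp_all add: C_coeff_def D_coeff_def A0_coeff_def)
  note C3 = infsum_triple_pos_middle[OF EC(1)] and D3 = infsum_triple_pos_middle[OF ED(1)]
  have state: "nth_state k (k * (n - 1) + s) = (n, s)"
    using nth_state_busy[OF s, of "n - 1"] n by simp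
  have ns: "(n, s) \<in> queue_states k" using n s by (simp add: queue_states_def busy_states_def)
  have Q_right: "\<forall>\<^sub>F v in at_right u. Q v \<omega> = Q u \<omega>" if "\<omega> \<in> space M" "0 \<le> u" for \<omega> u
    using Q that unfolding erlang_queue_def ctmc_def by blast
  have prob_ns: "prob {\<omega> \<in> space M. Q u \<omega> = (n, s)} = R u 0 (k * (n - 1) + s)" if "0 \<le> u" for u
    by (simp only: R_def state nth_state_0 prob_Q[OF that ns])
  note time = prob_at_independent_time[OF assms(13) less_imp_le[OF \<open>0 < t\<close>] inverse_process_nonneg ns
      Q_right prob_ns R_continuous]
  \<comment> \<open>The inverse process is 0 at time 0, so the conditioning event is that Q starts
    empty, which has probability 1.\<close>
  have "state_prob M (time_change Q (inverse_process D)) n s t = prob {\<omega> \<in> space M. Q (Y.Y t \<omega>) \<omega> = (n, s)}"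
  proof -
    let ?A = "{\<omega> \<in> space M. Q (Y.Y t \<omega>) \<omega> = (n, s)}"
    have meas0: "Q 0 \<in> measurable M (count_space (queue_states k))" and Q0: "AE \<omega> in M. Q 0 \<omega> = (0, 0)"
      using Q unfolding erlang_queue_def ctmc_def by blast+
    have ev0: "{\<omega> \<in> space M. Q 0 \<omega> = (0, 0)} \<in> events"
      using measurable_sets[OF meas0, of "{(0, 0)}"]
      by (simp add: vimage_def Int_def conj_commute queue_states_def)
    have "prob {\<omega> \<in> space M. Q 0 \<omega> = (0, 0)} = 1"
      using Q0 ev0 by (subst prob_Collect_eq_1) auto
    moreover have "prob {\<omega> \<in> space M. Q (Y.Y t \<omega>) \<omega> = (n, s) \<and> Q 0 \<omega> = (0, 0)} = prob ?A"
    proof (rule prob_eq_AE)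
      show "AE \<omega> in M. Q (Y.Y t \<omega>) \<omega> = (n, s) \<and> Q 0 \<omega> = (0, 0) \<longleftrightarrow> Q (Y.Y t \<omega>) \<omega> = (n, s)"
        using Q0 by eventually_elim simp
      show "{\<omega> \<in> space M. Q (Y.Y t \<omega>) \<omega> = (n, s) \<and> Q 0 \<omega> = (0, 0)} \<in> events"
        using sets.Int[OF time(1) ev0] by (rule back_subst[of "\<lambda>A. A \<in> events"]) auto
    qed (rule time(1))
    ultimately show ?thesis
      by (simp add: state_prob_def cond_prob_def time_change_def inverse_process_def[of D 0])
  qed
  also have "\<dots> = expectation (\<lambda>\<omega>. R (Y.Y t \<omega>) 0 (k * (n - 1) + s))"
    by (rule time(2))
  also have "\<dots> = expectation (\<lambda>\<omega>. B.S (Y.Y t \<omega>) + C.S (Y.Y t \<omega>) - D.S (Y.Y t \<omega>))"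
    by (simp only: transition_probability[OF inverse_process_nonneg])
  also have "\<dots> = (\<Sum>\<^sub>\<infinity>i. B_coeff lam mu k n s i * W (delta_exp k n s i))
      + (\<Sum>\<^sub>\<infinity>(i, m, r). C_coeff lam mu k n s i m r * W (nu_exp k n s i m r))
      - (\<Sum>\<^sub>\<infinity>(i, m, r). D_coeff lam mu k n s i m r * W (pi_exp k n s i m r))"
    by (intro has_bochner_integral_integral_eq has_bochner_integral_diff has_bochner_integral_add EB EC ED)
  finally show ?thesis
    using EB(1) C3 D3 zero by (simp add: W_def)
qed

end
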